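(* Let $k$ be a field, $d\geqslant 1$, let $R=k[x_1,\dots,x_d]_{\mathfrak m}$ with $\mathfrak m=(x_1,\dots,x_d)$, and let $I\subset R$ be a monomial ideal (an ideal generated by monomials in $x_1,\dots,x_d$). Then the sequence $\frac{d!}{n^d}\lambda_R\big(\operatorname{H}^0_{\mathfrak m}(R/I^n)\big)$ converges as $n\to\infty$ (i.e. the $\limsup$ in the definition of $\varepsilon(I)$ is a limit), and $$\varepsilon(I)=d!\,\operatorname{vol}(\operatorname{out}(I)),$$ which is a rational number.
   Context: The $\varepsilon$-multiplicity of $I$ is $$\varepsilon(I)=\limsup_{n\to\infty}\frac{d!}{n^d}\lambda_R\big(\operatorname{H}^0_{\mathfrak m}(R/I^n)\big),$$ where $\lambda_R$ is length and $\operatorname{H}^0_{\mathfrak m}(M)=(0:_M\mathfrak m^\infty)$ is the set of elements of $M$ annihilated by some power of $\mathfrak m$. The analytic spread $l(I)$ is the Krull dimension of the special fiber ring $\bigoplus_{n\geqslant 0}I^n/\mathfrak m I^n$; $I$ has maximal analytic spread if $l(I)=\dim R=d$. If $I$ is minimally generated by the monomials $x^{v_1},\dots,x^{v_n}$ with $v_i\in\mathbb Z^d_{\geqslant 0}$, the Newton polyhedron of $I$ is $\operatorname{conv}(I)=\operatorname{conv}(v_1,\dots,v_n)+\mathbb R^d_{\geqslant 0}$ (Minkowski sum). Let $H_i=\{x\in\mathbb R^d\mid\langle x,b_i\rangle=c_i\}$, with $b_i\in\mathbb Q^d$, $c_i\in\mathbb Q$, $i=1,\dots,w$, be the supporting hyperplanes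 of $\operatorname{conv}(I)$ along its facets $\mathcal F_i=H_i\cap\operatorname{conv}(I)$ (one for each $(d-1)$-dimensional face), with signs chosen so that $\operatorname{conv}(I)=H_1^+\cap\dots\cap H_w^+$, where $H_i^+=\{x\in\mathbb R^d\mid\langle x,b_i\rangle\geqslant c_i\}$. Put $H_i^-=\{x\in\mathbb R^d\mid\langle x,b_i\rangle\leqslant c_i\}$. The numbering is such that $H_1,\dots,H_u$ correspond to the unbounded facets and $H_{u+1},\dots,H_w$ to the bounded facets. If $I$ has maximal analytic spread, set $$\operatorname{out}(I)=\mathbb R^d_{\geqslant 0}\cap(H_1^+\cap\dots\cap H_u^+)\cap(H_{u+1}^-\cup\dots\cup H_w^-)$$ (an empty intersection of half-spaces being $\mathbb R^d$), and otherwise set $\operatorname{out}(I)=\emptyset$. Here $\operatorname{vol}$ is $d$-dimensional Lebesgue measure. *)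

theory Defs
  imports
    "HOL-Analysis.Analysis"
    "HOL-Library.Poly_Mapping"
    "HOL-Algebra.Ideal_Product"
    "HOL-Algebra.QuotRing"
    "HOL-Algebra.Module"
    "HOL-Algebra.Algebraic_Closure_Type"
begin

section \<open>Localization\<close>

definition loc_rel ::
  "('a, 'b) ring_scheme \<Rightarrow> 'a set \<Rightarrow> (('a \<times> 'a) \<times> ('a \<times> 'a)) set" where
  "loc_rel A S = {((a, s), (b, t)).
     a \<in> carrier A \<and> s \<in> S \<and> b \<in> carrier A \<and> t \<in> S \<and>
     (\<exists>u\<in>S. u \<otimes>\<^bsub>A\<^esub> (a \<otimes>\<^bsub>A\<^esub> t) = u \<otimes>\<^bsub>A\<^esub> (b \<otimes>\<^bsub>A\<^esub> s))}"

definition loc_frac :: "('a, 'b) ring_scheme \<Rightarrow> 'a set \<Rightarrow> 'a \<Rightarrow> 'a \<Rightarrow> ('a \<times> 'a) set" where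
  "loc_frac A S a s = loc_rel A S `` {(a, s)}"

definition localization :: "('a, 'b) ring_scheme \<Rightarrow> 'a set \<Rightarrow> ('a \<times> 'a) set ring" where
  "localization A S =
     \<lparr> carrier = (carrier A \<times> S) // loc_rel A S,
       mult = (\<lambda>U V. \<Union>(a, s)\<in>U. \<Union>(b, t)\<in>V. loc_frac A S (a \<otimes>\<^bsub>A\<^esub> b) (s \<otimes>\<^bsub>A\<^esub> t)),
       one = loc_frac A S \<one>\<^bsub>A\<^esub> \<one>\<^bsub>A\<^esub>,
       zero = loc_frac A S \<zero>\<^bsub>A\<^esub> \<one>\<^bsub>A\<^esub>,
       add = (\<lambda>U V. \<Union>(a, s)\<in>U. \<Union>(b, t)\<in>V.
                loc_frac A S ((a \<otimes>\<^bsub>A\<^esub> t) \<oplus>\<^bsub>A\<^esub> (b \<otimes>\<^bsub>A\<^esub> s)) (s \<otimes>\<^bsub>A\<^esub> t)) \<rparr>"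


section \<open>Length, Krull dimension, local cohomology in degree 0, special fiber ring\<close>

definition module_length :: "('a, 'b) ring_scheme \<Rightarrow> ('a, 'c, 'd) module_scheme \<Rightarrow> enat" where
  "module_length R M = Sup {enat n | n.
     \<exists>N. (\<forall>i\<le>n. submodule (N i) R M) \<and> (\<forall>i<n. N i \<subset> N (Suc i))}"

definition krull_dim :: "('a, 'b) ring_scheme \<Rightarrow> enat" where
  "krull_dim R = Sup {enat n | n.
     \<exists>P. (\<forall>i\<le>n. primeideal (P i) R) \<and> (\<forall>i<n. P i \<subset> P (Suc i))}"

abbreviation ideal_pow :: "('a, 'b) ring_scheme \<Rightarrow> 'a set \<Rightarrow> nat \<Rightarrow> 'a set" where
  "ideal_pow R I n \<equiv> I [^]\<^bsub>ideals_set R\<^esub> n"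

text \<open>The ring \<open>R/J\<close> regarded as an \<open>R\<close>-module.\<close>

definition quot_module :: "('a, 'b) ring_scheme \<Rightarrow> 'a set \<Rightarrow> ('a, 'a set) module" where
  "quot_module R J =
     \<lparr> carrier = carrier (R Quot J), mult = mult (R Quot J), one = one (R Quot J),
       zero = zero (R Quot J), add = add (R Quot J),
       smult = (\<lambda>a U. (J +>\<^bsub>R\<^esub> a) \<otimes>\<^bsub>R Quot J\<^esub> U) \<rparr>"

definition H0 ::
  "('a, 'b) ring_scheme \<Rightarrow> 'a set \<Rightarrow> ('a, 'c, 'd) module_scheme \<Rightarrow> ('a, 'c, 'd) module_scheme" where
  "H0 R \<mm> M = M\<lparr>carrier :=
     {x \<in> carrier M. \<exists>j. \<forall>a \<in> ideal_pow R \<mm> j. a \<odot>\<^bsub>M\<^esub> x = \<zero>\<^bsub>M\<^esub>}\<rparr>"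

text \<open>
  The special fiber ring, the direct sum of the \<open>I\<^sup>n/\<mm>I\<^sup>n\<close>.  An element is the sequence
  of its homogeneous components, each of which is a coset of \<open>\<mm>I\<^sup>n\<close> in \<open>I\<^sup>n\<close>.
  The product of \<open>a + \<mm>I\<^sup>i\<close> and \<open>b + \<mm>I\<^sup>j\<close> is \<open>ab + \<mm>I\<^bsup>i+j\<^esup>\<close>, which is what
  \<open>rcoset_mult R (\<mm>I\<^bsup>i+j\<^esup>)\<close> computes when applied to these two cosets.
\<close>

definition fiber_ring :: "('a, 'b) ring_scheme \<Rightarrow> 'a set \<Rightarrow> 'a set \<Rightarrow> (nat \<Rightarrow> 'a set) ring" where
  "fiber_ring R \<mm> I = (let J = (\<lambda>n. ideal_prod R \<mm> (ideal_pow R I n)) in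
     \<lparr> carrier = {f. (\<forall>n. f n \<in> (\<lambda>a. J n +>\<^bsub>R\<^esub> a) ` ideal_pow R I n) \<and> finite {n. f n \<noteq> J n}},
       mult = (\<lambda>f g n. finsum (R Quot J n) (\<lambda>i. rcoset_mult R (J n) (f i) (g (n - i))) {..n}),
       one = (\<lambda>n. if n = 0 then J n +>\<^bsub>R\<^esub> \<one>\<^bsub>R\<^esub> else J n),
       zero = J,
       add = (\<lambda>f g n. f n <+>\<^bsub>R\<^esub> g n) \<rparr>)"


section \<open>The local ring $k[x_1, \ldots, x_d]_{\mathfrak m}$ and its monomial ideals\<close>

text \<open>
  The variables are indexed by a finite type \<open>'n\<close>, so \<open>d = CARD('n)\<close>; a polynomial is a finitely
  supported map from exponent vectors to coefficients.
\<close>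

type_synonym ('n, 'k) mpoly = "('n \<Rightarrow>\<^sub>0 nat) \<Rightarrow>\<^sub>0 'k"

type_synonym ('n, 'k) loc_mpoly = "(('n, 'k) mpoly \<times> ('n, 'k) mpoly) set"

definition mpoly_ring :: "('n::finite, 'k::field) mpoly ring" where
  "mpoly_ring = ring_of_type_algebra"

definition monom_pol :: "('n \<Rightarrow>\<^sub>0 nat) \<Rightarrow> ('n::finite, 'k::field) mpoly" where
  "monom_pol v = Poly_Mapping.single v 1"

definition var_pol :: "'n \<Rightarrow> ('n::finite, 'k::field) mpoly" where
  "var_pol i = monom_pol (Poly_Mapping.single i 1)"

definition nonvanishing :: "('n::finite, 'k::field) mpoly set" where
  "nonvanishing = carrier mpoly_ring - genideal mpoly_ring (range var_pol)"

definition loc_ring :: "('n::finite, 'k::field) loc_mpoly ring" where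
  "loc_ring = localization mpoly_ring nonvanishing"

definition in_loc :: "('n::finite, 'k::field) mpoly \<Rightarrow> ('n, 'k) loc_mpoly" where
  "in_loc p = loc_frac mpoly_ring nonvanishing p 1"

definition max_id :: "('n::finite, 'k::field) loc_mpoly set" where
  "max_id = genideal loc_ring (range (\<lambda>i. in_loc (var_pol i)))"

definition ideal_of_exps :: "('n \<Rightarrow>\<^sub>0 nat) set \<Rightarrow> ('n::finite, 'k::field) loc_mpoly set" where
  "ideal_of_exps V = genideal loc_ring ((\<lambda>v. in_loc (monom_pol v)) ` V)"

definition monomial_ideal :: "('n::finite, 'k::field) loc_mpoly set \<Rightarrow> bool" where
  "monomial_ideal I \<longleftrightarrow> (\<exists>V. I = ideal_of_exps V)"


section \<open>The epsilon multiplicity and the analytic spread\<close>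

definition eps_seq :: "('n::finite, 'k::field) loc_mpoly set \<Rightarrow> nat \<Rightarrow> ennreal" where
  "eps_seq I n = ennreal (fact CARD('n) / real n ^ CARD('n)) *
     ennreal_of_enat (module_length loc_ring
       (H0 loc_ring max_id (quot_module loc_ring (ideal_pow loc_ring I n))))"

definition eps_mult :: "('n::finite, 'k::field) loc_mpoly set \<Rightarrow> ennreal" where
  "eps_mult I = limsup (eps_seq I)"

definition analytic_spread :: "('n::finite, 'k::field) loc_mpoly set \<Rightarrow> enat" where
  "analytic_spread I = krull_dim (fiber_ring loc_ring max_id I)"

definition max_analytic_spread :: "('n::finite, 'k::field) loc_mpoly set \<Rightarrow> bool" where
  "max_analytic_spread I \<longleftrightarrow> analytic_spread I = enat CARD('n)"


section \<open>The Newton polyhedron and the region out(I)\<close>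

definition real_exp :: "('n \<Rightarrow>\<^sub>0 nat) \<Rightarrow> real ^ 'n::finite" where
  "real_exp v = (\<chi> i. real (Poly_Mapping.lookup v i))"

definition orthant :: "(real ^ 'n::finite) set" where
  "orthant = {x. \<forall>i. 0 \<le> x $ i}"

definition minimally_generates ::
  "('n \<Rightarrow>\<^sub>0 nat) set \<Rightarrow> ('n::finite, 'k::field) loc_mpoly set \<Rightarrow> bool" where
  "minimally_generates V I \<longleftrightarrow>
     ideal_of_exps V = I \<and> (\<forall>W. W \<subset> V \<longrightarrow> ideal_of_exps W \<noteq> I)"

text \<open>
  A monomial ideal has exactly one minimal set of monomial generators, so the description below
  determines the exponent set of the minimal generators.
\<close>

definition min_exps :: "('n::finite, 'k::field) loc_mpoly set \<Rightarrow> ('n \<Rightarrow>\<^sub>0 nat) set" where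
  "min_exps I = (THE V. minimally_generates V I)"

definition newton_polyhedron :: "('n::finite, 'k::field) loc_mpoly set \<Rightarrow> (real ^ 'n) set" where
  "newton_polyhedron I = {x + y | x y. x \<in> convex hull (real_exp ` min_exps I) \<and> y \<in> orthant}"

text \<open>
  \<open>facet_ineq P F b c\<close>: \<open>F\<close> is a facet of \<open>P\<close> with supporting hyperplane \<open>\<langle>x, b\<rangle> = c\<close>, the
  sign being chosen such that \<open>P\<close> lies in \<open>\<langle>x, b\<rangle> \<ge> c\<close>.  For full-dimensional \<open>P\<close> the pair
  \<open>(b, c)\<close> is determined by \<open>F\<close> up to a positive factor, so the half-spaces below depend on
  \<open>F\<close> only.
\<close>

definition facet_ineq ::
  "(real ^ 'n::finite) set \<Rightarrow> (real ^ 'n) set \<Rightarrow> real ^ 'n \<Rightarrow> real \<Rightarrow> bool" where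
  "facet_ineq P F b c \<longleftrightarrow>
     F facet_of P \<and> b \<noteq> 0 \<and> (\<forall>i. b $ i \<in> \<rat>) \<and> c \<in> \<rat> \<and>
     F = {x. x \<bullet> b = c} \<inter> P \<and> P \<subseteq> {x. x \<bullet> b \<ge> c}"

definition out_region :: "('n::finite, 'k::field) loc_mpoly set \<Rightarrow> (real ^ 'n) set" where
  "out_region I = (if max_analytic_spread I
     then orthant
       \<inter> \<Inter> {{x. x \<bullet> b \<ge> c} | F b c. facet_ineq (newton_polyhedron I) F b c \<and> \<not> bounded F}
       \<inter> \<Union> {{x. x \<bullet> b \<le> c} | F b c. facet_ineq (newton_polyhedron I) F b c \<and> bounded F}
     else {})"

end

theory Submission
  imports Defs
begin

text \<open>Everything reduces to exponent vectors.  If \<open>E\<^sub>n\<close> is the set of exponents of the monomials in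
  \<open>I\<^sup>n\<close>, and \<open>sat E\<^sub>n\<close> consists of the exponents that enter \<open>E\<^sub>n\<close> after increasing any single
  coordinate sufficiently, then the length in question is the number of elements of \<open>sat E\<^sub>n - E\<^sub>n\<close>.
  Rescaled by \<open>1/n\<close> these points fill the region between the Newton polyhedron \<open>P\<close> and the
  intersection of its saturations along the coordinate axes, so the count divided by \<open>n\<^sup>d\<close>
  converges to the volume of that region.  Dropping the facet inequalities with a vanishing normal
  coordinate, which are those of the unbounded facets, describes the intersection of the saturations;
  hence the region is the one cut out by the bounded facets, up to a null set.

  If \<open>P\<close> has a bounded facet \<open>F\<close>, a flag of faces of \<open>F\<close> gives a chain of primes of length \<open>d\<close> in the
  special fiber ring: a face \<open>G\<close> yields the classes supported away from the exponents in the cone over \<open>G\<close>.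
  A chain of primes of length \<open>m\<close> conversely produces \<open>m\<close> elements with linearly independent
  products, and counting monomials forces \<open>m \<le> d\<close>.  So without maximal analytic spread there are no
  bounded facets, and both sides vanish.

  Rationality holds because along an arithmetic progression \<open>N \<cdot> k\<close> the count is eventually a
  polynomial in \<open>k\<close> with rational coefficients: it is the difference of the Hilbert functions of two
  finitely generated graded monoids.\<close>

text \<open>Two difficulties shape the argument. First, the ideals live in a localization, while
  counting needs exponents. A denominator has a nonzero constant term, so multiplying by it
  preserves every lowest-degree term outside an upward closed set; membership in a monomial ideal
  can therefore be read off any numerator, and modulo \<open>max_id\<close> a denominator is a
  constant. Second, a lattice point of the dilated polyhedron n P need not be an exponent of I^n.
  Rounding down the coefficients of a convex combination loses at most \<open>card V\<close>
  generators, hence a vector bounded independently of n. After rescaling the error is a shift of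
  order 1/n, and such shifts of convex sets are invisible in the limit because convex sets have null
  boundaries. Saturation fits into both arguments: inverting a variable deletes a coordinate of the
  generators, and this commutes with powers, so the saturation of I^n is an intersection of n-th
  powers of fixed monomial ideals. Convergence and rationality are obtained independently: the
  volume gives the limit, and the polynomial on a subsequence shows that its value is
  rational.\<close>

abbreviation (input) lookup :: "('a \<Rightarrow>\<^sub>0 'b::zero) \<Rightarrow> 'a \<Rightarrow> 'b" where
  "lookup \<equiv> Poly_Mapping.lookup"

abbreviation (input) keys :: "('a \<Rightarrow>\<^sub>0 'b::zero) \<Rightarrow> 'a set" where
  "keys \<equiv> Poly_Mapping.keys"

section \<open>Exponent vectors\<close>

text \<open>Divisibility of monomials, read on exponents. The order that comes with the type is a
  total monomial order, which serves in \<open>evpoly_card_graded_monoid\<close>; the partial order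
  has a name of its own.\<close>

definition ple :: "('a \<Rightarrow>\<^sub>0 nat) \<Rightarrow> ('a \<Rightarrow>\<^sub>0 nat) \<Rightarrow> bool" where
  "ple v w \<longleftrightarrow> (\<forall>i. lookup v i \<le> lookup w i)"

definition upc :: "('a \<Rightarrow>\<^sub>0 nat) set \<Rightarrow> ('a \<Rightarrow>\<^sub>0 nat) set" where
  "upc V = {u. \<exists>v\<in>V. ple v u}"

definition minl :: "('a \<Rightarrow>\<^sub>0 nat) set \<Rightarrow> ('a \<Rightarrow>\<^sub>0 nat) set" where
  "minl U = {u \<in> U. \<forall>w\<in>U. ple w u \<longrightarrow> w = u}"

text \<open>These are the exponent sets of monomial ideals; \<open>upc\<close> yields the ideal
  generated by given monomials, and \<open>minl\<close> its minimal generators.\<close>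

definition upclosed :: "('a \<Rightarrow>\<^sub>0 nat) set \<Rightarrow> bool" where
  "upclosed U \<longleftrightarrow> (\<forall>u\<in>U. \<forall>w. u + w \<in> U)"

lemma ple_refl [simp]: "ple v v"
  by (simp add: ple_def)

lemma ple_trans: "ple u v \<Longrightarrow> ple v w \<Longrightarrow> ple u w"
  unfolding ple_def by (meson le_trans)

lemma ple_add [simp]: "ple v (v + w)"
  by (simp add: ple_def lookup_add)

lemma ple_diff_add: "ple v w \<Longrightarrow> v + (w - v) = w"
  by (rule poly_mapping_eqI) (simp add: ple_def lookup_add lookup_minus)

lemma ple_add_mono: "ple a b \<Longrightarrow> ple c d \<Longrightarrow> ple (a + c) (b + d)"
  by (simp add: ple_def lookup_add add_mono)

lemma ple_keys: "ple v w \<Longrightarrow> keys v \<subseteq> keys w"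
  unfolding ple_def by (metis in_keys_iff le_zero_eq subsetI)

lemma upclosed_ple: "upclosed U \<Longrightarrow> u \<in> U \<Longrightarrow> ple u w \<Longrightarrow> w \<in> U"
  unfolding upclosed_def by (metis ple_diff_add)

lemma upclosed_upc: "upclosed (upc V)"
  unfolding upclosed_def upc_def using ple_trans[OF _ ple_add] by blast

lemma subset_upc: "V \<subseteq> upc V"
  unfolding upc_def by force

lemma upc_subset: "upclosed U \<Longrightarrow> V \<subseteq> U \<Longrightarrow> upc V \<subseteq> U"
  unfolding upc_def using upclosed_ple by blast

text \<open>The core of Dickson's lemma: monotone subsequences are extracted for one coordinate
  after the other, and passing to a further subsequence keeps what was achieved before.\<close>

lemma mono_subseq:
  fixes f :: "nat \<Rightarrow> 'j \<Rightarrow> nat"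
  assumes "finite J"
  shows "\<exists>s::nat\<Rightarrow>nat. strict_mono s \<and> (\<forall>j\<in>J. incseq (\<lambda>k. f (s k) j))"
  using assms
proof (induction J)
  case empty
  show ?case by (auto intro: exI[of _ id] strict_mono_id)
next
  case (insert x J)
  then obtain s :: "nat \<Rightarrow> nat" where s: "strict_mono s" "\<forall>j\<in>J. incseq (\<lambda>k. f (s k) j)" by blast
  obtain t :: "nat \<Rightarrow> nat" where t: "strict_mono t" "monoseq (\<lambda>k. f (s (t k)) x)"
    using seq_monosub[of "\<lambda>k. f (s k) x"] by auto
  have mt: "incseq (\<lambda>k. f (s (t k)) j)" if "j \<in> J" for j
    using s(2) that t(1) unfolding incseq_def by (simp add: strict_mono_less_eq)
  show ?case
  proof (cases "incseq (\<lambda>k. f (s (t k)) x)")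
    case True
    moreover have "strict_mono (\<lambda>k. s (t k))"
      using s(1) t(1) by (simp add: strict_mono_def)
    ultimately show ?thesis using mt by (intro exI[of _ "\<lambda>k. s (t k)"]) auto
  next
    case False
    hence dec: "decseq (\<lambda>k. f (s (t k)) x)" using t(2) monoseq_iff by blast
    \<comment> \<open>A decreasing sequence of naturals is constant from the place of its minimum
      on, so its tail counts as increasing as well.\<close>
    obtain m where m: "\<forall>k. f (s (t m)) x \<le> f (s (t k)) x"
      using ex_has_least_nat[of "\<lambda>_. True" 0 "\<lambda>k. f (s (t k)) x"] by auto
    have const: "f (s (t (m + k))) x = f (s (t m)) x" for k
      using dec m unfolding decseq_def by (meson le_add1 le_antisym)
    have "strict_mono (\<lambda>k. s (t (m + k)))"
      using s(1) t(1) by (simp add: strict_mono_def)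
    moreover have "incseq (\<lambda>k. f (s (t (m + k))) j)" if "j \<in> insert x J" for j
      using that mt const by (auto simp: incseq_def)
    ultimately show ?thesis by (intro exI[of _ "\<lambda>k. s (t (m + k))"]) auto
  qed
qed

lemma minl_subset: "minl U \<subseteq> U"
  unfolding minl_def by blast

text \<open>Dickson's lemma. Minimal elements are pairwise incomparable, whereas an infinite
  sequence with finitely many relevant coordinates has two comparable terms. The support bound
  \<open>J\<close> allows index types that are infinite, as in
  \<open>mgen_Int_finite\<close>.\<close>

lemma finite_minl:
  assumes "finite J" "\<And>u. u \<in> U \<Longrightarrow> keys u \<subseteq> J"
  shows "finite (minl U)"
proof (rule ccontr)
  assume "infinite (minl U)"
  then obtain f :: "nat \<Rightarrow> 'a \<Rightarrow>\<^sub>0 nat" where f: "inj f" "range f \<subseteq> minl U"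
    using infinite_countable_subset by blast
  obtain s :: "nat \<Rightarrow> nat" where s: "strict_mono s" "\<forall>j\<in>J. incseq (\<lambda>k. lookup (f (s k)) j)"
    using mono_subseq[OF assms(1), of "\<lambda>k. lookup (f k)"] by blast
  have in_minl: "f k \<in> minl U" for k using f(2) by blast
  have "ple (f (s 0)) (f (s 1))"
    unfolding ple_def
  proof
    fix i
    show "lookup (f (s 0)) i \<le> lookup (f (s 1)) i"
    proof (cases "i \<in> J")
      case True then show ?thesis using s(2) by (simp add: incseq_def)
    next
      case False
      hence "i \<notin> keys (f (s 0))" using assms(2) in_minl minl_subset by blast
      then show ?thesis by (simp add: in_keys_iff)
    qed
  qed
  hence "f (s 0) = f (s 1)" using in_minl unfolding minl_def by blast
  hence "s 0 = s 1" using f(1) by (simp add: inj_eq)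
  thus False using s(1) by (metis less_irrefl_nat strict_mono_def zero_less_one)
qed

lemma minl_below:
  assumes "u \<in> U"
  shows "\<exists>w\<in>minl U. ple w u"
  using assms
proof (induction "\<Sum>i\<in>keys u. lookup u i" arbitrary: u rule: less_induct)
  case less
  show ?case
  proof (cases "u \<in> minl U")
    case True
    show ?thesis using bexI[OF ple_refl True] .
  next
    case False
    then obtain w where w: "w \<in> U" "ple w u" "w \<noteq> u" using less(2) unfolding minl_def by blast
    have "(\<Sum>i\<in>keys w. lookup w i) = (\<Sum>i\<in>keys u. lookup w i)"
      using ple_keys[OF w(2)] by (intro sum.mono_neutral_left) (auto simp: in_keys_iff)
    also have "\<dots> < (\<Sum>i\<in>keys u. lookup u i)"
    proof (rule sum_strict_mono_ex1)
      show "\<forall>x\<in>keys u. lookup w x \<le> lookup u x" using w(2) by (simp add: ple_def)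
      obtain i where i: "lookup w i \<noteq> lookup u i" using w(3) by (meson poly_mapping_eqI)
      hence "lookup w i < lookup u i" using w(2) by (simp add: ple_def order_less_le)
      thus "\<exists>a\<in>keys u. lookup w a < lookup u a" by (intro bexI[of _ i]) (auto simp: in_keys_iff)
    qed simp
    finally have "\<exists>x\<in>minl U. ple x w" by (rule less(1)[OF _ w(1)])
    then obtain x where "x \<in> minl U" "ple x w" by blast
    then show ?thesis using ple_trans[OF _ w(2)] by blast
  qed
qed

lemma upc_minl:
  assumes "upclosed U"
  shows "upc (minl U) = U"
proof
  show "upc (minl U) \<subseteq> U" by (rule upc_subset[OF assms minl_subset])
  show "U \<subseteq> upc (minl U)" unfolding upc_def using minl_below by auto
qed

lemma minl_upc_subset: "minl (upc V) \<subseteq> V"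
proof
  fix u assume u: "u \<in> minl (upc V)"
  then obtain v where v: "v \<in> V" "ple v u" unfolding minl_def upc_def by blast
  hence "v = u" using u subset_upc unfolding minl_def by blast
  thus "u \<in> V" using v by simp
qed

section \<open>Total degree of an exponent\<close>

definition pdeg :: "('n::finite \<Rightarrow>\<^sub>0 nat) \<Rightarrow> nat" where
  "pdeg v = (\<Sum>i\<in>UNIV. lookup v i)"

lemma pdeg_add: "pdeg (v + w) = pdeg v + pdeg w"
  by (simp add: pdeg_def lookup_add sum.distrib)

lemma pdeg_0 [simp]: "pdeg 0 = 0"
  by (simp add: pdeg_def)

lemma pdeg_eq_0_iff [simp]: "pdeg v = 0 \<longleftrightarrow> v = 0"
proof
  assume "pdeg v = 0"
  hence "lookup v i = lookup 0 i" for i by (simp add: pdeg_def)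
  thus "v = 0" by (rule poly_mapping_eqI)
qed simp

lemma pdeg_single [simp]: "pdeg (Poly_Mapping.single i k) = k"
  unfolding pdeg_def lookup_single when_def by (simp add: sum.delta)

lemma lookup_le_pdeg: "lookup v i \<le> pdeg v"
  unfolding pdeg_def by (rule member_le_sum) auto

lemma pdeg_mono: "ple v w \<Longrightarrow> pdeg v \<le> pdeg w"
  by (simp add: pdeg_def ple_def sum_mono)

lemma pdeg_Suc_obtain:
  assumes "pdeg v = Suc k"
  obtains i w where "v = Poly_Mapping.single i 1 + w" "pdeg w = k"
proof -
  have "v \<noteq> 0" using assms by auto
  then obtain i where i: "lookup v i \<noteq> 0" by (metis lookup_zero poly_mapping_eqI)
  have "ple (Poly_Mapping.single i 1) v"
    using i by (auto simp: ple_def lookup_single when_def)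
  hence "v = Poly_Mapping.single i 1 + (v - Poly_Mapping.single i 1)" by (simp add: ple_diff_add)
  moreover from this have "pdeg v = 1 + pdeg (v - Poly_Mapping.single i 1)" 
    by (metis pdeg_add pdeg_single)
  ultimately show thesis using that assms by simp
qed

lemma finite_bounded_exps: "finite {v :: 'n::finite \<Rightarrow>\<^sub>0 nat. \<forall>i. lookup v i \<le> K}"
proof (rule finite_imageD)
  show "finite (lookup ` {v :: 'n \<Rightarrow>\<^sub>0 nat. \<forall>i. lookup v i \<le> K})"
    by (rule finite_subset[OF _ finite_PiE[of UNIV "\<lambda>_. {..K}"]]) (auto simp: PiE_def)
  show "inj_on lookup {v :: 'n \<Rightarrow>\<^sub>0 nat. \<forall>i. lookup v i \<le> K}"
    by (simp add: inj_on_def lookup_inject)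
qed

subsection \<open>Exponents of powers of a monomial ideal\<close>

primrec nsum :: "('a \<Rightarrow>\<^sub>0 nat) set \<Rightarrow> nat \<Rightarrow> ('a \<Rightarrow>\<^sub>0 nat) set" where
  "nsum V 0 = {0}"
| "nsum V (Suc n) = {u + v | u v. u \<in> nsum V n \<and> v \<in> V}"

text \<open>The exponents of the monomials in the n-th power of the ideal generated by
  \<open>V\<close>, as \<open>ideal_pow_mono_ideal\<close> confirms; \<open>nsum\<close> consists of
  the products of exactly n generators.\<close>

definition pexps :: "('a \<Rightarrow>\<^sub>0 nat) set \<Rightarrow> nat \<Rightarrow> ('a \<Rightarrow>\<^sub>0 nat) set" where
  "pexps V n = upc (nsum V n)"

lemma upclosed_pexps [simp]: "upclosed (pexps V n)"
  by (simp add: pexps_def upclosed_upc)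

lemma pexps_0 [simp]: "pexps V 0 = UNIV"
  by (auto simp: pexps_def upc_def ple_def)

lemma nsum_add: "nsum V (n + m) = {u + v | u v. u \<in> nsum V n \<and> v \<in> nsum V m}"
proof (induction m)
  case 0 show ?case by simp
next
  case (Suc m)
  show ?case
  proof (intro equalityI subsetI)
    fix x assume "x \<in> nsum V (n + Suc m)"
    then obtain u v w where "x = u + v + w" "u \<in> nsum V n" "v \<in> nsum V m" "w \<in> V" 
      using Suc by auto
    thus "x \<in> {u + v | u v. u \<in> nsum V n \<and> v \<in> nsum V (Suc m)}"
      by (smt (verit) add.assoc mem_Collect_eq nsum.simps(2))
  next
    fix x assume "x \<in> {u + v | u v. u \<in> nsum V n \<and> v \<in> nsum V (Suc m)}"
    then obtain u v w where "x = u + v + w" "u \<in> nsum V n" "v \<in> nsum V m" "w \<in> V" 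
      by (force simp: add.assoc)
    thus "x \<in> nsum V (n + Suc m)" using Suc by auto
  qed
qed

lemma nsum_1 [simp]: "nsum V (Suc 0) = V"
  by auto

lemma pexps_1: "pexps V (Suc 0) = upc V"
  by (simp only: pexps_def nsum_1)

lemma pexps_add: "pexps V (n + m) = {u + v | u v. u \<in> pexps V n \<and> v \<in> pexps V m}"
proof (intro equalityI subsetI)
  fix x assume "x \<in> pexps V (n + m)"
  then obtain s t where st: "s \<in> nsum V n" "t \<in> nsum V m" "ple (s + t) x"
    unfolding pexps_def upc_def nsum_add by blast
  have "x = s + (t + (x - (s + t)))" using ple_diff_add[OF st(3)] by (simp add: add.assoc)
  moreover have "s \<in> pexps V n" "t + (x - (s + t)) \<in> pexps V m"
    using st ple_refl ple_add unfolding pexps_def upc_def by blast+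
  ultimately show "x \<in> {u + v | u v. u \<in> pexps V n \<and> v \<in> pexps V m}" by blast
next
  fix x assume "x \<in> {u + v | u v. u \<in> pexps V n \<and> v \<in> pexps V m}"
  thus "x \<in> pexps V (n + m)"
    unfolding pexps_def upc_def nsum_add using ple_add_mono by blast
qed

lemma pexps_add_mem: "u \<in> pexps V n \<Longrightarrow> v \<in> pexps V m \<Longrightarrow> u + v \<in> pexps V (n + m)"
  unfolding pexps_add by blast

lemma nsum_bound:
  assumes "\<And>v i. v \<in> V \<Longrightarrow> lookup v i \<le> K" "u \<in> nsum V n"
  shows "lookup u i \<le> n * K"
  using assms(2)
proof (induction n arbitrary: u)
  case (Suc n)
  then obtain s v where "u = s + v" "s \<in> nsum V n" "v \<in> V" by auto
  thus ?case using Suc(1)[of s] assms(1)[of v i] by (simp add: lookup_add)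
qed simp

text \<open>The inner sum repeats \<open>v\<close> exactly \<open>a v\<close> times, so the left
  side is the exponent of a product of powers of generators. The subset \<open>U\<close> carries the
  induction.\<close>

lemma nsum_scale:
  assumes "finite V" "U \<subseteq> V"
  shows "(\<Sum>v\<in>U. \<Sum>_<a v. v) \<in> nsum V (\<Sum>v\<in>U. a v)"
  using finite_subset[OF assms(2,1)] assms(2)
proof (induction U rule: finite_induct)
  case empty show ?case by simp
next
  case (insert x U)
  have "(\<Sum>_<k. x) \<in> nsum V k" for k
    using insert(4) by (induction k) auto
  hence "(\<Sum>_<a x. x) + (\<Sum>v\<in>U. \<Sum>_<a v. v) \<in> nsum V (a x + (\<Sum>v\<in>U. a v))"
    using insert unfolding nsum_add by blast
  thus ?case using insert by simp
qed

section \<open>Saturation with respect to the maximal ideal\<close>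

definition zcoord :: "'a \<Rightarrow> ('a \<Rightarrow>\<^sub>0 nat) \<Rightarrow> ('a \<Rightarrow>\<^sub>0 nat)" where
  "zcoord i v = Poly_Mapping.update i 0 v"

lemma lookup_zcoord: "lookup (zcoord i v) j = (if j = i then 0 else lookup v j)"
  by (simp add: zcoord_def lookup_update)

lemma zcoord_add: "zcoord i (u + v) = zcoord i u + zcoord i v"
  by (rule poly_mapping_eqI) (simp add: lookup_zcoord lookup_add)

lemma nsum_zcoord: "nsum (zcoord i ` V) n = zcoord i ` nsum V n"
proof (induction n)
  case 0
  have "zcoord i 0 = 0" by (rule poly_mapping_eqI) (simp add: lookup_zcoord)
  thus ?case by simp
next
  case (Suc n)
  show ?case
  proof (intro equalityI subsetI)
    fix x assume "x \<in> nsum (zcoord i ` V) (Suc n)"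
    then obtain u v where "x = zcoord i u + zcoord i v" "u \<in> nsum V n" "v \<in> V" using Suc by auto
    thus "x \<in> zcoord i ` nsum V (Suc n)" by (auto simp: zcoord_add[symmetric])
  next
    fix x assume "x \<in> zcoord i ` nsum V (Suc n)"
    then obtain u v where "x = zcoord i u + zcoord i v" "u \<in> nsum V n" "v \<in> V"
      by (auto simp: zcoord_add)
    thus "x \<in> nsum (zcoord i ` V) (Suc n)" using Suc by auto
  qed
qed

text \<open>The exponents of the saturation by the maximal ideal, tested on powers of single
  variables; \<open>mem_sat_iff\<close> compares this with all monomials of large degree.\<close>

definition sat :: "('a \<Rightarrow>\<^sub>0 nat) set \<Rightarrow> ('a \<Rightarrow>\<^sub>0 nat) set" where
  "sat U = {u. \<forall>i. \<exists>j. u + Poly_Mapping.single i j \<in> U}"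

text \<open>Deleting the i-th coordinate amounts to inverting the i-th variable. It is additive,
  hence commutes with n-fold sums, so the saturation of a power becomes an intersection of n-th
  powers of ideals that do not depend on n.\<close>

lemma sat_pexps: "sat (pexps V n) = (\<Inter>i. pexps (zcoord i ` V) n)"
proof -
  have "(\<exists>j. u + Poly_Mapping.single i j \<in> pexps V n) \<longleftrightarrow> u \<in> pexps (zcoord i ` V) n" for u i
  proof
    assume "\<exists>j. u + Poly_Mapping.single i j \<in> pexps V n"
    then obtain j s where s: "s \<in> nsum V n" "ple s (u + Poly_Mapping.single i j)"
      unfolding pexps_def upc_def by blast
    hence "ple (zcoord i s) u"
      unfolding ple_def by (auto simp: lookup_zcoord lookup_add lookup_single when_def split: if_splits)
    thus "u \<in> pexps (zcoord i ` V) n" using s(1) unfolding pexps_def upc_def nsum_zcoord by blast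
  next
    assume "u \<in> pexps (zcoord i ` V) n"
    then obtain s where s: "s \<in> nsum V n" "ple (zcoord i s) u"
      unfolding pexps_def upc_def nsum_zcoord by blast
    have "lookup s k \<le> lookup (u + Poly_Mapping.single i (lookup s i)) k" for k
      using s(2)[unfolded ple_def, rule_format, of k] by (simp add: lookup_zcoord lookup_add lookup_single split: if_splits)
    hence "ple s (u + Poly_Mapping.single i (lookup s i))" unfolding ple_def by blast
    thus "\<exists>j. u + Poly_Mapping.single i j \<in> pexps V n" using s(1) unfolding pexps_def upc_def by blast
  qed
  thus ?thesis unfolding sat_def by blast
qed

lemma upclosed_sat: "upclosed U \<Longrightarrow> upclosed (sat U)"
proof -
  assume U: "upclosed U"
  have "u + w \<in> sat U" if u: "u \<in> sat U" for u w
    unfolding sat_def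
  proof clarify
    fix i
    obtain j where "u + Poly_Mapping.single i j \<in> U" using u unfolding sat_def by blast
    hence "u + Poly_Mapping.single i j + w \<in> U" using U unfolding upclosed_def by blast
    thus "\<exists>j. u + w + Poly_Mapping.single i j \<in> U" by (intro exI[of _ j]) (simp add: ac_simps)
  qed
  thus ?thesis unfolding upclosed_def by blast
qed

lemma subset_sat: "U \<subseteq> sat U"
proof
  fix u assume "u \<in> U"
  hence "u + Poly_Mapping.single i 0 \<in> U" for i by simp
  thus "u \<in> sat U" unfolding sat_def by blast
qed

lemma sat_diff_bounded:
  assumes V: "\<And>v i. v \<in> V \<Longrightarrow> lookup v i \<le> K" and u: "u \<in> sat (pexps V n)" "u \<notin> pexps V n"
  shows "lookup u i < n * K"
proof (rule ccontr)
  assume nl: "\<not> lookup u i < n * K"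
  obtain j where "u + Poly_Mapping.single i j \<in> pexps V n" using u(1) unfolding sat_def by blast
  then obtain s where s: "s \<in> nsum V n" "ple s (u + Poly_Mapping.single i j)"
    unfolding pexps_def upc_def by blast
  have "lookup s i \<le> n * K" using nsum_bound[OF V s(1)] .
  have "lookup s k \<le> lookup u k" for k
  proof (cases "k = i")
    case True
    then show ?thesis using \<open>lookup s i \<le> n * K\<close> nl by simp
  next
    case False
    have "lookup s k \<le> lookup (u + Poly_Mapping.single i j) k" using s(2) unfolding ple_def by blast
    then show ?thesis using False by (simp add: lookup_add lookup_single)
  qed
  hence "ple s u" unfolding ple_def by blast
  thus False using s(1) u(2) unfolding pexps_def upc_def by blast
qed

lemma finite_sat_diff:
  fixes V :: "('n::finite \<Rightarrow>\<^sub>0 nat) set"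
  assumes V: "\<And>v i. v \<in> V \<Longrightarrow> lookup v i \<le> K"
  shows "finite (sat (pexps V n) - pexps V n)"
proof (rule finite_subset[OF _ finite_bounded_exps[of "n * K"]], rule subsetI)
  fix u assume u: "u \<in> sat (pexps V n) - pexps V n"
  have "lookup u i < n * K" for i by (rule sat_diff_bounded[OF V]) (use u in blast)+
  thus "u \<in> {v. \<forall>i. lookup v i \<le> n * K}" by (simp add: less_imp_le)
qed

lemma exps_bound_obtain:
  fixes V :: "('n::finite \<Rightarrow>\<^sub>0 nat) set"
  assumes "finite V"
  obtains K where "\<And>v i. v \<in> V \<Longrightarrow> lookup v i \<le> K"
proof (rule that)
  fix v i assume "v \<in> V"
  hence "pdeg v \<le> Max (pdeg ` V)" using assms by simp
  thus "lookup v i \<le> Max (pdeg ` V)" by (rule le_trans[OF lookup_le_pdeg])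
qed

text \<open>Pigeonhole: a monomial whose degree exceeds the sum of the required exponents is
  divisible by one of the required powers of variables.\<close>

lemma mem_sat_iff:
  fixes U :: "('n::finite \<Rightarrow>\<^sub>0 nat) set"
  assumes "upclosed U"
  shows "u \<in> sat U \<longleftrightarrow> (\<exists>j. \<forall>w. pdeg w \<ge> j \<longrightarrow> u + w \<in> U)"
proof
  assume "u \<in> sat U"
  hence "\<forall>i. \<exists>j. u + Poly_Mapping.single i j \<in> U" unfolding sat_def by blast
  then obtain f where f: "\<And>i. u + Poly_Mapping.single i (f i) \<in> U" by metis
  have "u + w \<in> U" if w: "pdeg w \<ge> (\<Sum>i\<in>UNIV. f i) + 1" for w
  proof -
    have "\<exists>i. f i \<le> lookup w i"
    proof (rule ccontr)
      assume "\<not> ?thesis"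
      hence "pdeg w \<le> (\<Sum>i\<in>UNIV. f i)" unfolding pdeg_def
        by (intro sum_mono) (meson linorder_not_le less_imp_le)
      thus False using w by simp
    qed
    then obtain i where "f i \<le> lookup w i" by blast
    hence "ple (Poly_Mapping.single i (f i)) w" by (auto simp: ple_def lookup_single when_def)
    hence "ple (u + Poly_Mapping.single i (f i)) (u + w)" by (simp add: ple_add_mono)
    thus ?thesis using upclosed_ple[OF assms f] by blast
  qed
  thus "\<exists>j. \<forall>w. pdeg w \<ge> j \<longrightarrow> u + w \<in> U" by blast
next
  assume "\<exists>j. \<forall>w. pdeg w \<ge> j \<longrightarrow> u + w \<in> U"
  then obtain j where j: "\<And>w. pdeg w \<ge> j \<Longrightarrow> u + w \<in> U" by blast
  have "u + Poly_Mapping.single i j \<in> U" for i by (rule j) simp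
  thus "u \<in> sat U" unfolding sat_def by blast
qed

subsection \<open>Linear systems and polynomials\<close>

text \<open>Gaussian elimination: an unknown with nonzero pivot is removed together with one
  equation. The resulting linear relations give the upper bound for the length and the one for the
  dimension of the fiber ring.\<close>

lemma homogeneous_system_solution:
  fixes M :: "'x \<Rightarrow> 'b \<Rightarrow> 'k::field"
  assumes "finite B" "finite Y" "card Y > card B"
  shows "\<exists>c. (\<exists>x\<in>Y. c x \<noteq> 0) \<and> (\<forall>b\<in>B. (\<Sum>x\<in>Y. c x * M x b) = 0)"
  using assms
proof (induction B arbitrary: Y M rule: finite_induct)
  case empty
  then obtain x where "x \<in> Y" by fastforce
  thus ?case by (intro exI[of _ "\<lambda>_. 1"]) auto
next
  case (insert b B)
  show ?case
  proof (cases "\<exists>x0\<in>Y. M x0 b \<noteq> 0")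
    case False
    have "card B < card Y" using insert by simp
    then obtain c where "\<exists>x\<in>Y. c x \<noteq> 0" "\<forall>b\<in>B. (\<Sum>x\<in>Y. c x * M x b) = 0"
      using insert.IH[OF insert.prems(1), of M] by blast
    thus ?thesis using False by (intro exI[of _ c]) auto
  next
    case True
    then obtain x0 where x0: "x0 \<in> Y" "M x0 b \<noteq> 0" by blast
    define N where "N x b' = M x b' - M x b / M x0 b * M x0 b'" for x b'
    have card: "card B < card (Y - {x0})" using insert x0 by simp
    obtain c where c: "\<exists>x\<in>Y-{x0}. c x \<noteq> 0" "\<forall>b\<in>B. (\<Sum>x\<in>Y-{x0}. c x * N x b) = 0"
      using insert.IH[OF finite_Diff[OF insert.prems(1)] card, of N] by blast
    \<comment> \<open>The value at \<open>x0\<close> is forced by the equation \<open>b\<close>; the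
      matrix \<open>N\<close> is what remains after substituting it into the other
      equations.\<close>
    define c' where "c' x = (if x = x0 then - (\<Sum>x\<in>Y-{x0}. c x * (M x b / M x0 b)) else c x)" for x
    have eq: "(\<Sum>x\<in>Y. c' x * M x b') = (\<Sum>x\<in>Y-{x0}. c x * N x b')" for b'
    proof -
      have "(\<Sum>x\<in>Y. c' x * M x b') = c' x0 * M x0 b' + (\<Sum>x\<in>Y-{x0}. c x * M x b')"
        using x0(1) insert(4) by (simp add: sum.remove c'_def)
      moreover have "c' x0 * M x0 b' = - (\<Sum>x\<in>Y-{x0}. c x * (M x b / M x0 b * M x0 b'))"
        by (simp add: c'_def sum_distrib_right mult.assoc)
      ultimately show ?thesis
        by (simp add: N_def right_diff_distrib sum_subtractf)
    qed
    have "(\<Sum>x\<in>Y. c' x * M x b) = 0" unfolding eq N_def using x0(2) by simp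
    moreover have "\<exists>x\<in>Y. c' x \<noteq> 0" using c(1) c'_def by auto
    ultimately show ?thesis using c(2) eq by (intro exI[of _ c']) auto
  qed
qed

lemma lookup_mult_keys:
  fixes p q :: "'a::comm_monoid_add \<Rightarrow>\<^sub>0 'b::comm_semiring_0"
  shows "lookup (p * q) w = (\<Sum>u\<in>keys p. \<Sum>v\<in>keys q. if u + v = w then lookup p u * lookup q v else 0)"
proof -
  have "prod_fun (lookup p) (lookup q) w = 
    (\<Sum>(a, b). lookup p a * lookup q b when w = a + b)"
    by (rule prod_fun_unfold_prod) simp_all
  also have "\<dots> = (\<Sum>(a, b)\<in>keys p \<times> keys q. lookup p a * lookup q b when w = a + b)"
    by (rule Sum_any.expand_superset) (auto simp: in_keys_iff)
  also have "\<dots> = (\<Sum>u\<in>keys p. \<Sum>v\<in>keys q. if u + v = w then lookup p u * lookup q v else 0)"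
    unfolding sum.cartesian_product by (intro sum.cong) (auto simp: when_def)
  finally show ?thesis by (simp add: lookup_mult prod_fun_def)
qed

text \<open>If \<open>u + v\<close> is the only way to reach this exponent from the two supports,
  nothing can cancel. All later nonvanishing statements on products rest on this.\<close>

lemma lookup_mult_unique:
  fixes p q :: "'a::comm_monoid_add \<Rightarrow>\<^sub>0 'b::comm_semiring_0"
  assumes "\<And>u' v'. u' \<in> keys p \<Longrightarrow> v' \<in> keys q \<Longrightarrow> u' + v' = u + v \<Longrightarrow> u' = u \<and> v' = v"
  shows "lookup (p * q) (u + v) = lookup p u * lookup q v"
proof -
  have "lookup (p * q) (u + v) = (\<Sum>(u', v')\<in>keys p \<times> keys q. if u' + v' = u + v then lookup p u' * lookup q v' else 0)"
    unfolding lookup_mult_keys sum.cartesian_product ..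
  also have "\<dots> = (\<Sum>x\<in>keys p \<times> keys q. if x = (u, v) then lookup p u * lookup q v else 0)"
  proof (rule sum.cong[OF refl], clarify)
    fix a b assume "a \<in> keys p" "b \<in> keys q"
    thus "(if a + b = u + v then lookup p a * lookup q b else 0) =
      (if (a, b) = (u, v) then lookup p u * lookup q v else 0)" using assms[of a b] by auto
  qed
  also have "\<dots> = lookup p u * lookup q v"
    by (simp add: sum.delta) (auto simp: in_keys_iff)
  finally show ?thesis .
qed

text \<open>An additive weight that separates a finite set of exponents singles out a leading term,
  and its values in the naturals guarantee that maxima over finite supports exist.\<close>

lemma ex_separating_weight:
  fixes Y :: "('n::finite \<Rightarrow>\<^sub>0 nat) set"
  assumes "finite Y"
  obtains wt :: "('n \<Rightarrow>\<^sub>0 nat) \<Rightarrow> nat" where "\<And>u v. wt (u + v) = wt u + wt v" "inj_on wt Y"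
proof -
  obtain K where K: "\<And>v i. v \<in> Y \<Longrightarrow> lookup v i \<le> K" using exps_bound_obtain[OF assms] by blast
  have "\<exists>wt :: ('n \<Rightarrow>\<^sub>0 nat) \<Rightarrow> nat. (\<forall>u v. wt (u + v) = wt u + wt v) \<and> 
     (\<forall>u\<in>Y. \<forall>v\<in>Y. wt u = wt v \<longrightarrow> (\<forall>i\<in>J. lookup u i = lookup v i))" for J
  proof (induction J rule: finite_induct[OF finite])
    case 1 show ?case by (intro exI[of _ "\<lambda>_. 0"]) auto
  next
    case (2 j J)
    then obtain wt :: "('n \<Rightarrow>\<^sub>0 nat) \<Rightarrow> nat" where wt: "\<forall>u v. wt (u + v) = wt u + wt v"
      "\<forall>u\<in>Y. \<forall>v\<in>Y. wt u = wt v \<longrightarrow> (\<forall>i\<in>J. lookup u i = lookup v i)" by blast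
    \<comment> \<open>Expansion in base \<open>Suc K\<close>: the coordinates on \<open>Y\<close>
      are at most \<open>K\<close>, so the new coordinate is the last digit and the old weight is
      the quotient.\<close>
    define wt' where "wt' u = lookup u j + Suc K * wt u" for u
    have add: "wt' (u + v) = wt' u + wt' v" for u v
      unfolding wt'_def lookup_add wt(1)[rule_format] by (simp add: algebra_simps)
    have dm: "wt' u div Suc K = wt u" "wt' u mod Suc K = lookup u j" if "u \<in> Y" for u
      using K[OF that, of j] by (simp_all add: wt'_def del: mult_Suc)
    have "lookup u i = lookup v i" if "u \<in> Y" "v \<in> Y" "wt' u = wt' v" "i \<in> insert j J" for u v i
    proof -
      have "wt u = wt v" "lookup u j = lookup v j" using dm[OF that(1)] dm[OF that(2)] that(3) by simp_all
      thus ?thesis using wt(2)[rule_format, OF that(1,2)] that(4) by (cases "i = j") simp_all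
    qed
    thus ?case using add by (intro exI[of _ wt'] conjI allI ballI impI)
  qed
  from this[of UNIV] obtain wt :: "('n \<Rightarrow>\<^sub>0 nat) \<Rightarrow> nat" where wt: "\<forall>u v. wt (u + v) = wt u + wt v"
     "\<forall>u\<in>Y. \<forall>v\<in>Y. wt u = wt v \<longrightarrow> (\<forall>i\<in>UNIV. lookup u i = lookup v i)" by blast
  show thesis
  proof (rule that)
    show "wt (u + v) = wt u + wt v" for u v by (rule wt(1)[rule_format])
    show "inj_on wt Y"
    proof (rule inj_onI, rule poly_mapping_eqI)
      fix u v i assume "u \<in> Y" "v \<in> Y" "wt u = wt v"
      thus "lookup u i = lookup v i" using wt(2)[rule_format, of u v i] by simp
    qed
  qed
qed

text \<open>The heaviest terms of both factors multiply to a term that no other pair of terms can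
  cancel.\<close>

lemma mpoly_mult_eq_0_iff:
  fixes p q :: "('n::finite, 'k::field) mpoly"
  shows "p * q = 0 \<longleftrightarrow> p = 0 \<or> q = 0"
proof (rule ccontr)
  assume "\<not> ?thesis"
  hence pq: "p * q = 0" "p \<noteq> 0" "q \<noteq> 0" by auto
  obtain wt :: "('n \<Rightarrow>\<^sub>0 nat) \<Rightarrow> nat" where wt: "\<And>u v. wt (u + v) = wt u + wt v" "inj_on wt (keys p \<union> keys q)"
    using ex_separating_weight[OF finite_UnI[OF finite_keys[of p] finite_keys[of q]]] by blast
  have top: "\<exists>u\<in>keys p. \<forall>v\<in>keys p. wt v \<le> wt u" if "p \<noteq> 0" for p :: "('n, 'k) mpoly"
  proof -
    have "Max (wt ` keys p) \<in> wt ` keys p" using that by (intro Max_in) auto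
    moreover have "wt v \<le> Max (wt ` keys p)" if "v \<in> keys p" for v using that by simp
    ultimately show ?thesis by (elim imageE) (metis (no_types))
  qed
  obtain u where u: "u \<in> keys p" "\<And>v. v \<in> keys p \<Longrightarrow> wt v \<le> wt u" using top[OF pq(2)] by blast
  obtain v where v: "v \<in> keys q" "\<And>w. w \<in> keys q \<Longrightarrow> wt w \<le> wt v" using top[OF pq(3)] by blast
  have "lookup (p * q) (u + v) = lookup p u * lookup q v"
  proof (rule lookup_mult_unique)
    fix u' v' assume *: "u' \<in> keys p" "v' \<in> keys q" "u' + v' = u + v"
    have "wt u' + wt v' = wt u + wt v" by (simp only: wt(1)[symmetric] *(3))
    hence "wt u' = wt u" "wt v' = wt v" using u(2)[OF *(1)] v(2)[OF *(2)] by linarith+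
    thus "u' = u \<and> v' = v" 
      using inj_onD[OF wt(2), of u' u] inj_onD[OF wt(2), of v' v] *(1,2) u(1) v(1) by blast
  qed
  thus False using pq(1) u(1) v(1) by (simp add: in_keys_iff)
qed


section \<open>Finitely generated graded monoids\<close>

inductive_set mgen :: "'a::comm_monoid_add set \<Rightarrow> 'a set" for G where
  zero: "0 \<in> mgen G"
| step: "x \<in> mgen G \<Longrightarrow> g \<in> G \<Longrightarrow> g + x \<in> mgen G"

definition nmul :: "nat \<Rightarrow> 'a::comm_monoid_add \<Rightarrow> 'a" where
  "nmul k x = (\<Sum>_<k. x)"

text \<open>The homomorphism from the free commutative monoid on \<open>I\<close> that sends the
  i-th basis vector to \<open>\<phi> i\<close>. Working with an index set allows repeated
  generators.\<close>

definition gev :: "'i set \<Rightarrow> ('i \<Rightarrow> 'a::comm_monoid_add) \<Rightarrow> ('i \<Rightarrow>\<^sub>0 nat) \<Rightarrow> 'a" where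
  "gev I \<phi> c = (\<Sum>i\<in>I. nmul (lookup c i) (\<phi> i))"

lemma nmul_0 [simp]: "nmul 0 x = 0"
  by (simp add: nmul_def)

lemma nmul_Suc [simp]: "nmul (Suc k) x = x + nmul k x"
  by (simp add: nmul_def add.commute)

lemma nmul_add: "nmul (j + k) x = nmul j x + nmul k x"
  by (induction j) (simp_all add: add.assoc)

lemma gev_add: "gev I \<phi> (a + b) = gev I \<phi> a + gev I \<phi> b"
  by (simp add: gev_def lookup_add nmul_add sum.distrib)

lemma gev_0 [simp]: "gev I \<phi> 0 = 0"
  by (simp add: gev_def)

lemma gev_single:
  assumes "finite I" "i \<in> I"
  shows "gev I \<phi> (Poly_Mapping.single i 1) = \<phi> i"
proof -
  have "gev I \<phi> (Poly_Mapping.single i 1) = (\<Sum>j\<in>I. if j = i then \<phi> i else 0)"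
    unfolding gev_def by (rule sum.cong) (auto simp: lookup_single when_def)
  thus ?thesis using assms by simp
qed

lemma mgen_add: "x \<in> mgen G \<Longrightarrow> y \<in> mgen G \<Longrightarrow> x + y \<in> mgen G"
  by (induction rule: mgen.induct) (simp_all add: add.assoc mgen.step)

lemma mgen_base: "g \<in> G \<Longrightarrow> g \<in> mgen G"
  using mgen.step[OF mgen.zero] by force

lemma mgen_sum: "(\<And>i. i \<in> I \<Longrightarrow> f i \<in> mgen G) \<Longrightarrow> sum f I \<in> mgen G"
  by (induction I rule: infinite_finite_induct) (simp_all add: mgen.zero mgen_add)

lemma nmul_mgen: "g \<in> G \<Longrightarrow> nmul k g \<in> mgen G"
  by (induction k) (simp_all add: mgen.zero mgen.step)

lemma mgen_eq_gev:
  assumes "finite I"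
  shows "mgen (\<phi> ` I) = range (gev I \<phi>)"
proof
  show "mgen (\<phi> ` I) \<subseteq> range (gev I \<phi>)"
  proof
    fix x assume "x \<in> mgen (\<phi> ` I)"
    thus "x \<in> range (gev I \<phi>)"
    proof induction
      case zero show ?case using gev_0 by (metis rangeI)
    next
      case (step x g)
      then obtain c i where "x = gev I \<phi> c" "g = \<phi> i" "i \<in> I" by blast
      hence "g + x = gev I \<phi> (Poly_Mapping.single i 1 + c)"
        by (simp only: gev_add gev_single[OF assms])
      thus ?case by simp
    qed
  qed
  show "range (gev I \<phi>) \<subseteq> mgen (\<phi> ` I)"
    unfolding gev_def by (auto intro!: mgen_sum nmul_mgen)
qed

lemma ex_poly_mapping:
  assumes "finite I"
  shows "\<exists>c :: 'i \<Rightarrow>\<^sub>0 nat. (\<forall>i\<in>I. lookup c i = f i) \<and> keys c \<subseteq> I"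
proof (intro exI conjI ballI)
  let ?c = "\<Sum>i\<in>I. Poly_Mapping.single i (f i)"
  have l: "lookup ?c j = (\<Sum>i\<in>I. if j = i then f i else 0)" for j
    unfolding lookup_sum by (rule sum.cong) (auto simp: lookup_single when_def)
  show "lookup ?c j = f j" if "j \<in> I" for j using l that assms by simp
  have "lookup ?c j = 0" if "j \<notin> I" for j unfolding l using that assms by simp
  thus "keys ?c \<subseteq> I" unfolding in_keys_iff[symmetric] by (metis in_keys_iff subsetI)
qed

text \<open>The pairs of representations with equal value form a monoid \<open>Z\<close> of exponent
  vectors, generated by its minimal nonzero elements; these are finitely many by Dickson's lemma.
  The sum type keeps the generators of the two sides apart even if \<open>G\<close> and
  \<open>H\<close> overlap.\<close>

lemma mgen_Int_finite:
  fixes G H :: "'a::cancel_comm_monoid_add set"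
  assumes "finite G" "finite H"
  shows "\<exists>F. finite F \<and> mgen G \<inter> mgen H = mgen F"
proof -
  define \<phi> :: "'a + 'a \<Rightarrow> 'a" where "\<phi> = case_sum id id"
  define I J :: "('a + 'a) set" where "I = Inl ` G" and "J = Inr ` H"
  have fin: "finite I" "finite J" using assms by (auto simp: I_def J_def)
  have G: "mgen G = range (gev I \<phi>)"
    using mgen_eq_gev[OF fin(1), of \<phi>] by (simp add: I_def image_image \<phi>_def)
  have H: "mgen H = range (gev J \<phi>)"
    using mgen_eq_gev[OF fin(2), of \<phi>] by (simp add: J_def image_image \<phi>_def)
  define Z where "Z = {c. keys c \<subseteq> I \<union> J \<and> gev I \<phi> c = gev J \<phi> c}"
  define F where "F = minl (Z - {0})"
  have finF: "finite F" unfolding F_def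
    by (rule finite_minl[of "I \<union> J"]) (use fin in \<open>auto simp: Z_def\<close>)
  have FZ: "F \<subseteq> Z" "0 \<notin> F" using minl_subset[of "Z - {0}"] unfolding F_def by auto
  have gen: "gev I \<phi> c \<in> mgen (gev I \<phi> ` F)" if "c \<in> Z" for c
    using that
  proof (induction "\<Sum>i\<in>I \<union> J. lookup c i" arbitrary: c rule: less_induct)
    case less
    show ?case
    proof (cases "c = 0")
      case True then show ?thesis by (simp add: mgen.zero)
    next
      case False
      then obtain f where f: "f \<in> F" "ple f c" using minl_below[of c "Z - {0}"] less(2) unfolding F_def by blast
      have c: "c = f + (c - f)" using ple_diff_add[OF f(2)] by simp
      have fZ: "f \<in> Z" "f \<noteq> 0" using f(1) FZ by auto
      \<comment> \<open>This is where cancellation in the monoid enters: the difference of two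
        solutions is again a solution.\<close>
      have "gev I \<phi> f + gev I \<phi> (c - f) = gev J \<phi> f + gev J \<phi> (c - f)"
        using less(2) c unfolding Z_def gev_add[symmetric] by simp
      hence eq: "gev I \<phi> (c - f) = gev J \<phi> (c - f)" using fZ unfolding Z_def by simp
      have "ple (c - f) c" by (simp add: ple_def lookup_minus)
      hence "keys (c - f) \<subseteq> I \<union> J" using ple_keys less(2) unfolding Z_def by blast
      hence Z: "c - f \<in> Z" using eq unfolding Z_def by simp
      have "(\<Sum>i\<in>I \<union> J. lookup c i) = (\<Sum>i\<in>I \<union> J. lookup f i) + (\<Sum>i\<in>I \<union> J. lookup (c - f) i)"
      proof -
        have "lookup c i = lookup f i + lookup (c - f) i" for i
          by (subst c) (simp only: lookup_add)
        thus ?thesis unfolding sum.distrib[symmetric] by (intro sum.cong) simp_all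
      qed
      moreover have "(\<Sum>i\<in>I \<union> J. lookup f i) \<noteq> 0"
      proof
        assume "(\<Sum>i\<in>I \<union> J. lookup f i) = 0"
        hence "\<forall>i\<in>I \<union> J. lookup f i = 0" using fin by simp
        moreover have "keys f \<subseteq> I \<union> J" using fZ(1) unfolding Z_def by simp
        ultimately have "keys f = {}" unfolding keys.rep_eq by auto
        thus False using fZ(2) by simp
      qed
      ultimately have "gev I \<phi> (c - f) \<in> mgen (gev I \<phi> ` F)" by (intro less(1) Z) linarith
      hence "gev I \<phi> f + gev I \<phi> (c - f) \<in> mgen (gev I \<phi> ` F)" using f(1) by (intro mgen.step) auto
      thus ?thesis unfolding gev_add[symmetric] c[symmetric] .
    qed
  qed
  have "mgen G \<inter> mgen H = mgen (gev I \<phi> ` F)"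
  proof (intro equalityI subsetI)
    fix x assume "x \<in> mgen G \<inter> mgen H"
    then obtain a b where ab: "x = gev I \<phi> a" "x = gev J \<phi> b" unfolding G H by blast
    obtain c where c: "\<forall>i\<in>I \<union> J. lookup c i = (if i \<in> I then lookup a i else lookup b i)" "keys c \<subseteq> I \<union> J"
      using ex_poly_mapping[OF finite_UnI[OF fin], of "\<lambda>i. if i \<in> I then lookup a i else lookup b i"] by blast
    have "gev I \<phi> c = x" unfolding ab(1) gev_def using c(1) by (intro sum.cong) auto
    moreover have "gev J \<phi> c = x" unfolding ab(2) gev_def using c(1) by (intro sum.cong) (auto simp: I_def J_def)
    ultimately show "x \<in> mgen (gev I \<phi> ` F)" using gen[of c] c(2) unfolding Z_def by auto
  next
    fix x assume "x \<in> mgen (gev I \<phi> ` F)"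
    thus "x \<in> mgen G \<inter> mgen H"
    proof induction
      case zero show ?case by (simp add: mgen.zero)
    next
      case (step x g)
      then obtain f where f: "f \<in> F" "g = gev I \<phi> f" by blast
      hence "g = gev J \<phi> f" using FZ unfolding Z_def by auto
      hence "g \<in> mgen G \<inter> mgen H" using f(2) unfolding G H by blast
      thus ?case using step by (simp add: mgen_add)
    qed
  qed
  thus ?thesis using finF by blast
qed

text \<open>\<open>H\<close> starts the induction: the intersection over an empty index set is the
  whole type, which need not be finitely generated.\<close>

lemma mgen_INT_finite:
  fixes G :: "'i \<Rightarrow> 'a::cancel_comm_monoid_add set"
  assumes "finite I" "finite H" "\<And>i. i \<in> I \<Longrightarrow> finite (G i)"
  shows "\<exists>F. finite F \<and> (\<Inter>i\<in>I. mgen (G i)) \<inter> mgen H = mgen F"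
  using assms(1,3)
proof (induction I rule: finite_induct)
  case empty then show ?case using assms(2) by auto
next
  case (insert i I)
  then obtain F where F: "finite F" "(\<Inter>i\<in>I. mgen (G i)) \<inter> mgen H = mgen F" by auto
  obtain F' where "finite F'" "mgen (G i) \<inter> mgen F = mgen F'"
    using mgen_Int_finite[OF insert(4)[of i] F(1)] by auto
  moreover have "(\<Inter>i\<in>insert i I. mgen (G i)) \<inter> mgen H = mgen (G i) \<inter> mgen F" using F(2) by auto
  ultimately show ?case by auto
qed

lemma mgen_remove_0: "mgen (G - {0}) = mgen G"
proof
  show "mgen (G - {0}) \<subseteq> mgen G"
  proof
    fix x assume "x \<in> mgen (G - {0})"
    thus "x \<in> mgen G" by induction (auto intro: mgen.intros)
  qed
  show "mgen G \<subseteq> mgen (G - {0})"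
  proof
    fix x assume "x \<in> mgen G"
    thus "x \<in> mgen (G - {0})"
    proof induction
      case (step x g)
      thus ?case by (cases "g = 0") (auto intro: mgen.intros)
    qed (rule mgen.zero)
  qed
qed

subsection \<open>Counting functions that are eventually polynomial\<close>

text \<open>The coefficients are rational on purpose: \<open>evpoly_limit_rational\<close> finds the
  limit among them, up to a rational factor.\<close>

definition evpoly :: "(nat \<Rightarrow> nat) \<Rightarrow> bool" where
  "evpoly f \<longleftrightarrow> (\<exists>p :: rat poly. \<forall>\<^sub>F k in sequentially. of_nat (f k) = poly p (of_nat k))"

lemma evpoly_shift:
  assumes "evpoly f"
  shows "evpoly (\<lambda>k. if s \<le> k then f (k - s) else 0)"
proof -
  obtain p :: "rat poly" where "\<forall>\<^sub>F k in sequentially. of_nat (f k) = poly p (of_nat k)"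
    using assms unfolding evpoly_def by blast
  then obtain K where K: "\<And>k. k \<ge> K \<Longrightarrow> of_nat (f k) = poly p (of_nat k)"
    unfolding eventually_sequentially by blast
  have "of_nat (if s \<le> k then f (k - s) else 0) = poly (pcompose p [:- of_nat s, 1:]) (of_nat k)"
    if "k \<ge> K + s" for k
    using K[of "k - s"] that by (simp add: poly_pcompose of_nat_diff)
  thus ?thesis unfolding evpoly_def eventually_sequentially
    by (intro exI[of _ "pcompose p [:- of_nat s, 1:]"] exI[of _ "K + s"] allI impI)
qed

lemma evpoly_scale:
  assumes "evpoly f" "c > 0"
  shows "evpoly (\<lambda>k. f (c * k))"
proof -
  obtain p :: "rat poly" where "\<forall>\<^sub>F k in sequentially. of_nat (f k) = poly p (of_nat k)"
    using assms unfolding evpoly_def by blast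
  then obtain K where K: "\<And>k. k \<ge> K \<Longrightarrow> of_nat (f k) = poly p (of_nat k)"
    unfolding eventually_sequentially by blast
  have "of_nat (f (c * k)) = poly (pcompose p [:0, of_nat c:]) (of_nat k)" if "k \<ge> K" for k
  proof -
    have "k \<le> c * k" using assms(2) by simp
    hence "c * k \<ge> K" using that by (rule le_trans[rotated])
    thus ?thesis using K[of "c * k"] by (simp add: poly_pcompose mult.commute)
  qed
  thus ?thesis unfolding evpoly_def eventually_sequentially
    by (intro exI[of _ "pcompose p [:0, of_nat c:]"] exI[of _ K] allI impI)
qed

lemma evpoly_diff:
  assumes "evpoly f" "evpoly g" "\<And>k. g k \<le> f k"
  shows "evpoly (\<lambda>k. f k - g k)"
proof -
  obtain p q :: "rat poly" where "\<forall>\<^sub>F k in sequentially. of_nat (f k) = poly p (of_nat k)"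
    "\<forall>\<^sub>F k in sequentially. of_nat (g k) = poly q (of_nat k)"
    using assms(1,2) unfolding evpoly_def by blast
  hence "\<forall>\<^sub>F k in sequentially. of_nat (f k - g k) = poly (p - q) (of_nat k)"
    by eventually_elim (simp add: of_nat_diff assms(3))
  thus ?thesis unfolding evpoly_def by blast
qed

lemma evpoly_sum:
  assumes "finite S" "\<And>s. s \<in> S \<Longrightarrow> evpoly (f s)"
  shows "evpoly (\<lambda>k. \<Sum>s\<in>S. f s k)"
  using assms
proof (induction S rule: finite_induct)
  case empty
  show ?case unfolding evpoly_def by (intro exI[of _ 0]) simp
next
  case (insert s S)
  obtain p q :: "rat poly" where "\<forall>\<^sub>F k in sequentially. of_nat (f s k) = poly p (of_nat k)"
    "\<forall>\<^sub>F k in sequentially. of_nat (\<Sum>s\<in>S. f s k) = poly q (of_nat k)"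
    using insert.IH[OF insert.prems] insert.prems[of s] unfolding evpoly_def by auto
  hence "\<forall>\<^sub>F k in sequentially. of_nat (\<Sum>s\<in>insert s S. f s k) = poly (p + q) (of_nat k)"
    by eventually_elim (use insert in simp)
  thus ?case unfolding evpoly_def by blast
qed

definition ssum :: "nat \<Rightarrow> (nat \<Rightarrow>\<^sub>0 nat) \<Rightarrow> nat" where
  "ssum r a = (\<Sum>i<r. lookup a i)"

definition simplex_exps :: "nat \<Rightarrow> nat \<Rightarrow> (nat \<Rightarrow>\<^sub>0 nat) set" where
  "simplex_exps r k = {a. keys a \<subseteq> {..<r} \<and> ssum r a = k}"

lemma simplex_exps_bij:
  "bij_betw (\<lambda>a. map (lookup a) [0..<r]) (simplex_exps r k) {l. length l = r \<and> sum_list l = k}"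
proof (rule bij_betw_imageI)
  show "inj_on (\<lambda>a. map (lookup a) [0..<r]) (simplex_exps r k)"
  proof (rule inj_onI, rule poly_mapping_eqI)
    fix a b i assume ab: "a \<in> simplex_exps r k" "b \<in> simplex_exps r k"
      "map (lookup a) [0..<r] = map (lookup b) [0..<r]"
    show "lookup a i = lookup b i"
    proof (cases "i < r")
      case True
      then show ?thesis using ab(3) by simp
    next
      case False
      hence "i \<notin> keys a" "i \<notin> keys b" using ab(1,2) unfolding simplex_exps_def by auto
      then show ?thesis by (simp add: in_keys_iff)
    qed
  qed
  have sl: "sum_list (map f [0..<r]) = (\<Sum>i<r. f i)" for f :: "nat \<Rightarrow> nat"
    by (simp add: interv_sum_list_conv_sum_set_nat atLeast0LessThan)
  show "(\<lambda>a. map (lookup a) [0..<r]) ` simplex_exps r k = {l. length l = r \<and> sum_list l = k}"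
  proof (intro equalityI subsetI)
    fix l assume "l \<in> (\<lambda>a. map (lookup a) [0..<r]) ` simplex_exps r k"
    thus "l \<in> {l. length l = r \<and> sum_list l = k}" by (auto simp: sl simplex_exps_def ssum_def)
  next
    fix l :: "nat list" assume l: "l \<in> {l. length l = r \<and> sum_list l = k}"
    obtain a where a: "\<forall>i\<in>{..<r}. lookup a i = l ! i" "keys a \<subseteq> {..<r}"
      using ex_poly_mapping[of "{..<r}" "\<lambda>i. l ! i"] by blast
    have eq: "map (lookup a) [0..<r] = l" using a(1) l by (intro nth_equalityI) auto
    hence "ssum r a = k" unfolding ssum_def using sl[of "lookup a"] l by simp
    thus "l \<in> (\<lambda>a. map (lookup a) [0..<r]) ` simplex_exps r k" using eq a(2) unfolding simplex_exps_def by blast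
  qed
qed

lemma card_simplex_exps: "card (simplex_exps r k) = (k + r - 1) choose k"
  using bij_betw_same_card[OF simplex_exps_bij] card_length_sum_list[of r k] by simp

lemma finite_simplex_exps: "finite (simplex_exps r k)"
proof -
  have "{l :: nat list. length l = r \<and> sum_list l = k} \<subseteq> {l. set l \<subseteq> {..k} \<and> length l = r}"
    using member_le_sum_list by fastforce
  hence "finite {l :: nat list. length l = r \<and> sum_list l = k}"
    by (rule finite_subset) (rule finite_lists_length_eq, simp)
  thus ?thesis using bij_betw_finite[OF simplex_exps_bij] by blast
qed

text \<open>Stars and bars. Without variables the count is 1 at 0 and vanishes afterwards, so
  already here the polynomial is reached only eventually.\<close>

lemma evpoly_card_simplex_exps: "evpoly (\<lambda>k. card (simplex_exps r k))"
proof (cases r)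
  case 0
  have "\<forall>\<^sub>F k in sequentially. of_nat (card (simplex_exps r k)) = poly 0 (of_nat k :: rat)"
    unfolding eventually_sequentially card_simplex_exps 0 by (intro exI[of _ 1]) simp
  thus ?thesis unfolding evpoly_def by blast
next
  case (Suc j)
  let ?p = "Polynomial.smult (1 / fact j) (\<Prod>i<j. [:of_nat j - of_nat i, 1:]) :: rat poly"
  have "of_nat (card (simplex_exps r k)) = poly ?p (of_nat k)" for k
  proof -
    have "card (simplex_exps r k) = (k + j) choose j"
      unfolding card_simplex_exps Suc using binomial_symmetric[of k "k + j"] by simp
    hence "of_nat (card (simplex_exps r k)) = (of_nat (k + j) gchoose j :: rat)"
      by (simp add: binomial_gbinomial)
    also have "\<dots> = (\<Prod>i<j. of_nat (k + j) - of_nat i) / fact j"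
      by (simp add: gbinomial_prod_rev atLeast0LessThan)
    also have "\<dots> = poly ?p (of_nat k)"
      by (simp add: poly_prod algebra_simps)
    finally show ?thesis .
  qed
  thus ?thesis unfolding evpoly_def by (intro exI[of _ ?p]) simp
qed

text \<open>The Hilbert function of a polynomial ring modulo a monomial ideal, by induction on the
  number of generators. To pass from \<open>F'\<close> to \<open>insert u F'\<close> one discards
  the multiples of \<open>u\<close>; these are \<open>u\<close> times the monomials avoiding the
  colon ideal, which the truncated differences \<open>f - u\<close> generate.\<close>

lemma evpoly_card_avoiding:
  assumes "finite F" "\<And>f. f \<in> F \<Longrightarrow> keys f \<subseteq> {..<r}"
  shows "evpoly (\<lambda>k. card {a \<in> simplex_exps r k. \<forall>f\<in>F. \<not> ple f a})"
  using assms
proof (induction "card F" arbitrary: F rule: less_induct)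
  case less
  show ?case
  proof (cases "F = {}")
    case True
    thus ?thesis using evpoly_card_simplex_exps by simp
  next
    case False
    then obtain u where u: "u \<in> F" by blast
    define F' where "F' = F - {u}"
    have F: "F = insert u F'" using u by (auto simp: F'_def)
    have F': "finite F'" "card F' < card F" 
      unfolding F'_def using less(2) card_Diff1_less[OF less(2) u] by simp_all
    have ku: "keys u \<subseteq> {..<r}" using u less(3) by blast
    define F'' where "F'' = (\<lambda>f. f - u) ` F'"
    have F'': "finite F''" "card F'' < card F"
      unfolding F''_def using F' card_image_le[OF F'(1), of "\<lambda>f. f - u"] by auto
    have kF'': "keys f \<subseteq> {..<r}" if fF: "f \<in> F''" for f
    proof -
      obtain f' where f': "f' \<in> F'" "f = f' - u" using fF unfolding F''_def by blast
      have "ple f f'" by (simp add: f'(2) ple_def lookup_minus)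
      hence "keys f \<subseteq> keys f'" by (rule ple_keys)
      moreover have "keys f' \<subseteq> {..<r}" using less(3)[of f'] f'(1) F by blast
      ultimately show ?thesis by (rule subset_trans)
    qed
    let ?c = "\<lambda>F k. {a \<in> simplex_exps r k. \<forall>f\<in>F. \<not> ple f a}"
    define g where "g k = (if ssum r u \<le> k then card (?c F'' (k - ssum r u)) else 0)" for k
    have "evpoly (\<lambda>k. card (?c F' k))"
      by (rule less(1)[OF F'(2,1)]) (use F less(3) in blast)
    moreover have "evpoly g"
      unfolding g_def by (rule evpoly_shift, rule less(1)[OF F''(2,1)]) (rule kF'')
    moreover have gk: "card {a \<in> ?c F' k. ple u a} = g k" for k
    proof (cases "ssum r u \<le> k")
      case True
      have ss: "ssum r (u + a) = ssum r u + ssum r a" for a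
        by (simp add: ssum_def lookup_add sum.distrib)
      have iff: "ple f (u + a) \<longleftrightarrow> ple (f - u) a" for f a
        unfolding ple_def lookup_add lookup_minus by (rule all_cong1) linarith
      have "{a \<in> ?c F' k. ple u a} = (\<lambda>a. u + a) ` ?c F'' (k - ssum r u)"
      proof (intro equalityI subsetI)
        fix a assume a: "a \<in> {a \<in> ?c F' k. ple u a}"
        hence eq: "a = u + (a - u)" by (simp add: ple_diff_add)
        have "ple (a - u) a" by (simp add: ple_def lookup_minus)
        hence "keys (a - u) \<subseteq> {..<r}" using ple_keys[of "a - u" a] a unfolding simplex_exps_def by blast
        moreover have "ssum r (a - u) = k - ssum r u" using ss[of "a - u"] eq a unfolding simplex_exps_def by auto
        moreover have "\<forall>f\<in>F''. \<not> ple f (a - u)"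
          unfolding F''_def using a iff[of _ "a - u"] eq by auto
        ultimately show "a \<in> (\<lambda>a. u + a) ` ?c F'' (k - ssum r u)"
          unfolding simplex_exps_def using eq by blast
      next
        fix a assume "a \<in> (\<lambda>a. u + a) ` ?c F'' (k - ssum r u)"
        then obtain b where b: "a = u + b" "keys b \<subseteq> {..<r}" "ssum r b = k - ssum r u" "\<forall>f\<in>F''. \<not> ple f b"
          unfolding simplex_exps_def by auto
        have "keys a \<subseteq> {..<r}" using b(1,2) ku keys_add[of u b] by blast
        moreover have "ssum r a = k" using b(1,3) ss True by simp
        moreover have "\<forall>f\<in>F'. \<not> ple f a" using b(4) unfolding b(1) iff F''_def by blast
        moreover have "ple u a" unfolding b(1) by simp
        ultimately show "a \<in> {a \<in> ?c F' k. ple u a}" unfolding simplex_exps_def by blast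
      qed
      moreover have "inj_on (\<lambda>a. u + a) (?c F'' (k - ssum r u))" by (simp add: inj_on_def)
      ultimately show ?thesis using True by (simp add: g_def card_image)
    next
      case False
      have "ssum r u \<le> ssum r a" if "ple u a" for a
        unfolding ssum_def using that by (intro sum_mono) (simp add: ple_def)
      hence "{a \<in> ?c F' k. ple u a} = {}" using False unfolding simplex_exps_def by blast
      thus ?thesis using False by (simp only: g_def if_False card.empty)
    qed
    moreover have fin: "finite (?c F' k)" for k using finite_simplex_exps by auto
    moreover have "g k \<le> card (?c F' k)" for k
      unfolding gk[symmetric] by (rule card_mono[OF fin]) blast
    ultimately have "evpoly (\<lambda>k. card (?c F' k) - g k)" by (intro evpoly_diff)
    moreover have "card (?c F k) = card (?c F' k) - g k" for k
    proof -
      have "?c F k = ?c F' k - {a \<in> ?c F' k. ple u a}" unfolding F by blast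
      moreover have "card (?c F' k - {a \<in> ?c F' k. ple u a}) = card (?c F' k) - card {a \<in> ?c F' k. ple u a}"
      proof (rule card_Diff_subset)
        show "finite {a \<in> ?c F' k. ple u a}" by (rule finite_subset[OF _ fin[of k]]) blast
      qed blast
      ultimately show ?thesis by (simp only: gk)
    qed
    ultimately show ?thesis by simp
  qed
qed

text \<open>Every element has a unique minimal representation with respect to a fixed monomial order on the
  exponents of the generators, and the non-minimal exponents form an upward closed set.\<close>

lemma evpoly_card_graded_monoid:
  fixes G :: "'a::comm_monoid_add set" and deg :: "'a \<Rightarrow> nat"
  assumes "finite G" and add: "\<And>x y. deg (x + y) = deg x + deg y" and pos: "\<And>g. g \<in> G \<Longrightarrow> deg g \<ge> 1"
  shows "\<exists>N>0. evpoly (\<lambda>k. card {x \<in> mgen G. deg x = N * k})"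
proof -
  obtain r and \<phi> :: "nat \<Rightarrow> 'a" where \<phi>: "G = \<phi> ` {..<r}"
    using finite_imp_nat_seg_image_inj_on[OF assms(1)] by (metis lessThan_def)
  define I where "I = {..<r}"
  have fI: "finite I" by (simp add: I_def)
  have mG: "mgen G = range (gev I \<phi>)" unfolding \<phi> I_def by (rule mgen_eq_gev) simp
  have pos': "deg (\<phi> i) \<ge> 1" if "i \<in> I" for i using pos \<phi> that I_def by blast
  have deg0: "deg 0 = 0" using add[of 0 0] by simp
  have degs: "deg (sum f S) = (\<Sum>i\<in>S. deg (f i))" for f :: "nat \<Rightarrow> 'a" and S
    by (induction S rule: infinite_finite_induct) (simp_all add: deg0 add)
  have degn: "deg (nmul k x) = k * deg x" for k x
    by (induction k) (simp_all add: deg0 add)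
  have degev: "deg (gev I \<phi> a) = (\<Sum>i\<in>I. lookup a i * deg (\<phi> i))" for a
    unfolding gev_def degs degn ..
  \<comment> \<open>A common multiple of all generator degrees: the \<open>m i\<close>-th power of
    the i-th variable then has degree exactly \<open>N\<close>, and division with remainder by the
    \<open>m i\<close> reduces the weighted grading to the standard one.\<close>
  define N where "N = (\<Prod>i\<in>I. deg (\<phi> i))"
  have N: "N > 0" unfolding N_def using pos' by (intro prod_pos) (simp add: Suc_le_lessD)
  define m where "m i = N div deg (\<phi> i)" for i
  have m: "m i * deg (\<phi> i) = N" "m i > 0" if "i \<in> I" for i
  proof -
    have "deg (\<phi> i) dvd N" unfolding N_def using fI that by (intro dvd_prodI)
    thus "m i * deg (\<phi> i) = N" by (simp add: m_def)
    thus "m i > 0" using N by (metis gr0I mult_0)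
  qed
  define A where "A = {a :: nat \<Rightarrow>\<^sub>0 nat. keys a \<subseteq> I}"
  have Aadd: "a + b \<in> A" if "a \<in> A" "b \<in> A" for a b using that keys_add[of a b] unfolding A_def by blast
  have Aeq: "a = b" if "a \<in> A" "b \<in> A" "\<And>i. i \<in> I \<Longrightarrow> lookup a i = lookup b i" for a b
  proof (rule poly_mapping_eqI)
    fix i show "lookup a i = lookup b i"
    proof (cases "i \<in> I")
      case False
      hence "i \<notin> keys a" "i \<notin> keys b" using that(1,2) unfolding A_def by auto
      thus ?thesis by (simp add: in_keys_iff)
    qed (rule that(3))
  qed
  \<comment> \<open>The standard monomials: in each fiber of \<open>gev\<close> the least exponent
    for the total order. The order is compatible with addition, so the complement is an ideal of
    \<open>A\<close>, the initial ideal of the relations between the generators.\<close>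
  define M where "M = {a \<in> A. \<forall>b\<in>A. gev I \<phi> b = gev I \<phi> a \<longrightarrow> \<not> b < a}"
  have up: "a + c \<notin> M" if aM: "a \<in> A" "c \<in> A" "a \<notin> M" for a c
  proof -
    obtain b where b: "b \<in> A" "gev I \<phi> b = gev I \<phi> a" "b < a" using aM(1,3) unfolding M_def by blast
    have "b + c < a + c" using b(3) by (rule add_strict_right_mono)
    moreover have "gev I \<phi> (b + c) = gev I \<phi> (a + c)" using b(2) by (simp add: gev_add)
    ultimately show ?thesis using Aadd[OF b(1) aM(2)] unfolding M_def by blast
  qed
  have finA: "finite {a \<in> A. deg (gev I \<phi> a) = n}" for n
  proof (rule finite_subset)
    show "{a \<in> A. deg (gev I \<phi> a) = n} \<subseteq> (\<Union>k\<le>n. simplex_exps r k)"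
    proof
      fix a assume a: "a \<in> {a \<in> A. deg (gev I \<phi> a) = n}"
      have "(\<Sum>i\<in>I. lookup a i) \<le> (\<Sum>i\<in>I. lookup a i * deg (\<phi> i))"
      proof (rule sum_mono)
        fix i assume "i \<in> I"
        thus "lookup a i \<le> lookup a i * deg (\<phi> i)" using pos'[of i] by simp
      qed
      hence "ssum r a \<le> n" using a degev[of a] by (simp add: ssum_def I_def)
      moreover have "a \<in> simplex_exps r (ssum r a)" using a by (simp add: simplex_exps_def A_def I_def)
      ultimately show "a \<in> (\<Union>k\<le>n. simplex_exps r k)" by blast
    qed
    show "finite (\<Union>k\<le>n. simplex_exps r k)" using finite_simplex_exps by blast
  qed
  have bij: "bij_betw (gev I \<phi>) {a \<in> M. deg (gev I \<phi> a) = n} {x \<in> mgen G. deg x = n}" for n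
  proof (rule bij_betw_imageI)
    show "inj_on (gev I \<phi>) {a \<in> M. deg (gev I \<phi> a) = n}"
    proof (rule inj_onI)
      fix a b assume "a \<in> {a \<in> M. deg (gev I \<phi> a) = n}" "b \<in> {a \<in> M. deg (gev I \<phi> a) = n}"
        "gev I \<phi> a = gev I \<phi> b"
      hence "\<not> a < b" "\<not> b < a" unfolding M_def by auto
      thus "a = b" by simp
    qed
    show "gev I \<phi> ` {a \<in> M. deg (gev I \<phi> a) = n} = {x \<in> mgen G. deg x = n}"
    proof (intro equalityI subsetI)
      fix x assume x: "x \<in> {x \<in> mgen G. deg x = n}"
      then obtain a0 where a0: "x = gev I \<phi> a0" unfolding mG by blast
      obtain a where a: "\<forall>i\<in>I. lookup a i = lookup a0 i" "keys a \<subseteq> I"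
        using ex_poly_mapping[OF fI, of "lookup a0"] by blast
      have xa: "gev I \<phi> a = x" unfolding a0 gev_def using a(1) by (intro sum.cong) auto
      define S where "S = {b \<in> A. gev I \<phi> b = x}"
      have "S \<subseteq> {a \<in> A. deg (gev I \<phi> a) = n}" using x unfolding S_def by auto
      hence fS: "finite S" using finA finite_subset by blast
      have neS: "S \<noteq> {}" using a(2) xa unfolding S_def A_def by blast
      have "Min S \<in> S" using fS neS by (rule Min_in)
      moreover have "Min S \<in> M" unfolding M_def
      proof (intro CollectI conjI ballI impI)
        show "Min S \<in> A" using \<open>Min S \<in> S\<close> unfolding S_def by blast
        fix b assume "b \<in> A" "gev I \<phi> b = gev I \<phi> (Min S)"
        hence "b \<in> S" using \<open>Min S \<in> S\<close> unfolding S_def by simp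
        thus "\<not> b < Min S" using Min_le[OF fS] by (simp add: not_less)
      qed
      ultimately show "x \<in> gev I \<phi> ` {a \<in> M. deg (gev I \<phi> a) = n}" using x unfolding S_def by force
    qed (auto simp: mG)
  qed
  define Bx where "Bx = {\<rho> \<in> A. \<forall>i\<in>I. lookup \<rho> i < m i}"
  have "finite Bx"
  proof (rule finite_subset)
    show "Bx \<subseteq> (\<Union>n\<le>(\<Sum>i\<in>I. m i * deg (\<phi> i)). {a \<in> A. deg (gev I \<phi> a) = n})"
    proof
      fix a assume a: "a \<in> Bx"
      have "deg (gev I \<phi> a) \<le> (\<Sum>i\<in>I. m i * deg (\<phi> i))" unfolding degev
        by (rule sum_mono) (use a in \<open>auto simp: Bx_def intro!: mult_le_mono less_imp_le\<close>)
      thus "a \<in> (\<Union>n\<le>(\<Sum>i\<in>I. m i * deg (\<phi> i)). {a \<in> A. deg (gev I \<phi> a) = n})"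
        using a unfolding Bx_def by blast
    qed
  qed (use finA in blast)
  define mq where "mq q = (\<Sum>i\<in>I. Poly_Mapping.single i (m i * lookup q i))" for q :: "nat \<Rightarrow>\<^sub>0 nat"
  have lmq: "lookup (mq q) j = (if j \<in> I then m j * lookup q j else 0)" for q j
  proof -
    have "lookup (mq q) j = (\<Sum>i\<in>I. if j = i then m i * lookup q i else 0)"
      unfolding mq_def lookup_sum by (rule sum.cong) (auto simp: lookup_single when_def)
    thus ?thesis using fI by simp
  qed
  have mqA: "mq q \<in> A" for q unfolding A_def using lmq[of q] by (auto simp: in_keys_iff split: if_splits)
  have mq_add: "mq (p + q) = mq p + mq q" for p q
    by (rule poly_mapping_eqI) (simp add: lmq lookup_add distrib_left)
  have degmq: "deg (gev I \<phi> (\<rho> + mq q)) = deg (gev I \<phi> \<rho>) + N * ssum r q" for \<rho> q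
  proof -
    have "deg (gev I \<phi> (mq q)) = (\<Sum>i\<in>I. N * lookup q i)"
      unfolding degev by (rule sum.cong) (simp_all add: lmq m(1)[symmetric])
    thus ?thesis by (simp add: gev_add add ssum_def I_def sum_distrib_left)
  qed
  \<comment> \<open>Only remainders with degree divisible by \<open>N\<close> contribute to the
    degrees \<open>N * k\<close>; \<open>s \<rho>\<close> is the resulting shift of
    \<open>k\<close>.\<close>
  define Bd where "Bd = {\<rho> \<in> Bx. N dvd deg (gev I \<phi> \<rho>)}"
  have finBd: "finite Bd" using \<open>finite Bx\<close> unfolding Bd_def by simp
  define s where "s \<rho> = deg (gev I \<phi> \<rho>) div N" for \<rho>
  define Q where "Q \<rho> k = {q \<in> simplex_exps r k. \<rho> + mq q \<in> M}" for \<rho> k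
  \<comment> \<open>For a fixed remainder the quotients \<open>q\<close> leading out of
    \<open>M\<close> form an ideal, because the complement of \<open>M\<close> is one.
    \<open>F \<rho>\<close> is its finite set of minimal generators, so the count for
    \<open>\<rho>\<close> falls under \<open>evpoly_card_avoiding\<close>.\<close>
  define F where "F \<rho> = minl {q \<in> A. \<rho> + mq q \<notin> M}" for \<rho>
  have Q: "Q \<rho> k = {q \<in> simplex_exps r k. \<forall>f\<in>F \<rho>. \<not> ple f q}" if "\<rho> \<in> A" for \<rho> k
  proof -
    have "\<rho> + mq q \<in> M \<longleftrightarrow> (\<forall>f\<in>F \<rho>. \<not> ple f q)" if q: "q \<in> A" for q
    proof
      assume *: "\<rho> + mq q \<in> M"
      show "\<forall>f\<in>F \<rho>. \<not> ple f q"
      proof (intro ballI notI)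
        fix f assume f: "f \<in> F \<rho>" "ple f q"
        have fU: "f \<in> A" "\<rho> + mq f \<notin> M" using f(1) minl_subset unfolding F_def by blast+
        have "\<rho> + mq f + mq (q - f) \<notin> M"
          by (rule up) (use fU \<open>\<rho> \<in> A\<close> mqA Aadd in auto)
        moreover have "\<rho> + mq f + mq (q - f) = \<rho> + mq q"
          using ple_diff_add[OF f(2)] by (simp add: add.assoc mq_add[symmetric])
        ultimately show False using * by simp
      qed
    next
      assume *: "\<forall>f\<in>F \<rho>. \<not> ple f q"
      show "\<rho> + mq q \<in> M"
      proof (rule ccontr)
        assume "\<rho> + mq q \<notin> M"
        hence "\<exists>w\<in>F \<rho>. ple w q" unfolding F_def using q by (intro minl_below) blast
        thus False using * by blast
      qed
    qed
    thus ?thesis unfolding Q_def simplex_exps_def A_def I_def by blast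
  qed
  have finF: "finite (F \<rho>)" for \<rho> unfolding F_def
    by (rule finite_minl[OF fI]) (auto simp: A_def)
  have keysF: "keys f \<subseteq> {..<r}" if "f \<in> F \<rho>" for f \<rho>
    using that minl_subset unfolding F_def A_def I_def by blast
  have eQ: "evpoly (\<lambda>k. card (Q \<rho> k))" if "\<rho> \<in> A" for \<rho>
    unfolding Q[OF that] by (rule evpoly_card_avoiding[OF finF keysF])
  let ?g = "\<lambda>\<rho> k. if s \<rho> \<le> k then card (Q \<rho> (k - s \<rho>)) else 0"
  have "evpoly (\<lambda>k. \<Sum>\<rho>\<in>Bd. ?g \<rho> k)"
    by (rule evpoly_sum[OF finBd], rule evpoly_shift, rule eQ) (auto simp: Bd_def Bx_def)
  moreover have "card {x \<in> mgen G. deg x = N * k} = (\<Sum>\<rho>\<in>Bd. ?g \<rho> k)" for k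
  proof -
    \<comment> \<open>Division with remainder in every coordinate: a standard monomial of degree
      \<open>N * k\<close> is a remainder plus \<open>mq q\<close> in exactly one way.\<close>
    let ?P = "SIGMA \<rho>:{\<rho> \<in> Bd. s \<rho> \<le> k}. Q \<rho> (k - s \<rho>)"
    have "bij_betw (\<lambda>(\<rho>, q). \<rho> + mq q) ?P {a \<in> M. deg (gev I \<phi> a) = N * k}"
    proof (rule bij_betw_imageI)
      show "inj_on (\<lambda>(\<rho>, q). \<rho> + mq q) ?P"
      proof (rule inj_onI, clarify)
        fix \<rho> q \<rho>' q'
        assume *: "\<rho> \<in> Bd" "\<rho>' \<in> Bd" "q \<in> Q \<rho> (k - s \<rho>)" "q' \<in> Q \<rho>' (k - s \<rho>')" "\<rho> + mq q = \<rho>' + mq q'"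
        have e: "lookup \<rho> i = lookup \<rho>' i \<and> lookup q i = lookup q' i" if i: "i \<in> I" for i
        proof -
          have l: "lookup \<rho> i < m i" "lookup \<rho>' i < m i" using *(1,2) i unfolding Bd_def Bx_def by auto
          have eq: "lookup \<rho> i + m i * lookup q i = lookup \<rho>' i + m i * lookup q' i"
            using arg_cong[OF *(5), of "\<lambda>p. lookup p i"] i by (simp add: lookup_add lmq)
          have "(lookup \<rho> i + m i * lookup q i) mod m i = lookup \<rho> i" 
            "(lookup \<rho>' i + m i * lookup q' i) mod m i = lookup \<rho>' i" using l by simp_all
          hence "lookup \<rho> i = lookup \<rho>' i" using eq by simp
          thus ?thesis using eq m(2)[OF i] by simp
        qed
        have "\<rho> \<in> A" "\<rho>' \<in> A" "q \<in> A" "q' \<in> A"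
          using * unfolding Bd_def Bx_def Q_def simplex_exps_def A_def I_def by auto
        thus "\<rho> = \<rho>' \<and> q = q'" using Aeq e by blast
      qed
      show "(\<lambda>(\<rho>, q). \<rho> + mq q) ` ?P = {a \<in> M. deg (gev I \<phi> a) = N * k}"
      proof (intro equalityI subsetI)
        fix a assume "a \<in> (\<lambda>(\<rho>, q). \<rho> + mq q) ` ?P"
        then obtain \<rho> q where *: "\<rho> \<in> Bd" "s \<rho> \<le> k" "q \<in> Q \<rho> (k - s \<rho>)" "a = \<rho> + mq q" by auto
        have "deg (gev I \<phi> a) = N * s \<rho> + N * (k - s \<rho>)"
          using * unfolding degmq *(4) Q_def simplex_exps_def Bd_def s_def by simp
        also have "\<dots> = N * k" using *(2) by (simp add: distrib_left[symmetric])
        finally show "a \<in> {a \<in> M. deg (gev I \<phi> a) = N * k}" using *(3,4) unfolding Q_def by simp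
      next
        fix a assume a: "a \<in> {a \<in> M. deg (gev I \<phi> a) = N * k}"
        hence aA: "a \<in> A" unfolding M_def by blast
        obtain \<rho> where \<rho>: "\<forall>i\<in>I. lookup \<rho> i = lookup a i mod m i" "keys \<rho> \<subseteq> I"
          using ex_poly_mapping[OF fI, of "\<lambda>i. lookup a i mod m i"] by blast
        obtain q where q: "\<forall>i\<in>I. lookup q i = lookup a i div m i" "keys q \<subseteq> I"
          using ex_poly_mapping[OF fI, of "\<lambda>i. lookup a i div m i"] by blast
        have \<rho>A: "\<rho> \<in> A" using \<rho>(2) unfolding A_def by simp
        have eq: "a = \<rho> + mq q"
          by (rule Aeq[OF aA Aadd[OF \<rho>A mqA]]) (simp add: lookup_add lmq \<rho>(1) q(1))
        have d: "deg (gev I \<phi> \<rho>) + N * ssum r q = N * k" using a degmq[of \<rho> q] eq by simp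
        have "N dvd deg (gev I \<phi> \<rho>) + N * ssum r q" unfolding d by simp
        hence dv: "N dvd deg (gev I \<phi> \<rho>)" by (subst (asm) dvd_add_left_iff) simp_all
        have sq: "s \<rho> + ssum r q = k"
        proof -
          have "N * (s \<rho> + ssum r q) = N * k" using d dv by (simp add: s_def distrib_left)
          thus ?thesis using N by simp
        qed
        have "\<rho> \<in> Bd" using \<rho>A \<rho>(1) m(2) dv unfolding Bd_def Bx_def by simp
        moreover have "q \<in> Q \<rho> (k - s \<rho>)"
          using a eq q(2) sq unfolding Q_def simplex_exps_def I_def by auto
        ultimately have "(\<rho>, q) \<in> ?P" using sq by simp
        thus "a \<in> (\<lambda>(\<rho>, q). \<rho> + mq q) ` ?P" using eq by (intro image_eqI[of _ _ "(\<rho>, q)"]) simp_all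
      qed
    qed
    hence "card {a \<in> M. deg (gev I \<phi> a) = N * k} = card ?P" by (simp add: bij_betw_same_card)
    also have "\<dots> = (\<Sum>\<rho>\<in>{\<rho> \<in> Bd. s \<rho> \<le> k}. card (Q \<rho> (k - s \<rho>)))"
      by (rule card_SigmaI) (use finBd finite_simplex_exps in \<open>auto simp: Q_def\<close>)
    also have "\<dots> = (\<Sum>\<rho>\<in>Bd. ?g \<rho> k)"
      using finBd by (simp add: sum.inter_filter)
    finally show ?thesis using bij_betw_same_card[OF bij] by simp
  qed
  ultimately show ?thesis using N by (intro exI[of _ N]) simp
qed

subsection \<open>The number of exponents is polynomial along an arithmetic progression\<close>

text \<open>These are the exponents of the Rees algebra, with the power n as second component. The
  variables sit in degree 0, which makes the slices infinite and is the reason for cutting with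
  \<open>cut_eq_mgen\<close>.\<close>

lemma pexps_eq_mgen:
  fixes V :: "('n::finite \<Rightarrow>\<^sub>0 nat) set"
  shows "{(u, n). u \<in> pexps V n} = mgen ((\<lambda>v. (v, 1)) ` V \<union> range (\<lambda>i. (Poly_Mapping.single i 1, 0)))" (is "_ = mgen ?G")
proof (intro equalityI subsetI)
  fix x assume "x \<in> mgen ?G"
  thus "x \<in> {(u, n). u \<in> pexps V n}"
  proof induction
    case zero show ?case by (simp add: zero_prod_def)
  next
    case (step x g)
    obtain u n where x: "x = (u, n)" "u \<in> pexps V n" using step(3) by blast
    from step(2) consider v where "v \<in> V" "g = (v, 1)" | i where "g = (Poly_Mapping.single i 1, 0)" by blast
    then show ?case
    proof cases
      case 1
      have "v \<in> pexps V (Suc 0)" unfolding pexps_1 using 1(1) subset_upc by blast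
      hence "v + u \<in> pexps V (Suc 0 + n)" using x(2) by (rule pexps_add_mem)
      thus ?thesis using 1 x by simp
    next
      case 2
      have "u + Poly_Mapping.single i 1 \<in> pexps V n" using upclosed_pexps x(2) unfolding upclosed_def by blast
      thus ?thesis using 2 x by (simp add: add.commute)
    qed
  qed
next
  have single: "(w, 0) \<in> mgen ?G" for w
  proof (induction "pdeg w" arbitrary: w)
    case 0 thus ?case using mgen.zero[of ?G] by (simp add: zero_prod_def)
  next
    case (Suc k)
    then obtain i w' where w': "w = Poly_Mapping.single i 1 + w'" "pdeg w' = k" by (metis pdeg_Suc_obtain)
    have "(Poly_Mapping.single i 1, 0) + (w', 0) \<in> mgen ?G"
      by (rule mgen.step) (use Suc(1)[of w'] w' in auto)
    thus ?case using w' by simp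
  qed
  have ns: "(s, n) \<in> mgen ?G" if "s \<in> nsum V n" for s n
    using that
  proof (induction n arbitrary: s)
    case 0 thus ?case using mgen.zero[of ?G] by (simp add: zero_prod_def)
  next
    case (Suc n)
    then obtain u v where "s = u + v" "u \<in> nsum V n" "v \<in> V" by auto
    moreover from this have "(v, 1) + (u, n) \<in> mgen ?G" by (intro mgen.step Suc(1)) auto
    ultimately show ?case by (simp add: add.commute)
  qed
  fix x assume "x \<in> {(u, n). u \<in> pexps V n}"
  then obtain u n s where x: "x = (u, n)" "s \<in> nsum V n" "ple s u" unfolding pexps_def upc_def by blast
  have "(s, n) + (u - s, 0) \<in> mgen ?G" using ns[OF x(2)] single by (rule mgen_add)
  thus "x \<in> mgen ?G" using ple_diff_add[OF x(3)] x(1) by simp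
qed

lemma ple_obtain_pdeg:
  assumes "k \<le> pdeg u"
  shows "\<exists>w. ple w u \<and> pdeg w = k"
  using assms
proof (induction k)
  case 0 show ?case by (intro exI[of _ 0]) (simp add: ple_def)
next
  case (Suc k)
  then obtain w where w: "ple w u" "pdeg w = k" by auto
  obtain j where j: "pdeg u = Suc j + k" using Suc(2) by (metis add.commute add_Suc_shift le_iff_add)
  have u: "u = w + (u - w)" using ple_diff_add[OF w(1)] by simp
  hence "pdeg u = pdeg w + pdeg (u - w)" by (metis pdeg_add)
  hence "pdeg (u - w) = Suc j" using j w(2) by simp
  then obtain i w' where w': "u - w = Poly_Mapping.single i 1 + w'" "pdeg w' = j" by (rule pdeg_Suc_obtain)
  have "u = (w + Poly_Mapping.single i 1) + w'" using u w'(1) by (simp add: add.assoc)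
  hence "ple (w + Poly_Mapping.single i 1) u" using ple_add by metis
  thus ?case using w(2) by (intro exI[of _ "w + Poly_Mapping.single i 1"]) (simp add: pdeg_add)
qed

text \<open>The cone is generated in degree 1: an exponent of degree at most
  \<open>B * Suc n\<close> has a divisor of degree at most \<open>B\<close> whose removal leaves
  degree at most \<open>B * n\<close>.\<close>

lemma cut_eq_mgen: "{(u, n). pdeg u \<le> B * n} = mgen ((\<lambda>w. (w, 1)) ` {w. pdeg w \<le> B})" (is "_ = mgen ?G")
proof (intro equalityI subsetI)
  fix x assume "x \<in> mgen ?G"
  thus "x \<in> {(u, n). pdeg u \<le> B * n}"
    by induction (auto simp: zero_prod_def pdeg_add)
next
  have "(u, n) \<in> mgen ?G" if "pdeg u \<le> B * n" for u n
    using that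
  proof (induction n arbitrary: u)
    case 0 thus ?case using mgen.zero[of ?G] by (simp add: zero_prod_def)
  next
    case (Suc n)
    obtain w where w: "ple w u" "pdeg w = min B (pdeg u)" using ple_obtain_pdeg[of "min B (pdeg u)" u] by auto
    have u: "u = w + (u - w)" using ple_diff_add[OF w(1)] by simp
    hence "pdeg u = pdeg w + pdeg (u - w)" by (metis pdeg_add)
    hence "pdeg (u - w) \<le> B * n" using w(2) Suc(2) by (simp add: min_def split: if_splits)
    hence "(w, 1) + (u - w, n) \<in> mgen ?G" by (intro mgen.step Suc(1)) (use w(2) in auto)
    thus ?case using u by simp
  qed
  thus "x \<in> mgen ?G" if "x \<in> {(u, n). pdeg u \<le> B * n}" for x using that by blast
qed

text \<open>Cutting by total degree makes the slices finite and leaves 0 as the only element with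
  second component 0, so all nonzero generators have positive degree, as
  \<open>evpoly_card_graded_monoid\<close> demands.\<close>

lemma evpoly_card_INT_pexps:
  fixes V :: "'i \<Rightarrow> ('n::finite \<Rightarrow>\<^sub>0 nat) set"
  assumes "finite I" "\<And>i. i \<in> I \<Longrightarrow> finite (V i)"
  shows "\<exists>N>0. evpoly (\<lambda>k. card {u \<in> (\<Inter>i\<in>I. pexps (V i) (N * k)). pdeg u \<le> B * (N * k)})"
proof -
  let ?H = "(\<lambda>w :: 'n \<Rightarrow>\<^sub>0 nat. (w, 1::nat)) ` {w. pdeg w \<le> B}"
  let ?G = "\<lambda>i. (\<lambda>v. (v, 1)) ` V i \<union> range (\<lambda>i. (Poly_Mapping.single i 1, 0::nat))"
  have "finite {w :: 'n \<Rightarrow>\<^sub>0 nat. pdeg w \<le> B}"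
    by (rule finite_subset[OF _ finite_bounded_exps[of B]]) (auto intro: le_trans[OF lookup_le_pdeg])
  hence "finite ?H" by simp
  then obtain F where F: "finite F" "(\<Inter>i\<in>I. mgen (?G i)) \<inter> mgen ?H = mgen F"
    using mgen_INT_finite[OF assms(1), of ?H ?G] assms(2) by auto
  have M: "mgen F = {(u, n). (\<forall>i\<in>I. u \<in> pexps (V i) n) \<and> pdeg u \<le> B * n}"
    unfolding F(2)[symmetric] pexps_eq_mgen[symmetric] cut_eq_mgen[symmetric] by auto
  have "\<exists>N>0. evpoly (\<lambda>k. card {x \<in> mgen (F - {0}). snd x = N * k})"
  proof (rule evpoly_card_graded_monoid)
    show "finite (F - {0})" using F(1) by simp
    show "snd (x + y) = snd x + snd y" for x y :: "('n \<Rightarrow>\<^sub>0 nat) \<times> nat" by simp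
    fix g assume g: "g \<in> F - {0}"
    hence "g \<in> mgen F" by (intro mgen_base) simp
    hence "pdeg (fst g) \<le> B * snd g" unfolding M by auto
    hence "snd g = 0 \<Longrightarrow> g = 0" by (simp add: prod_eq_iff)
    thus "1 \<le> snd g" using g by (cases "snd g") auto
  qed
  then obtain N where N: "N > 0" "evpoly (\<lambda>k. card {x \<in> mgen F. snd x = N * k})"
    unfolding mgen_remove_0 by blast
  have "card {x \<in> mgen F. snd x = n} = card {u \<in> (\<Inter>i\<in>I. pexps (V i) n). pdeg u \<le> B * n}" for n
  proof -
    have "{x \<in> mgen F. snd x = n} = (\<lambda>u. (u, n)) ` {u \<in> (\<Inter>i\<in>I. pexps (V i) n). pdeg u \<le> B * n}"
      unfolding M by auto
    thus ?thesis by (simp add: card_image inj_on_def)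
  qed
  thus ?thesis using N by auto
qed

lemma evpoly_card_sat_diff:
  fixes V :: "('n::finite \<Rightarrow>\<^sub>0 nat) set"
  assumes "finite V"
  shows "\<exists>N>0. evpoly (\<lambda>k. card (sat (pexps V (N * k)) - pexps V (N * k)))"
proof -
  obtain K where K: "\<And>v i. v \<in> V \<Longrightarrow> lookup v i \<le> K" using exps_bound_obtain[OF assms] by blast
  \<comment> \<open>By \<open>sat_diff_bounded\<close> every point of the difference has total
    degree at most \<open>B * n\<close>. Cutting both sets at this degree makes them finite and does
    not change their difference.\<close>
  define B where "B = CARD('n) * K"
  define f where "f n = card {u \<in> sat (pexps V n). pdeg u \<le> B * n}" for n
  define g where "g n = card {u \<in> pexps V n. pdeg u \<le> B * n}" for n
  have fin: "finite {u :: 'n \<Rightarrow>\<^sub>0 nat. pdeg u \<le> m}" for m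
    by (rule finite_subset[OF _ finite_bounded_exps[of m]]) (auto intro: le_trans[OF lookup_le_pdeg])
  have eq: "card (sat (pexps V n) - pexps V n) = f n - g n" and le: "g n \<le> f n" for n
  proof -
    have "pdeg u \<le> B * n" if "u \<in> sat (pexps V n) - pexps V n" for u
    proof -
      have "lookup u i \<le> n * K" for i
        by (rule less_imp_le, rule sat_diff_bounded[OF K]) (use that in blast)+
      hence "pdeg u \<le> (\<Sum>i\<in>(UNIV::'n set). n * K)" unfolding pdeg_def by (intro sum_mono)
      thus ?thesis by (simp add: B_def mult.commute mult.left_commute)
    qed
    hence "sat (pexps V n) - pexps V n = {u \<in> sat (pexps V n). pdeg u \<le> B * n} - {u \<in> pexps V n. pdeg u \<le> B * n}"
      by blast
    moreover have sub: "{u \<in> pexps V n. pdeg u \<le> B * n} \<subseteq> {u \<in> sat (pexps V n). pdeg u \<le> B * n}"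
      using subset_sat by auto
    moreover have fs: "finite {u \<in> S. pdeg u \<le> B * n}" for S :: "('n \<Rightarrow>\<^sub>0 nat) set"
      by (rule finite_subset[OF _ fin[of "B * n"]]) auto
    ultimately show "card (sat (pexps V n) - pexps V n) = f n - g n"
      unfolding f_def g_def by (simp only: card_Diff_subset)
    show "g n \<le> f n" unfolding f_def g_def by (rule card_mono[OF fs sub])
  qed
  obtain N1 where N1: "N1 > 0" "evpoly (\<lambda>k. f (N1 * k))"
    using evpoly_card_INT_pexps[of UNIV "\<lambda>i. zcoord i ` V" B] assms unfolding f_def sat_pexps by auto
  obtain N2 where N2: "N2 > 0" "evpoly (\<lambda>k. g (N2 * k))"
    using evpoly_card_INT_pexps[of "{()}" "\<lambda>_. V" B] assms unfolding g_def by auto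
  have "evpoly (\<lambda>k. f (N1 * N2 * k))" "evpoly (\<lambda>k. g (N1 * N2 * k))"
    using evpoly_scale[OF N1(2) N2(1)] evpoly_scale[OF N2(2) N1(1)] by (simp_all add: ac_simps)
  hence "evpoly (\<lambda>k. f (N1 * N2 * k) - g (N1 * N2 * k))" using le by (rule evpoly_diff)
  thus ?thesis using N1(1) N2(1) unfolding eq by (intro exI[of _ "N1 * N2"]) simp
qed

text \<open>A polynomial that converges after division by the d-th power has degree at most d, and
  the limit is its coefficient in degree d. The factor \<open>real N ^ d\<close> comes from sampling
  along multiples of \<open>N\<close>.\<close>

lemma evpoly_limit_rational:
  assumes f: "evpoly (\<lambda>k. f (N * k))" and N: "N > 0"
    and lim: "(\<lambda>n. real (f n) / real n ^ d) \<longlonglongrightarrow> L"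
  shows "L \<in> \<rat>"
proof -
  obtain p :: "rat poly" where p: "\<forall>\<^sub>F k in sequentially. of_nat (f (N * k)) = poly p (of_nat k)"
    using f unfolding evpoly_def by blast
  define h where "h k = (of_rat (poly p (of_nat k)) :: real)" for k
  have h: "h k = (\<Sum>i\<le>Polynomial.degree p. of_rat (Polynomial.coeff p i) * real k ^ i)" for k
    by (simp add: h_def poly_altdef of_rat_sum of_rat_mult of_rat_power)
  have sub: "filterlim (\<lambda>k. N * k) sequentially sequentially"
    using N by (intro filterlim_subseq) (simp add: strict_mono_def)
  have l1: "(\<lambda>k. real (f (N * k)) / real (N * k) ^ d) \<longlonglongrightarrow> L"
    using filterlim_compose[OF lim sub] .
  have "(\<lambda>k. h k / real k ^ d) \<longlonglongrightarrow> real N ^ d * L"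
  proof (rule Lim_transform_eventually)
    show "(\<lambda>k. real N ^ d * (real (f (N * k)) / real (N * k) ^ d)) \<longlonglongrightarrow> real N ^ d * L"
      using l1 by (intro tendsto_intros)
    show "\<forall>\<^sub>F k in sequentially. real N ^ d * (real (f (N * k)) / real (N * k) ^ d) = h k / real k ^ d"
      using p
    proof eventually_elim
      case (elim k)
      have "real (f (N * k)) = of_rat (of_nat (f (N * k)))" by simp
      also have "\<dots> = h k" unfolding elim h_def ..
      finally show ?case using N by (simp add: power_mult_distrib)
    qed
  qed
  note l2 = this
  define m where "m = Polynomial.degree p"
  have inv0: "(\<lambda>k. (1 / real k) ^ j) \<longlonglongrightarrow> (if j = 0 then 1 else 0)" for j
  proof (cases "j = 0")
    case False
    have "(\<lambda>k. (1 / real k) ^ j) \<longlonglongrightarrow> 0 ^ j" by (intro tendsto_power lim_1_over_n)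
    thus ?thesis using False by (simp add: power_0_left)
  qed simp
  have l3: "(\<lambda>k. h k / real k ^ m) \<longlonglongrightarrow> of_rat (Polynomial.coeff p m)"
  proof (rule Lim_transform_eventually)
    have "(\<lambda>k. \<Sum>i\<le>m. of_rat (Polynomial.coeff p i) * (1 / real k) ^ (m - i)) \<longlonglongrightarrow>
       (\<Sum>i\<le>m. of_rat (Polynomial.coeff p i) * (if m - i = 0 then 1 else 0))"
      by (intro tendsto_sum tendsto_mult tendsto_const inv0)
    also have "(\<Sum>i\<le>m. of_rat (Polynomial.coeff p i) * (if m - i = 0 then 1 else 0)) = 
       (\<Sum>i\<le>m. if i = m then of_rat (Polynomial.coeff p i) else (0::real))"
      by (intro sum.cong) auto
    also have "\<dots> = of_rat (Polynomial.coeff p m)" by simp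
    finally show "(\<lambda>k. \<Sum>i\<le>m. of_rat (Polynomial.coeff p i) * (1 / real k) ^ (m - i)) \<longlonglongrightarrow> of_rat (Polynomial.coeff p m)" .
    show "\<forall>\<^sub>F k in sequentially. (\<Sum>i\<le>m. of_rat (Polynomial.coeff p i) * (1 / real k) ^ (m - i)) = h k / real k ^ m"
      using eventually_gt_at_top[of 0]
    proof eventually_elim
      case (elim k)
      show ?case unfolding h m_def[symmetric] sum_divide_distrib
      proof (rule sum.cong[OF refl])
        fix i assume "i \<in> {..m}"
        hence "real k ^ m = real k ^ i * real k ^ (m - i)" by (simp add: power_add[symmetric])
        thus "of_rat (Polynomial.coeff p i) * (1 / real k) ^ (m - i) = of_rat (Polynomial.coeff p i) * real k ^ i / real k ^ m"
          using elim by (simp add: power_one_over field_simps)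
      qed
    qed
  qed
  have "real N ^ d * L \<in> \<rat>"
  proof (cases "m \<le> d")
    case True
    have "(\<lambda>k. h k / real k ^ m * (1 / real k) ^ (d - m)) \<longlonglongrightarrow> of_rat (Polynomial.coeff p m) * (if d - m = 0 then 1 else 0)"
      by (intro tendsto_mult l3 inv0)
    moreover have "h k / real k ^ m * (1 / real k) ^ (d - m) = h k / real k ^ d" for k
      using True by (simp add: power_one_over power_add[symmetric])
    ultimately have "real N ^ d * L = of_rat (Polynomial.coeff p m) * (if d - m = 0 then 1 else 0)"
      using LIMSEQ_unique[OF l2] by simp
    thus ?thesis by simp
  next
    case False
    \<comment> \<open>In excessive degree the normalized sequence would tend to 0 and to the leading
      coefficient at once, so the polynomial would be 0.\<close>
    have "(\<lambda>k. h k / real k ^ d * (1 / real k) ^ (m - d)) \<longlonglongrightarrow> real N ^ d * L * (if m - d = 0 then 1 else 0)"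
      by (intro tendsto_mult l2 inv0)
    moreover have "h k / real k ^ d * (1 / real k) ^ (m - d) = h k / real k ^ m" for k
      using False by (simp add: power_one_over power_add[symmetric])
    ultimately have "of_rat (Polynomial.coeff p m) = (0::real)"
      using LIMSEQ_unique[OF l3] False by simp
    hence "p = 0" unfolding m_def by (simp add: leading_coeff_0_iff)
    thus ?thesis using False by (simp add: m_def)
  qed
  hence "real N ^ d * L / real N ^ d \<in> \<rat>" by (intro Rats_divide) auto
  thus ?thesis using N by simp
qed


section \<open>Newton polyhedra\<close>

text \<open>For finite \<open>V\<close>, the Newton polyhedron dilated by \<open>t\<close>;
  \<open>newton_eq_NP\<close> treats \<open>t = 1\<close>. Listing the coefficients and keeping
  \<open>t\<close> variable makes sums and multiples immediate and prepares for rounding the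
  coefficients.\<close>

definition NP :: "('n::finite \<Rightarrow>\<^sub>0 nat) set \<Rightarrow> real \<Rightarrow> (real ^ 'n) set" where
  "NP V t = {x. \<exists>l. (\<forall>v\<in>V. 0 \<le> l v) \<and> sum l V = t \<and> (\<forall>i. (\<Sum>v\<in>V. l v * real (lookup v i)) \<le> x $ i)}"

lemma NP_I:
  fixes x :: "real ^ 'n::finite"
  assumes "\<And>v. v \<in> V \<Longrightarrow> 0 \<le> l v" "sum l V = t" "\<And>i. (\<Sum>v\<in>V. l v * real (lookup v i)) \<le> x $ i"
  shows "x \<in> NP V t"
  unfolding NP_def using assms by blast

lemma NP_E:
  fixes x :: "real ^ 'n::finite"
  assumes "x \<in> NP V t"
  obtains l where "\<And>v. v \<in> V \<Longrightarrow> 0 \<le> l v" "sum l V = t" "\<And>i. (\<Sum>v\<in>V. l v * real (lookup v i)) \<le> x $ i"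
  using assms unfolding NP_def by blast

lemma NP_add:
  fixes x y :: "real ^ 'n::finite"
  assumes "x \<in> NP V s" "y \<in> NP V t"
  shows "x + y \<in> NP V (s + t)"
proof -
  obtain l where l: "\<And>v. v \<in> V \<Longrightarrow> 0 \<le> l v" "sum l V = s" "\<And>i. (\<Sum>v\<in>V. l v * real (lookup v i)) \<le> x $ i"
    using NP_E[OF assms(1)] by blast
  obtain m where m: "\<And>v. v \<in> V \<Longrightarrow> 0 \<le> m v" "sum m V = t" "\<And>i. (\<Sum>v\<in>V. m v * real (lookup v i)) \<le> y $ i"
    using NP_E[OF assms(2)] by blast
  show ?thesis
  proof (rule NP_I[of V "\<lambda>v. l v + m v"])
    fix i show "(\<Sum>v\<in>V. (l v + m v) * real (lookup v i)) \<le> (x + y) $ i"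
      using add_mono[OF l(3)[of i] m(3)[of i]] by (simp add: distrib_right sum.distrib)
  qed (use l m in \<open>simp_all add: sum.distrib\<close>)
qed

lemma NP_scale:
  fixes x :: "real ^ 'n::finite"
  assumes "x \<in> NP V t" "0 \<le> c"
  shows "c *\<^sub>R x \<in> NP V (c * t)"
proof -
  obtain l where l: "\<And>v. v \<in> V \<Longrightarrow> 0 \<le> l v" "sum l V = t" "\<And>i. (\<Sum>v\<in>V. l v * real (lookup v i)) \<le> x $ i"
    using NP_E[OF assms(1)] by blast
  show ?thesis
  proof (rule NP_I[of V "\<lambda>v. c * l v"])
    fix i show "(\<Sum>v\<in>V. (c * l v) * real (lookup v i)) \<le> (c *\<^sub>R x) $ i"
      using mult_left_mono[OF l(3)[of i] assms(2)] by (simp add: sum_distrib_left mult.assoc)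
  qed (use l assms in \<open>simp_all add: sum_distrib_left[symmetric]\<close>)
qed

lemma NP_up:
  fixes x y :: "real ^ 'n::finite"
  assumes "x \<in> NP V t" "\<And>i. x $ i \<le> y $ i"
  shows "y \<in> NP V t"
proof -
  obtain l where l: "\<And>v. v \<in> V \<Longrightarrow> 0 \<le> l v" "sum l V = t" "\<And>i. (\<Sum>v\<in>V. l v * real (lookup v i)) \<le> x $ i"
    using NP_E[OF assms(1)] by blast
  show ?thesis
    by (rule NP_I[of V l]) (use l in \<open>auto intro: order_trans[OF l(3) assms(2)]\<close>)
qed

lemma NP_nonneg:
  fixes x :: "real ^ 'n::finite"
  assumes "x \<in> NP V t"
  shows "0 \<le> x $ i"
proof -
  obtain l where l: "\<And>v. v \<in> V \<Longrightarrow> 0 \<le> l v" "sum l V = t" "\<And>i. (\<Sum>v\<in>V. l v * real (lookup v i)) \<le> x $ i"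
    using NP_E[OF assms] by blast
  have "0 \<le> (\<Sum>v\<in>V. l v * real (lookup v i))" using l(1) by (intro sum_nonneg) simp
  thus ?thesis using l(3)[of i] by linarith
qed

lemma NP_0: "0 \<in> NP V 0"
  by (rule NP_I[of V "\<lambda>_. 0"]) simp_all

lemma NP_sum:
  assumes "finite W" "\<And>w. w \<in> W \<Longrightarrow> f w \<in> NP V (c w)"
  shows "sum f W \<in> NP V (sum c W)"
  using assms by (induction W rule: finite_induct) (simp_all add: NP_0 NP_add)

lemma real_exp_add: "real_exp (u + v) = real_exp u + real_exp v"
  by (simp add: real_exp_def vec_eq_iff lookup_add)

lemma real_exp_nth [simp]: "real_exp v $ i = real (lookup v i)"
  by (simp add: real_exp_def)

lemma NP_gen:
  assumes "finite V" "v \<in> V"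
  shows "real_exp v \<in> NP V 1"
proof (rule NP_I[of V "\<lambda>w. if w = v then 1 else 0"])
  fix i
  have "(\<Sum>w\<in>V. (if w = v then 1 else 0) * real (lookup w i)) = (\<Sum>w\<in>V. if w = v then real (lookup w i) else 0)"
    by (rule sum.cong) auto
  thus "(\<Sum>w\<in>V. (if w = v then 1 else 0) * real (lookup w i)) \<le> real_exp v $ i" using assms by simp
qed (use assms in auto)

lemma convex_NP: "convex (NP V 1)"
proof (rule convexI)
  fix x y :: "real ^ 'a" and u v :: real
  assume "x \<in> NP V 1" "y \<in> NP V 1" "0 \<le> u" "0 \<le> v" "u + v = 1"
  thus "u *\<^sub>R x + v *\<^sub>R y \<in> NP V 1"
    using NP_add[OF NP_scale[of x V 1 u] NP_scale[of y V 1 v]] by simp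
qed

lemma NP_divide_iff:
  assumes "n > 0"
  shows "(1 / real n) *\<^sub>R x \<in> NP V 1 \<longleftrightarrow> x \<in> NP V (real n)"
proof
  assume "(1 / real n) *\<^sub>R x \<in> NP V 1"
  from NP_scale[OF this, of "real n"] show "x \<in> NP V (real n)" using assms by simp
next
  assume "x \<in> NP V (real n)"
  from NP_scale[OF this, of "1 / real n"] show "(1 / real n) *\<^sub>R x \<in> NP V 1" using assms by simp
qed

lemma newton_eq_NP:
  fixes V :: "('n::finite \<Rightarrow>\<^sub>0 nat) set"
  assumes "finite V"
  shows "{x + y | x y. x \<in> convex hull (real_exp ` V) \<and> y \<in> orthant} = NP V 1"
proof (intro equalityI subsetI)
  fix z assume "z \<in> {x + y | x y. x \<in> convex hull (real_exp ` V) \<and> y \<in> orthant}"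
  then obtain x y where z: "z = x + y" "x \<in> convex hull (real_exp ` V)" "y \<in> orthant" by blast
  have "convex hull (real_exp ` V) \<subseteq> NP V 1"
    by (rule hull_minimal) (use NP_gen[OF assms] convex_NP in auto)
  hence "x \<in> NP V 1" using z(2) by blast
  thus "z \<in> NP V 1" by (rule NP_up) (use z in \<open>simp add: orthant_def\<close>)
next
  fix z assume "z \<in> NP V 1"
  then obtain l where l: "\<And>v. v \<in> V \<Longrightarrow> 0 \<le> l v" "sum l V = 1" "\<And>i. (\<Sum>v\<in>V. l v * real (lookup v i)) \<le> z $ i"
    using NP_E by blast
  define x :: "real ^ 'n" where "x = (\<Sum>v\<in>V. l v *\<^sub>R real_exp v)"
  have "x \<in> convex hull (real_exp ` V)"
    unfolding x_def by (rule convex_sum) (use assms l in \<open>auto intro: hull_inc\<close>)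
  moreover have "z - x \<in> orthant" using l(3) by (simp add: orthant_def x_def)
  moreover have "z = x + (z - x)" by simp
  ultimately show "z \<in> {x + y | x y. x \<in> convex hull (real_exp ` V) \<and> y \<in> orthant}" by blast
qed

lemma closed_NP:
  assumes "finite V"
  shows "closed (NP V 1)"
proof -
  have o: "closed (orthant :: (real ^ 'a) set)"
    unfolding orthant_def by (intro closed_Collect_all closed_Collect_le continuous_intros)
  have "compact (convex hull (real_exp ` V))"
    using assms by (intro compact_convex_hull finite_imp_compact) simp
  hence "closed (\<Union>x\<in>convex hull (real_exp ` V). \<Union>y\<in>orthant. {x + y})" using o by (rule compact_closed_sums)
  moreover have "(\<Union>x\<in>convex hull (real_exp ` V). \<Union>y\<in>orthant. {x + y}) = NP V 1"
    unfolding newton_eq_NP[OF assms, symmetric] by blast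
  ultimately show ?thesis by simp
qed

lemma pexps_imp_NP:
  assumes "finite V" "u \<in> pexps V n"
  shows "real_exp u \<in> NP V (real n)"
proof -
  have ns: "real_exp s \<in> NP V (real n)" if "s \<in> nsum V n" for s n
    using that
  proof (induction n arbitrary: s)
    case 0
    hence "real_exp s = 0" by (simp add: vec_eq_iff)
    thus ?case using NP_0[of V] by simp
  next
    case (Suc n)
    then obtain a v where s: "s = a + v" "a \<in> nsum V n" "v \<in> V" by auto
    have "real_exp a + real_exp v \<in> NP V (real n + 1)"
      by (intro NP_add Suc(1) NP_gen assms s)
    thus ?case by (simp add: s(1) real_exp_add add.commute)
  qed
  obtain s where s: "s \<in> nsum V n" "ple s u" using assms(2) unfolding pexps_def upc_def by blast
  show ?thesis by (rule NP_up[OF ns[OF s(1)]]) (use s(2) in \<open>simp add: ple_def\<close>)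
qed

text \<open>The converse of \<open>pexps_imp_NP\<close> up to a bounded error. Rounding the
  coefficients down loses less than 1 for each generator, and restoring the total n costs at most
  \<open>card V * K\<close> in each coordinate, uniformly in n.\<close>

lemma NP_imp_pexps:
  fixes x :: "real ^ 'n::finite" and V :: "('n::finite \<Rightarrow>\<^sub>0 nat) set"
  assumes V: "finite V" "V \<noteq> {}" and K: "\<And>v i. v \<in> V \<Longrightarrow> lookup v i \<le> K"
    and kap: "\<kappa> \<ge> card V * K" and x: "x \<in> NP V (real n)" and xu: "\<And>i. x $ i \<le> real (lookup u i) - real \<kappa>"
  shows "u \<in> pexps V n"
proof -
  obtain l where l: "\<And>v. v \<in> V \<Longrightarrow> 0 \<le> l v" "sum l V = real n" "\<And>i. (\<Sum>v\<in>V. l v * real (lookup v i)) \<le> x $ i"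
    using NP_E[OF x] by blast
  obtain v1 where v1: "v1 \<in> V" using V(2) by blast
  define a where "a v = nat \<lfloor>l v\<rfloor>" for v
  have a1: "real (a v) \<le> l v" "l v \<le> real (a v) + 1" if "v \<in> V" for v
    using l(1)[OF that] by (simp_all add: a_def)
  have "real (sum a V) \<le> real n" unfolding l(2)[symmetric] of_nat_sum by (rule sum_mono) (rule a1)
  hence an: "sum a V \<le> n" by (simp only: of_nat_le_iff)
  have "real n \<le> (\<Sum>v\<in>V. real (a v) + 1)" unfolding l(2)[symmetric] by (rule sum_mono) (rule a1)
  hence "real n \<le> real (sum a V + card V)" by (simp add: sum.distrib)
  hence e: "n - sum a V \<le> card V" by linarith
  \<comment> \<open>The whole deficit of the rounded coefficients is charged to the single generator
    \<open>v1\<close>.\<close>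
  define b where "b v = a v + (if v = v1 then n - sum a V else 0)" for v
  have sb: "sum b V = n" using v1 V(1) an by (simp add: b_def sum.distrib)
  define s where "s = (\<Sum>v\<in>V. \<Sum>_<b v. v)"
  have sN: "s \<in> nsum V n" using nsum_scale[OF V(1) order_refl, of b] unfolding sb s_def .
  have "lookup s i \<le> lookup u i" for i
  proof -
    have "lookup s i = (\<Sum>v\<in>V. b v * lookup v i)" by (simp add: s_def lookup_sum)
    also have "\<dots> = (\<Sum>v\<in>V. a v * lookup v i + (if v = v1 then (n - sum a V) * lookup v i else 0))"
      by (rule sum.cong) (simp_all add: b_def distrib_right)
    also have "\<dots> = (\<Sum>v\<in>V. a v * lookup v i) + (n - sum a V) * lookup v1 i"
      using V(1) v1 by (simp add: sum.distrib)
    finally have "real (lookup s i) = real (\<Sum>v\<in>V. a v * lookup v i) + real ((n - sum a V) * lookup v1 i)"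
      by (simp only: of_nat_add)
    moreover have "(n - sum a V) * lookup v1 i \<le> \<kappa>"
      using mult_le_mono[OF e K[OF v1, of i]] kap by linarith
    hence "real ((n - sum a V) * lookup v1 i) \<le> real \<kappa>" by (simp only: of_nat_le_iff)
    moreover have "real (\<Sum>v\<in>V. a v * lookup v i) \<le> (\<Sum>v\<in>V. l v * real (lookup v i))"
      unfolding of_nat_sum of_nat_mult by (rule sum_mono, rule mult_right_mono) (use a1 in auto)
    ultimately have "real (lookup s i) \<le> real (lookup u i)" using l(3)[of i] xu[of i] by linarith
    thus ?thesis by simp
  qed
  thus ?thesis using sN unfolding pexps_def upc_def ple_def by blast
qed

subsection \<open>Facets and their rational normal vectors\<close>

text \<open>Homogenization: \<open>NP V 1\<close> is the slice at height 1 of a finitely generated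
  cone, which is a polyhedron. Generators lie at height 1, the axis directions at height 0.\<close>

lemma polyhedron_NP:
  fixes V :: "('n::finite \<Rightarrow>\<^sub>0 nat) set"
  assumes "finite V"
  shows "polyhedron (NP V 1)"
proof -
  define G :: "((real ^ 'n) \<times> real) set" where
    "G = (\<lambda>v. (real_exp v, 1)) ` V \<union> range (\<lambda>i. (axis i 1, 0))"
  define C where "C = convex_cone hull G"
  have "finite G" using assms by (simp add: G_def)
  hence "polyhedron C" unfolding C_def by (rule polyhedron_convex_cone_hull)
  then obtain F where F: "finite F" "C = \<Inter>F" "\<forall>h\<in>F. \<exists>a b. a \<noteq> 0 \<and> h = {x. a \<bullet> x \<le> b}"
    unfolding polyhedron_def by blast
  have Csub: "C \<subseteq> {p. 0 \<le> snd p \<and> fst p \<in> NP V (snd p)}"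
    unfolding C_def
  proof (rule hull_minimal)
    have "axis i 1 \<in> NP V 0" for i :: 'n
      by (rule NP_up[OF NP_0]) (simp add: axis_def)
    thus "G \<subseteq> {p. 0 \<le> snd p \<and> fst p \<in> NP V (snd p)}"
      unfolding G_def using NP_gen[OF assms] by auto
    show "convex_cone {p :: (real ^ 'n) \<times> real. 0 \<le> snd p \<and> fst p \<in> NP V (snd p)}"
      unfolding convex_cone_iff by (auto simp: NP_0 NP_add NP_scale)
  qed
  have Csum: "sum f W \<in> C" if "finite W" "\<And>w. w \<in> W \<Longrightarrow> f w \<in> C" for f :: "'c \<Rightarrow> (real^'n) \<times> real" and W
    using that by (induction W rule: finite_induct)
      (simp_all add: C_def convex_cone_hull_contains_0 convex_cone_hull_add)
  have eq: "x \<in> NP V 1 \<longleftrightarrow> (x, 1) \<in> C" for x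
  proof
    assume "(x, 1) \<in> C" thus "x \<in> NP V 1" using Csub by auto
  next
    assume "x \<in> NP V 1"
    then obtain l where l: "\<And>v. v \<in> V \<Longrightarrow> 0 \<le> l v" "sum l V = 1" "\<And>i. (\<Sum>v\<in>V. l v * real (lookup v i)) \<le> x $ i"
      using NP_E by blast
    define y where "y i = x $ i - (\<Sum>v\<in>V. l v * real (lookup v i))" for i
    have y: "0 \<le> y i" for i using l(3)[of i] by (simp add: y_def)
    have "(\<Sum>v\<in>V. l v *\<^sub>R (real_exp v, 1)) \<in> C"
      by (rule Csum[OF assms], unfold C_def, rule convex_cone_hull_mul, rule hull_inc) (use l(1) in \<open>auto simp: G_def\<close>)
    moreover have "(\<Sum>i\<in>UNIV. y i *\<^sub>R (axis i 1, 0)) \<in> C"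
      by (rule Csum[OF finite], unfold C_def, rule convex_cone_hull_mul, rule hull_inc) (use y in \<open>auto simp: G_def\<close>)
    ultimately have "(\<Sum>v\<in>V. l v *\<^sub>R (real_exp v, 1)) + (\<Sum>i\<in>UNIV. y i *\<^sub>R (axis i 1, 0)) \<in> C"
      unfolding C_def by (rule convex_cone_hull_add)
    moreover have "(\<Sum>v\<in>V. l v *\<^sub>R (real_exp v, 1)) + (\<Sum>i\<in>UNIV. y i *\<^sub>R (axis i 1, 0)) = (x, 1::real)"
    proof (rule prod_eqI)
      show "fst ((\<Sum>v\<in>V. l v *\<^sub>R (real_exp v, 1::real)) + (\<Sum>i\<in>UNIV. y i *\<^sub>R (axis i 1, 0))) = fst (x, 1::real)"
      proof (simp add: fst_sum vec_eq_iff, intro allI)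
        fix i
        have "(\<Sum>j\<in>UNIV. y j * axis j 1 $ i) = (\<Sum>j\<in>UNIV. if j = i then y j else 0)"
          by (rule sum.cong) (auto simp: axis_def)
        thus "(\<Sum>v\<in>V. l v * real (lookup v i)) + (\<Sum>j\<in>UNIV. y j * axis j 1 $ i) = x $ i"
          by (simp add: y_def)
      qed
    qed (simp add: snd_sum l(2))
    ultimately show "(x, 1) \<in> C" by simp
  qed
  have "NP V 1 = \<Inter>((\<lambda>h. {x. (x, 1) \<in> h}) ` F)" using eq F(2) by auto
  moreover have "polyhedron {x :: real^'n. (x, 1::real) \<in> h}" if h: "h \<in> F" for h
  proof -
    obtain a b where "h = {x. a \<bullet> x \<le> b}" using F(3) h by blast
    hence "{x :: real^'n. (x, 1::real) \<in> h} = {x. fst a \<bullet> x \<le> b - snd a}"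
      by (cases a) auto
    thus ?thesis by (simp add: polyhedron_halfspace_le)
  qed
  ultimately show ?thesis using F(1) by (auto intro!: polyhedron_Inter)
qed

lemma interior_NP_nonempty:
  fixes V :: "('n::finite \<Rightarrow>\<^sub>0 nat) set"
  assumes "finite V" "V \<noteq> {}"
  shows "interior (NP V 1) \<noteq> {}"
proof -
  obtain v where v: "v \<in> V" using assms(2) by blast
  define u :: "real ^ 'n" where "u = (\<chi> i. real (lookup v i) + 1)"
  have "box (real_exp v) u \<subseteq> NP V 1"
  proof
    fix x assume "x \<in> box (real_exp v) u"
    hence "real_exp v $ i \<le> x $ i" for i by (auto simp: mem_box_cart intro: less_imp_le)
    thus "x \<in> NP V 1" by (rule NP_up[OF NP_gen[OF assms(1) v]])
  qed
  hence "box (real_exp v) u \<subseteq> interior (NP V 1)" by (rule interior_maximal) (rule open_box)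
  moreover have "(\<chi> i. real (lookup v i) + 1/2) \<in> box (real_exp v) u" by (simp add: mem_box_cart u_def)
  ultimately show ?thesis by blast
qed

text \<open>A projection of the reals onto the rationals, linear over the rationals, obtained by
  extending from the independent set {1}. It turns a real facet equation into a rational
  one.\<close>

lemma ex_rat_functional:
  "\<exists>\<phi> :: real \<Rightarrow> rat. (\<forall>x y. \<phi> (x + y) = \<phi> x + \<phi> y) \<and> (\<forall>q x. \<phi> (of_rat q * x) = q * \<phi> x) \<and> \<phi> 1 = 1"
proof -
  interpret vector_space_pair "\<lambda>(q::rat) (x::real). of_rat q * x" "(*) :: rat \<Rightarrow> rat \<Rightarrow> rat"
    by unfold_locales (simp_all add: algebra_simps of_rat_add of_rat_mult)
  have "vs1.independent {1::real}" using vs1.dependent_single[of 1] by simp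
  from linear_independent_extend[OF this, of "\<lambda>_. 1"]
  obtain g where g: "Vector_Spaces.linear (\<lambda>(q::rat) (x::real). of_rat q * x) (*) g" "g 1 = 1" by auto
  interpret g: Vector_Spaces.linear "\<lambda>(q::rat) (x::real). of_rat q * x" "(*)" g by (rule g(1))
  show ?thesis using g.add g.scale g(2) by (intro exI[of _ g]) simp
qed

lemma NP_support_nonneg:
  fixes V :: "('n::finite \<Rightarrow>\<^sub>0 nat) set" and b :: "real ^ 'n"
  assumes V: "finite V" "V \<noteq> {}" and sup: "NP V 1 \<subseteq> {x. x \<bullet> b \<ge> c}"
  shows "0 \<le> b $ i"
proof (rule ccontr)
  assume "\<not> 0 \<le> b $ i"
  hence neg: "b $ i < 0" by simp
  obtain v where v: "v \<in> V" using V(2) by blast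
  \<comment> \<open>Far enough along the i-th axis to push the value at a generator below
    \<open>c\<close>; the polyhedron contains that whole ray.\<close>
  define t where "t = (\<bar>real_exp v \<bullet> b - c\<bar> + 1) / - (b $ i)"
  have t0: "0 \<le> t" using neg by (simp add: t_def divide_nonneg_neg divide_nonpos_neg)
  have "real_exp v + t *\<^sub>R axis i 1 \<in> NP V 1"
    by (rule NP_up[OF NP_gen[OF V(1) v]]) (use t0 in \<open>simp add: axis_def\<close>)
  hence "(real_exp v + t *\<^sub>R axis i 1) \<bullet> b \<ge> c" using sup by blast
  hence "real_exp v \<bullet> b + t * (b $ i) \<ge> c" by (simp add: inner_add_left inner_axis')
  moreover have "t * (b $ i) = - (\<bar>real_exp v \<bullet> b - c\<bar> + 1)" using neg by (simp add: t_def)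
  ultimately show False by linarith
qed

text \<open>Applying the rational projection to \<open>b\<close> and \<open>c\<close> gives a
  rational equation that still holds on \<open>F\<close>, since generators have integral
  coordinates. The affine hull of a facet is a whole hyperplane, so the two equations are
  proportional, and the normalization at \<open>i0\<close> makes them equal.\<close>

lemma facet_normal_rational:
  fixes V :: "('n::finite \<Rightarrow>\<^sub>0 nat) set" and b :: "real ^ 'n"
  assumes V: "finite V" "V \<noteq> {}" and F: "F facet_of NP V 1" and Feq: "F = NP V 1 \<inter> {x. x \<bullet> b = c}"
    and sup: "NP V 1 \<subseteq> {x. x \<bullet> b \<ge> c}" and i0: "b $ i0 = 1"
  shows "(\<forall>i. b $ i \<in> \<rat>) \<and> c \<in> \<rat>"
proof -
  obtain \<phi> :: "real \<Rightarrow> rat" where \<phi>: "\<And>x y. \<phi> (x + y) = \<phi> x + \<phi> y" "\<And>q x. \<phi> (of_rat q * x) = q * \<phi> x" "\<phi> 1 = 1"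
    using ex_rat_functional by blast
  have \<phi>0: "\<phi> 0 = 0" using \<phi>(1)[of 0 0] by simp
  have \<phi>sum: "\<phi> (sum f S) = (\<Sum>i\<in>S. \<phi> (f i))" for f :: "'n \<Rightarrow> real" and S
    by (induction S rule: infinite_finite_induct) (simp_all add: \<phi>0 \<phi>(1))
  have \<phi>n: "\<phi> (real k * x) = of_nat k * \<phi> x" for k x using \<phi>(2)[of "of_nat k" x] by simp
  define b' :: "real ^ 'n" where "b' = (\<chi> i. of_rat (\<phi> (b $ i)))"
  define c' :: real where "c' = of_rat (\<phi> c)"
  have bn: "0 \<le> b $ i" for i using NP_support_nonneg[OF V sup] .
  have inner: "x \<bullet> y = (\<Sum>i\<in>UNIV. x $ i * y $ i)" for x y :: "real ^ 'n" by (simp add: inner_vec_def)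
  have genphi: "real_exp v \<bullet> b' = of_rat (\<phi> (real_exp v \<bullet> b))" for v
    unfolding inner \<phi>sum real_exp_nth \<phi>n by (simp add: b'_def of_rat_sum of_rat_mult)
  have F': "x \<bullet> b' = c'" if "x \<in> F" for x
  proof -
    have x: "x \<in> NP V 1" "x \<bullet> b = c" using that Feq by auto
    obtain l where l: "\<And>v. v \<in> V \<Longrightarrow> 0 \<le> l v" "sum l V = 1" "\<And>i. (\<Sum>v\<in>V. l v * real (lookup v i)) \<le> x $ i"
      using NP_E[OF x(1)] by blast
    define y :: "real ^ 'n" where "y = x - (\<Sum>v\<in>V. l v *\<^sub>R real_exp v)"
    have y: "0 \<le> y $ i" for i using l(3)[of i] by (simp add: y_def)
    have xy: "x = (\<Sum>v\<in>V. l v *\<^sub>R real_exp v) + y" by (simp add: y_def)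
    have in1: "x \<bullet> z = (\<Sum>v\<in>V. l v * (real_exp v \<bullet> z)) + (\<Sum>i\<in>UNIV. y $ i * z $ i)" for z
      by (subst xy) (simp only: inner_add_left inner_sum_left inner_scaleR_left inner[of y])
    have vc: "real_exp v \<bullet> b \<ge> c" if "v \<in> V" for v using sup NP_gen[OF V(1) that] by blast
    \<comment> \<open>Complementary slackness: nonnegative terms with sum 0 all vanish. The point
      uses only generators on the hyperplane and exceeds them only in directions where the normal is
      0; both properties survive the projection.\<close>
    have "(\<Sum>v\<in>V. l v * (real_exp v \<bullet> b - c)) + (\<Sum>i\<in>UNIV. y $ i * b $ i) = 0"
    proof -
      have "(\<Sum>v\<in>V. l v * (real_exp v \<bullet> b - c)) = (\<Sum>v\<in>V. l v * (real_exp v \<bullet> b)) - c"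
        by (simp add: right_diff_distrib sum_subtractf sum_distrib_right[symmetric] l(2))
      thus ?thesis using in1[of b] x(2) by simp
    qed
    moreover have nn1: "0 \<le> (\<Sum>v\<in>V. l v * (real_exp v \<bullet> b - c))"
      by (intro sum_nonneg mult_nonneg_nonneg) (use l(1) vc in auto)
    moreover have nn2: "0 \<le> (\<Sum>i\<in>UNIV. y $ i * b $ i)"
      by (intro sum_nonneg mult_nonneg_nonneg) (use y bn in auto)
    ultimately have z: "(\<Sum>v\<in>V. l v * (real_exp v \<bullet> b - c)) = 0" "(\<Sum>i\<in>UNIV. y $ i * b $ i) = 0" by linarith+
    have z1: "l v * (real_exp v \<bullet> b - c) = 0" if "v \<in> V" for v
      using z(1) V(1) that l(1) vc by (subst (asm) sum_nonneg_eq_0_iff) auto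
    have z2: "y $ i * b $ i = 0" for i
      using z(2) y bn by (subst (asm) sum_nonneg_eq_0_iff) auto
    have "l v * (real_exp v \<bullet> b') = l v * c'" if "v \<in> V" for v
    proof (cases "l v = 0")
      case False
      hence "real_exp v \<bullet> b = c" using z1[OF that] by simp
      thus ?thesis by (simp add: genphi c'_def)
    qed simp
    hence "(\<Sum>v\<in>V. l v * (real_exp v \<bullet> b')) = (\<Sum>v\<in>V. l v * c')" by (intro sum.cong) auto
    hence s1: "(\<Sum>v\<in>V. l v * (real_exp v \<bullet> b')) = c'" by (simp add: sum_distrib_right[symmetric] l(2))
    have "y $ i * b' $ i = 0" for i
    proof (cases "y $ i = 0")
      case False
      hence "b $ i = 0" using z2[of i] by simp
      thus ?thesis by (simp add: b'_def \<phi>0)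
    qed simp
    hence s2: "(\<Sum>i\<in>UNIV. y $ i * b' $ i) = 0" by (intro sum.neutral ballI)
    show ?thesis unfolding in1[of b'] s1 s2 by simp
  qed
  have b0: "b \<noteq> 0" using i0 by auto
  have H: "{x. b \<bullet> x = c} = affine hull F"
  proof (rule sym, rule affine_dim_equal)
    show "affine hull F \<noteq> {}" using F by (simp add: facet_of_def)
    show "affine hull F \<subseteq> {x. b \<bullet> x = c}"
    proof (rule hull_minimal)
      show "F \<subseteq> {x. b \<bullet> x = c}" using Feq by (auto simp: inner_commute)
    qed (rule affine_hyperplane)
    have "aff_dim F = aff_dim (NP V 1) - 1" using F by (simp add: facet_of_def)
    thus "aff_dim (affine hull F) = aff_dim {x. b \<bullet> x = c}"
      using b0 aff_dim_nonempty_interior[OF interior_NP_nonempty[OF V]] by (simp add: of_nat_diff)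
  qed (simp_all add: affine_hyperplane)
  have H': "affine hull F \<subseteq> {x. b' \<bullet> x = c'}"
  proof (rule hull_minimal)
    show "F \<subseteq> {x. b' \<bullet> x = c'}" using F' by (auto simp: inner_commute)
  qed (rule affine_hyperplane)
  obtain x0 where x0: "x0 \<in> F" using F by (auto simp: facet_of_def)
  have x0b: "b \<bullet> x0 = c" using x0 Feq by (auto simp: inner_commute)
  have x0b': "b' \<bullet> x0 = c'" using F'[OF x0] by (simp add: inner_commute)
  have bb: "b' $ i = b $ i" for i
  proof -
    \<comment> \<open>A direction inside the hyperplane; since \<open>b'\<close> must annihilate it
      too, the i-th coordinates of the two normals agree.\<close>
    define u :: "real ^ 'n" where "u = axis i 1 - (b $ i) *\<^sub>R axis i0 1"
    have ub: "z \<bullet> u = z $ i - b $ i * z $ i0" for z :: "real ^ 'n"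
      by (simp add: u_def inner_diff_right inner_axis)
    have "b \<bullet> u = 0" using ub[of b] i0 by simp
    hence "x0 + u \<in> {x. b \<bullet> x = c}" using x0b by (simp add: inner_add_right)
    hence "b' \<bullet> (x0 + u) = c'" using H H' by blast
    hence "b' \<bullet> u = 0" using x0b' by (simp add: inner_add_right)
    thus ?thesis using ub[of b'] by (simp add: b'_def i0 \<phi>(3))
  qed
  hence "b' = b" by (simp add: vec_eq_iff)
  hence "c = c'" using x0b x0b' by simp
  moreover have "b $ i \<in> \<rat>" for i by (subst bb[symmetric]) (simp add: b'_def)
  moreover have "c' \<in> \<rat>" by (simp add: c'_def)
  ultimately show ?thesis by (simp only:) simp
qed

text \<open>Polyhedron theory delivers real normals with the opposite sign. The factor
  \<open>s\<close> is chosen so that one coordinate of the new normal is 1, which makes all the data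
  rational.\<close>

lemma facet_ineq_scaled:
  fixes V :: "('n::finite \<Rightarrow>\<^sub>0 nat) set"
  assumes V: "finite V" "V \<noteq> {}" and F: "F facet_of NP V 1" and Feq: "F = NP V 1 \<inter> {x. a \<bullet> x = \<beta>}"
    and sup: "NP V 1 \<subseteq> {x. a \<bullet> x \<le> \<beta>}" and a: "a \<noteq> 0"
  shows "\<exists>s>0. facet_ineq (NP V 1) F (- s *\<^sub>R a) (- s * \<beta>)"
proof -
  have "0 \<le> (- a) $ i" for i
    by (rule NP_support_nonneg[OF V, of "- \<beta>" "- a"]) (use sup in \<open>auto simp: inner_commute\<close>)
  hence nn: "a $ i \<le> 0" for i by simp
  obtain i0 where "a $ i0 \<noteq> 0" using a by (metis vec_eq_iff zero_index)
  hence i0: "a $ i0 < 0" using nn[of i0] by linarith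
  define s where "s = - 1 / a $ i0"
  have s: "s > 0" using i0 by (simp add: s_def)
  have scale: "x \<bullet> (- s *\<^sub>R a) = - s * (a \<bullet> x)" for x by (simp add: inner_commute)
  have Feq': "F = NP V 1 \<inter> {x. x \<bullet> (- s *\<^sub>R a) = - s * \<beta>}"
    unfolding Feq scale using s by auto
  have sup': "NP V 1 \<subseteq> {x. x \<bullet> (- s *\<^sub>R a) \<ge> - s * \<beta>}"
    unfolding scale using sup s by auto
  have r: "(\<forall>i. (- s *\<^sub>R a) $ i \<in> \<rat>) \<and> - s * \<beta> \<in> \<rat>"
    by (rule facet_normal_rational[OF V F Feq' sup', of i0]) (use i0 in \<open>simp add: s_def\<close>)
  have "- s *\<^sub>R a \<noteq> 0" using s a by simp
  hence "facet_ineq (NP V 1) F (- s *\<^sub>R a) (- s * \<beta>)"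
    unfolding facet_ineq_def by (intro conjI F r[THEN conjunct1] r[THEN conjunct2] sup' trans[OF Feq' Int_commute])
  thus ?thesis using s by blast
qed

text \<open>In an irredundant description by half-spaces each half-space defines a facet. The
  polyhedron has interior points, so its affine hull imposes no further condition.\<close>

lemma NP_eq_facet_ineqs:
  fixes V :: "('n::finite \<Rightarrow>\<^sub>0 nat) set"
  assumes V: "finite V" "V \<noteq> {}"
  shows "\<exists>H. finite H \<and> (\<forall>(b, c)\<in>H. \<exists>F. facet_ineq (NP V 1) F b c) \<and> NP V 1 = {x. \<forall>(b, c)\<in>H. c \<le> x \<bullet> b}"
proof -
  have full: "affine hull (NP V 1) = UNIV" by (rule affine_hull_nonempty_interior[OF interior_NP_nonempty[OF V]])
  from polyhedron_NP[OF V(1), unfolded polyhedron_Int_affine_minimal]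
  obtain F where "finite F \<and> NP V 1 = affine hull (NP V 1) \<inter> \<Inter>F \<and>
     (\<forall>h\<in>F. \<exists>a b. a \<noteq> 0 \<and> h = {x. a \<bullet> x \<le> b}) \<and> (\<forall>F'. F' \<subset> F \<longrightarrow> NP V 1 \<subset> affine hull (NP V 1) \<inter> \<Inter>F')" ..
  note F' = this
  note F = F'[THEN conjunct1] F'[THEN conjunct2, THEN conjunct1] F'[THEN conjunct2, THEN conjunct2, THEN conjunct1]
     F'[THEN conjunct2, THEN conjunct2, THEN conjunct2]
  have NPeq: "NP V 1 = \<Inter>F" by (rule trans[OF F(2)]) (simp only: full Int_UNIV_left)
  have "\<forall>h\<in>F. \<exists>p. fst p \<noteq> 0 \<and> h = {x. fst p \<bullet> x \<le> snd p}"
  proof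
    fix h assume "h \<in> F"
    then obtain a b where "a \<noteq> 0 \<and> h = {x. a \<bullet> x \<le> b}" using F(3) by blast
    thus "\<exists>p. fst p \<noteq> 0 \<and> h = {x. fst p \<bullet> x \<le> snd p}" by (intro exI[of _ "(a, b)"]) simp
  qed
  from bchoice[OF this] obtain p where p: "\<forall>h\<in>F. fst (p h) \<noteq> 0 \<and> h = {x. fst (p h) \<bullet> x \<le> snd (p h)}" ..
  define a where "a h = fst (p h)" for h
  define \<beta> where "\<beta> h = snd (p h)" for h
  have ab: "a h \<noteq> 0 \<and> h = {x. a h \<bullet> x \<le> \<beta> h}" if "h \<in> F" for h
    unfolding a_def \<beta>_def by (rule p[rule_format, OF that])
  have facet: "C facet_of NP V 1 \<longleftrightarrow> (\<exists>h. h \<in> F \<and> C = NP V 1 \<inter> {x. a h \<bullet> x = \<beta> h})" for C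
    using facet_of_polyhedron_explicit[OF F(1,2) ab F(4)[rule_format]] .
  have "\<exists>s>0. facet_ineq (NP V 1) (NP V 1 \<inter> {x. a h \<bullet> x = \<beta> h}) (- s *\<^sub>R a h) (- s * \<beta> h)" if h: "h \<in> F" for h
  proof (rule facet_ineq_scaled[OF V])
    show "NP V 1 \<inter> {x. a h \<bullet> x = \<beta> h} facet_of NP V 1" unfolding facet using h by blast
    have "NP V 1 \<subseteq> h" unfolding NPeq using h by blast
    thus "NP V 1 \<subseteq> {x. a h \<bullet> x \<le> \<beta> h}" using conjunct2[OF ab[OF h]] by (rule subst[rotated])
    show "NP V 1 \<inter> {x. a h \<bullet> x = \<beta> h} = NP V 1 \<inter> {x. a h \<bullet> x = \<beta> h}" by (rule refl)
    show "a h \<noteq> 0" using ab[OF h] by (rule conjunct1)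
  qed
  hence "\<forall>h\<in>F. \<exists>s>0. facet_ineq (NP V 1) (NP V 1 \<inter> {x. a h \<bullet> x = \<beta> h}) (- s *\<^sub>R a h) (- s * \<beta> h)"
    by (rule ballI)
  from bchoice[OF this] obtain s where s0: "\<forall>h\<in>F. s h > 0 \<and>
    facet_ineq (NP V 1) (NP V 1 \<inter> {x. a h \<bullet> x = \<beta> h}) (- s h *\<^sub>R a h) (- s h * \<beta> h)" ..
  note s = s0[rule_format, THEN conjunct1] s0[rule_format, THEN conjunct2]
  define H where "H = (\<lambda>h. (- s h *\<^sub>R a h, - s h * \<beta> h)) ` F"
  have "x \<in> h \<longleftrightarrow> - s h * \<beta> h \<le> x \<bullet> (- s h *\<^sub>R a h)" if h: "h \<in> F" for x h
  proof -
    have "x \<in> h \<longleftrightarrow> a h \<bullet> x \<le> \<beta> h" by (subst conjunct2[OF ab[OF h]]) simp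
    thus ?thesis using s(1)[OF h] by (simp add: inner_commute)
  qed
  hence "NP V 1 = {x. \<forall>(b, c)\<in>H. c \<le> x \<bullet> b}" unfolding NPeq H_def by auto
  moreover have "\<forall>(b, c)\<in>H. \<exists>F. facet_ineq (NP V 1) F b c" using s(2) unfolding H_def by auto
  moreover have "finite H" using F(1) by (simp add: H_def)
  ultimately show ?thesis by blast
qed

text \<open>On the facet the nonnegative terms \<open>x $ i * b $ i\<close> add up to
  \<open>c\<close>, so a positive normal caps every coordinate.\<close>

lemma facet_ineq_pos_bounded:
  fixes V :: "('n::finite \<Rightarrow>\<^sub>0 nat) set" and b :: "real ^ 'n"
  assumes "facet_ineq (NP V 1) F b c" "\<And>i. 0 < b $ i"
  shows "bounded F"
proof (rule bounded_subset[OF bounded_cbox])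
  show "F \<subseteq> cbox 0 (\<chi> i. c / b $ i)"
  proof
    fix x assume "x \<in> F"
    hence x: "x \<in> NP V 1" "x \<bullet> b = c" using assms(1) by (auto simp: facet_ineq_def)
    have "x $ i \<le> c / b $ i" for i
    proof -
      have "x $ i * b $ i \<le> (\<Sum>j\<in>UNIV. x $ j * b $ j)"
        using NP_nonneg[OF x(1)] assms(2) by (intro member_le_sum) (simp_all add: less_imp_le)
      also have "\<dots> = c" using x(2) by (simp add: inner_vec_def)
      finally show ?thesis using assms(2)[of i] by (simp add: pos_le_divide_eq)
    qed
    thus "x \<in> cbox 0 (\<chi> i. c / b $ i)" using NP_nonneg[OF x(1)] by (simp add: mem_box_cart)
  qed
qed

text \<open>If a normal coordinate vanished, the facet would contain a ray along that axis. Together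
  with \<open>facet_ineq_pos_bounded\<close> this makes boundedness of a facet a condition on its
  normal.\<close>

lemma facet_ineq_bounded_pos:
  fixes V :: "('n::finite \<Rightarrow>\<^sub>0 nat) set" and b :: "real ^ 'n"
  assumes V: "finite V" "V \<noteq> {}" and F: "facet_ineq (NP V 1) F b c" and bd: "bounded F"
  shows "0 < b $ i"
proof (rule ccontr)
  have sup: "NP V 1 \<subseteq> {x. x \<bullet> b \<ge> c}" using F by (simp add: facet_ineq_def)
  assume "\<not> 0 < b $ i"
  hence b0: "b $ i = 0" using NP_support_nonneg[OF V sup, of i] by linarith
  obtain x where x: "x \<in> F" using F by (auto simp: facet_ineq_def facet_of_def)
  obtain B where B: "\<And>y. y \<in> F \<Longrightarrow> norm y \<le> B" using bd unfolding bounded_iff by blast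
  have xP: "x \<in> NP V 1" "x \<bullet> b = c" using x F by (auto simp: facet_ineq_def)
  define y where "y = x + (\<bar>B\<bar> + 1) *\<^sub>R axis i 1"
  have "y \<in> NP V 1" by (rule NP_up[OF xP(1)]) (simp add: y_def axis_def)
  moreover have "y \<bullet> b = c" using xP(2) b0 by (simp add: y_def inner_add_left inner_axis')
  ultimately have "y \<in> F" using F by (auto simp: facet_ineq_def)
  hence "\<bar>y $ i\<bar> \<le> B" using B component_le_norm_cart[of y i] by (meson order_trans)
  moreover have "y $ i = x $ i + (\<bar>B\<bar> + 1)" by (simp add: y_def axis_def)
  ultimately show False using NP_nonneg[OF xP(1), of i] by linarith
qed

subsection \<open>The region between the saturated and the original Newton polyhedron\<close>

text \<open>The real counterpart of \<open>sat_pexps\<close>, on the scale of a single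
  power.\<close>

definition NPsat :: "('n::finite \<Rightarrow>\<^sub>0 nat) set \<Rightarrow> (real ^ 'n) set" where
  "NPsat V = (\<Inter>i. NP (zcoord i ` V) 1)"

lemma NP_zcoord_iff:
  fixes V :: "('n::finite \<Rightarrow>\<^sub>0 nat) set" and x :: "real ^ 'n"
  assumes V: "finite V"
  shows "x \<in> NP (zcoord i ` V) 1 \<longleftrightarrow> 0 \<le> x $ i \<and> (\<exists>t. x + t *\<^sub>R axis i 1 \<in> NP V 1)"
proof
  let ?W = "zcoord i ` V"
  assume x: "x \<in> NP ?W 1"
  obtain l where l: "\<And>v. v \<in> ?W \<Longrightarrow> 0 \<le> l v" "sum l ?W = 1" "\<And>j. (\<Sum>v\<in>?W. l v * real (lookup v j)) \<le> x $ j"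
    using NP_E[OF x] by blast
  \<comment> \<open>Deleting a coordinate may identify generators, so the weights are transported
    back along a chosen section.\<close>
  define s where "s = inv_into V (zcoord i)"
  have s: "s w \<in> V" "zcoord i (s w) = w" if "w \<in> ?W" for w
    using that by (simp_all add: s_def inv_into_into f_inv_into_f)
  define y where "y = (\<Sum>w\<in>?W. l w *\<^sub>R real_exp (s w))"
  have "(\<Sum>w\<in>?W. l w *\<^sub>R real_exp (s w)) \<in> NP V (\<Sum>w\<in>?W. l w * 1)"
  proof (rule NP_sum)
    fix w assume w: "w \<in> ?W"
    show "l w *\<^sub>R real_exp (s w) \<in> NP V (l w * 1)"
      by (rule NP_scale[OF NP_gen[OF V s(1)[OF w]] l(1)[OF w]])
  qed (use V in simp)
  hence y: "y \<in> NP V 1" using l(2) by (simp add: y_def)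
  have "y $ j \<le> (x + y $ i *\<^sub>R axis i 1) $ j" for j
  proof (cases "j = i")
    case True
    then show ?thesis using NP_nonneg[OF x] by (simp add: axis_def)
  next
    case False
    have "y $ j = (\<Sum>w\<in>?W. l w * real (lookup w j))"
      unfolding y_def sum_component vector_scaleR_component real_exp_nth real_scaleR_def
    proof (rule sum.cong[OF refl])
      fix w assume "w \<in> ?W"
      hence "lookup (zcoord i (s w)) j = lookup w j" using s by simp
      thus "l w * real (lookup (s w) j) = l w * real (lookup w j)" using False by (simp add: lookup_zcoord)
    qed
    thus ?thesis using l(3)[of j] False by (simp add: axis_def)
  qed
  hence "x + y $ i *\<^sub>R axis i 1 \<in> NP V 1" by (rule NP_up[OF y])
  thus "0 \<le> x $ i \<and> (\<exists>t. x + t *\<^sub>R axis i 1 \<in> NP V 1)" 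
    by (intro conjI NP_nonneg[OF x] exI[of _ "y $ i"])
next
  let ?W = "zcoord i ` V"
  assume "0 \<le> x $ i \<and> (\<exists>t. x + t *\<^sub>R axis i 1 \<in> NP V 1)"
  then obtain t where x: "0 \<le> x $ i" "x + t *\<^sub>R axis i 1 \<in> NP V 1" by blast
  obtain l where l: "\<And>v. v \<in> V \<Longrightarrow> 0 \<le> l v" "sum l V = 1"
     "\<And>j. (\<Sum>v\<in>V. l v * real (lookup v j)) \<le> (x + t *\<^sub>R axis i 1) $ j"
    using NP_E[OF x(2)] by blast
  have "(\<Sum>v\<in>V. l v *\<^sub>R real_exp (zcoord i v)) \<in> NP ?W (\<Sum>v\<in>V. l v * 1)"
  proof (rule NP_sum[OF V])
    fix v assume v: "v \<in> V"
    show "l v *\<^sub>R real_exp (zcoord i v) \<in> NP ?W (l v * 1)"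
      by (rule NP_scale[OF NP_gen[OF finite_imageI[OF V] imageI[OF v]] l(1)[OF v]])
  qed
  hence "(\<Sum>v\<in>V. l v *\<^sub>R real_exp (zcoord i v)) \<in> NP ?W 1" using l(2) by simp
  thus "x \<in> NP ?W 1"
  proof (rule NP_up)
    fix j
    show "(\<Sum>v\<in>V. l v *\<^sub>R real_exp (zcoord i v)) $ j \<le> x $ j"
      using l(3)[of j] x(1) by (cases "j = i") (simp_all add: lookup_zcoord axis_def)
  qed
qed

text \<open>Moving along the i-th axis repairs precisely the facet inequalities with positive i-th
  normal coordinate. The normal of an unbounded facet has a zero coordinate, and its inequality
  survives saturation along that axis; those of bounded facets can be repaired along every
  axis.\<close>

lemma NPsat_eq:
  fixes V :: "('n::finite \<Rightarrow>\<^sub>0 nat) set"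
  assumes V: "finite V" "V \<noteq> {}"
  shows "NPsat V = {x \<in> orthant. \<forall>F b c. facet_ineq (NP V 1) F b c \<and> \<not> bounded F \<longrightarrow> c \<le> x \<bullet> b}"
proof (intro equalityI subsetI)
  fix x assume "x \<in> NPsat V"
  hence x: "0 \<le> x $ i" "\<exists>t. x + t *\<^sub>R axis i 1 \<in> NP V 1" for i
    unfolding NPsat_def using NP_zcoord_iff[OF V(1)] by blast+
  have fc: "c \<le> x \<bullet> b" if F: "facet_ineq (NP V 1) F b c" "\<not> bounded F" for F b c
  proof -
    have sup: "NP V 1 \<subseteq> {x. x \<bullet> b \<ge> c}" using F by (simp add: facet_ineq_def)
    obtain i where "\<not> 0 < b $ i"
    proof (rule ccontr)
      assume *: "\<not> thesis"
      have "bounded F" by (rule facet_ineq_pos_bounded[OF F(1)]) (use * that in blast)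
      thus False using F(2) by simp
    qed
    hence b0: "b $ i = 0" using NP_support_nonneg[OF V sup, of i] by linarith
    obtain t where "x + t *\<^sub>R axis i 1 \<in> NP V 1" using x(2) by blast
    hence "c \<le> (x + t *\<^sub>R axis i 1) \<bullet> b" using sup by blast
    thus ?thesis using b0 by (simp add: inner_add_left inner_axis')
  qed
  have "x \<in> orthant" using x(1) by (simp add: orthant_def)
  thus "x \<in> {x \<in> orthant. \<forall>F b c. facet_ineq (NP V 1) F b c \<and> \<not> bounded F \<longrightarrow> c \<le> x \<bullet> b}"
    by (intro CollectI conjI allI impI, assumption, elim conjE) (rule fc)
next
  fix x assume "x \<in> {x \<in> orthant. \<forall>F b c. facet_ineq (NP V 1) F b c \<and> \<not> bounded F \<longrightarrow> c \<le> x \<bullet> b}"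
  hence x1: "x \<in> orthant" "\<forall>F b c. facet_ineq (NP V 1) F b c \<and> \<not> bounded F \<longrightarrow> c \<le> x \<bullet> b" by simp_all
  have x0: "0 \<le> x $ i" for i using x1(1) by (simp add: orthant_def)
  have x: "c \<le> x \<bullet> b" if "facet_ineq (NP V 1) F b c" "\<not> bounded F" for F b c
    by (rule x1(2)[rule_format]) (use that in simp)
  obtain H where H: "finite H" "\<forall>(b, c)\<in>H. \<exists>F. facet_ineq (NP V 1) F b c" "NP V 1 = {x. \<forall>(b, c)\<in>H. c \<le> x \<bullet> b}"
    using NP_eq_facet_ineqs[OF V] by blast
  have "\<exists>t. x + t *\<^sub>R axis i 1 \<in> NP V 1" for i
  proof -
    \<comment> \<open>The distance along the i-th axis that suffices for the inequality
      \<open>p\<close>; the sum over \<open>H\<close> dominates each of these distances.\<close>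
    define f where "f p = (if 0 < fst p $ i then \<bar>snd p - x \<bullet> fst p\<bar> / fst p $ i else 0)" for p :: "(real ^ 'n) \<times> real"
    have f0: "0 \<le> f p" for p by (simp add: f_def)
    define t where "t = sum f H"
    have "c \<le> (x + t *\<^sub>R axis i 1) \<bullet> b" if bc: "(b, c) \<in> H" for b c
    proof -
      have "\<exists>F. facet_ineq (NP V 1) F b c" using bspec[OF H(2) bc] by simp
      then obtain F where F: "facet_ineq (NP V 1) F b c" ..
      have e: "(x + t *\<^sub>R axis i 1) \<bullet> b = x \<bullet> b + t * b $ i" by (simp add: inner_add_left inner_axis')
      show ?thesis
      proof (cases "0 < b $ i")
        case True
        have "f (b, c) \<le> t" unfolding t_def using H(1) bc f0 by (intro member_le_sum) auto
        hence "f (b, c) * b $ i \<le> t * b $ i" using True by (intro mult_right_mono) auto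
        hence "\<bar>c - x \<bullet> b\<bar> \<le> t * b $ i" using True by (simp add: f_def)
        thus ?thesis unfolding e by linarith
      next
        case False
        have sup: "NP V 1 \<subseteq> {x. x \<bullet> b \<ge> c}" using F by (simp add: facet_ineq_def)
        have b0: "b $ i = 0" using False NP_support_nonneg[OF V sup, of i] by linarith
        have "\<not> bounded F" using facet_ineq_bounded_pos[OF V F, of i] b0 by auto
        thus ?thesis unfolding e b0 using x[OF F] by simp
      qed
    qed
    hence "x + t *\<^sub>R axis i 1 \<in> NP V 1" unfolding H(3) by blast
    thus ?thesis by blast
  qed
  thus "x \<in> NPsat V" unfolding NPsat_def using x0 NP_zcoord_iff[OF V(1)] by blast
qed

lemma closed_NPsat: "finite V \<Longrightarrow> closed (NPsat V)"
  unfolding NPsat_def by (intro closed_INT ballI closed_NP) simp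

lemma convex_NPsat: "convex (NPsat V)"
  unfolding NPsat_def by (intro convex_INT convex_NP)

lemma NPsat_up:
  fixes x y :: "real ^ 'n::finite"
  assumes "x \<in> NPsat V" "\<And>i. x $ i \<le> y $ i"
  shows "y \<in> NPsat V"
  using assms unfolding NPsat_def by (auto intro: NP_up)

text \<open>A point outside the polyhedron but inside the saturated one violates a bounded facet
  inequality. The non-strict inequalities in the definition of the region add only points of bounded
  facets, which lie in the frontier of a convex set and have measure 0.\<close>

lemma emeasure_out_polyhedron:
  fixes V :: "('n::finite \<Rightarrow>\<^sub>0 nat) set"
  assumes V: "finite V" "V \<noteq> {}"
  shows "emeasure lebesgue (orthant
       \<inter> \<Inter> {{x. x \<bullet> b \<ge> c} | F b c. facet_ineq (NP V 1) F b c \<and> \<not> bounded F}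
       \<inter> \<Union> {{x. x \<bullet> b \<le> c} | F b c. facet_ineq (NP V 1) F b c \<and> bounded F})
     = emeasure lebesgue (NPsat V - NP V 1)" (is "emeasure _ ?O = _")
proof -
  let ?P = "NP V 1"
  have "NPsat V = orthant \<inter> \<Inter> {{x. x \<bullet> b \<ge> c} | F b c. facet_ineq ?P F b c \<and> \<not> bounded F}"
    unfolding NPsat_eq[OF V] by auto
  hence O: "?O = NPsat V \<inter> \<Union> {{x. x \<bullet> b \<le> c} | F b c. facet_ineq ?P F b c \<and> bounded F}" by simp
  obtain H where H: "\<forall>(b, c)\<in>H. \<exists>F. facet_ineq (NP V 1) F b c" "NP V 1 = {x. \<forall>(b, c)\<in>H. c \<le> x \<bullet> b}"
    using NP_eq_facet_ineqs[OF V] by blast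
  have sub: "NPsat V - ?P \<subseteq> ?O"
  proof
    fix x assume x: "x \<in> NPsat V - ?P"
    then obtain b c where bc: "(b, c) \<in> H" "\<not> c \<le> x \<bullet> b" unfolding H(2) by blast
    have "\<exists>F. facet_ineq ?P F b c" using bspec[OF H(1) bc(1)] by simp
    then obtain F where F: "facet_ineq ?P F b c" ..
    have "bounded F" using x bc(2) F unfolding NPsat_eq[OF V] by blast
    moreover have "x \<bullet> b \<le> c" using bc(2) by simp
    ultimately show "x \<in> ?O" unfolding O using x F by blast
  qed
  have fr: "?O \<inter> ?P \<subseteq> frontier ?P"
  proof
    fix x assume x: "x \<in> ?O \<inter> ?P"
    then obtain F b c where F: "facet_ineq ?P F b c" "x \<bullet> b \<le> c" unfolding O by blast
    have xF: "x \<in> F" using F x unfolding facet_ineq_def by force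
    have "F face_of ?P" "F \<noteq> ?P" using F(1) facet_of_irrefl facet_of_imp_face_of unfolding facet_ineq_def by blast+
    hence "F \<inter> interior ?P = {}" by (rule face_of_disjoint_interior)
    hence "x \<notin> interior ?P" using xF by blast
    thus "x \<in> frontier ?P" unfolding frontier_def using x closure_subset by blast
  qed
  have null: "?O \<inter> ?P \<in> null_sets lebesgue"
    unfolding negligible_iff_null_sets[symmetric]
    by (rule negligible_subset[OF negligible_convex_frontier[OF convex_NP] fr])
  have sub2: "?O \<subseteq> NPsat V" unfolding O by (rule Int_lower1)
  have gen: "A = (N - P) \<union> (A \<inter> P)" if "N - P \<subseteq> A" "A \<subseteq> N" for A N P :: "(real ^ 'n) set"
    using that by blast
  have "emeasure lebesgue ?O = emeasure lebesgue ((NPsat V - ?P) \<union> (?O \<inter> ?P))"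
    by (rule arg_cong[OF gen[OF sub sub2]])
  also have "\<dots> = emeasure lebesgue (NPsat V - ?P)"
  proof (rule emeasure_Un_null_set[OF _ null])
    have "NPsat V - ?P \<in> sets lborel"
      using borel_closed[OF closed_NPsat[OF V(1)]] borel_closed[OF closed_NP[OF V(1)]] by simp
    thus "NPsat V - ?P \<in> sets lebesgue" by (rule sets_completionI_sets)
  qed
  finally show ?thesis .
qed

subsection \<open>Counting lattice points\<close>

text \<open>Open cubes at distinct scaled lattice points are disjoint and serve to fill a region;
  closed cubes serve to cover one, where subadditivity is enough.\<close>

lemma emeasure_cubes:
  fixes D :: "('n::finite \<Rightarrow>\<^sub>0 nat) set"
  assumes "finite D" "n > 0"
  defines "Q v \<equiv> box ((1 / real n) *\<^sub>R real_exp v) ((1 / real n) *\<^sub>R (real_exp v + (\<chi> i. 1)))"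
  defines "CQ v \<equiv> cbox ((1 / real n) *\<^sub>R real_exp v) ((1 / real n) *\<^sub>R (real_exp v + (\<chi> i. 1)))"
  shows "emeasure lborel (\<Union>v\<in>D. Q v) = ennreal (card D / real n ^ CARD('n))"
    and "emeasure lborel (\<Union>v\<in>D. CQ v) \<le> ennreal (card D / real n ^ CARD('n))"
proof -
  have le: "((1 / real n) *\<^sub>R real_exp v) \<bullet> b \<le> ((1 / real n) *\<^sub>R (real_exp v + (\<chi> i. 1))) \<bullet> b"
    and diff: "((1 / real n) *\<^sub>R (real_exp v + (\<chi> i. 1)) - (1 / real n) *\<^sub>R real_exp v) \<bullet> b = 1 / real n"
    if "b \<in> Basis" for b and v :: "'n \<Rightarrow>\<^sub>0 nat"
    using that assms(2) by (auto simp: Basis_vec_def inner_axis algebra_simps divide_right_mono)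
  have vol: "(\<Prod>b\<in>(Basis :: (real ^ 'n) set). ((1 / real n) *\<^sub>R (real_exp v + (\<chi> i. 1)) - (1 / real n) *\<^sub>R real_exp v) \<bullet> b) = 1 / real n ^ CARD('n)" for v
    by (simp add: diff power_one_over cong: prod.cong)
  have Q: "emeasure lborel (Q v) = ennreal (1 / real n ^ CARD('n))" for v
    unfolding Q_def by (subst emeasure_lborel_box[OF le]) (simp_all only: vol)
  have CQ: "emeasure lborel (CQ v) = ennreal (1 / real n ^ CARD('n))" for v
    unfolding CQ_def by (subst emeasure_lborel_cbox[OF le]) (simp_all only: vol)
  have c: "(\<Sum>v\<in>D. ennreal (1 / real n ^ CARD('n))) = ennreal (card D / real n ^ CARD('n))"
    by (simp add: ennreal_of_nat_eq_real_of_nat ennreal_mult[symmetric])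
  have disj: "disjoint_family_on Q D"
  proof (unfold disjoint_family_on_def, intro ballI impI)
    fix u v :: "'n \<Rightarrow>\<^sub>0 nat" assume "u \<noteq> v"
    then obtain i where i: "lookup u i \<noteq> lookup v i" by (meson poly_mapping_eqI)
    show "Q u \<inter> Q v = {}"
    proof (rule ccontr)
      assume "Q u \<inter> Q v \<noteq> {}"
      then obtain x where x: "x \<in> Q u" "x \<in> Q v" by blast
      have "real (lookup u i) < real n * x $ i \<and> real n * x $ i < real (lookup u i) + 1"
        "real (lookup v i) < real n * x $ i \<and> real n * x $ i < real (lookup v i) + 1"
        using x assms(2) unfolding Q_def mem_box_cart
        by (simp_all add: pos_divide_less_eq pos_less_divide_eq mult.commute)
      thus False using i by linarith
    qed
  qed
  have "(\<Sum>v\<in>D. emeasure lborel (Q v)) = emeasure lborel (\<Union>v\<in>D. Q v)"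
    by (rule sum_emeasure[OF _ disj assms(1)]) (auto simp: Q_def)
  thus "emeasure lborel (\<Union>v\<in>D. Q v) = ennreal (card D / real n ^ CARD('n))"
    unfolding Q c by simp
  have "emeasure lborel (\<Union>v\<in>D. CQ v) \<le> (\<Sum>v\<in>D. emeasure lborel (CQ v))"
    by (rule emeasure_subadditive_finite[OF assms(1)]) (auto simp: CQ_def)
  thus "emeasure lborel (\<Union>v\<in>D. CQ v) \<le> ennreal (card D / real n ^ CARD('n))"
    unfolding CQ c .
qed

text \<open>The entries of \<open>w\<close> collect the rounding error \<open>card V * K\<close> of
  \<open>NP_imp_pexps\<close> and the side 1 of a lattice cube, divided by n. The cubes at the
  counted points cover the region shrunk by \<open>w\<close> on the saturated side and fit into the
  region enlarged by \<open>w\<close> on the side of the polyhedron.\<close>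

lemma card_sat_diff_bounds:
  fixes V :: "('n::finite \<Rightarrow>\<^sub>0 nat) set"
  assumes V: "finite V" "V \<noteq> {}" and K: "\<And>v i. v \<in> V \<Longrightarrow> lookup v i \<le> K" and n: "n > 0"
  defines "w \<equiv> (\<chi> i. (real (card V * K) + 1) / real n) :: real ^ 'n"
  shows "emeasure lborel {x. x \<notin> NP V 1 \<and> x - w \<in> NPsat V} \<le> ennreal (card (sat (pexps V n) - pexps V n) / real n ^ CARD('n))"
    and "ennreal (card (sat (pexps V n) - pexps V n) / real n ^ CARD('n))
      \<le> emeasure lborel {x \<in> NPsat V. x - w \<notin> NP V 1 \<and> (\<forall>i. x $ i \<le> real K + 1)}"
proof -
  define D where "D = sat (pexps V n) - pexps V n"
  define kap where "kap = card V * K"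
  have w: "w $ i = (real kap + 1) / real n" for i by (simp add: w_def kap_def)
  have finD: "finite D" unfolding D_def by (rule finite_sat_diff[OF K])
  have Kz: "lookup v j \<le> K" if "v \<in> zcoord i ` V" for v i j
    using that K by (auto simp: lookup_zcoord)
  have kz: "card (zcoord i ` V) * K \<le> kap" for i
    unfolding kap_def by (intro mult_le_mono card_image_le V) simp
  have inP: "(1 / real n) *\<^sub>R y \<in> NPsat V \<longleftrightarrow> (\<forall>i. y \<in> NP (zcoord i ` V) (real n))" for y
    unfolding NPsat_def using NP_divide_iff[OF n] by blast
  define Q where "Q v = box ((1 / real n) *\<^sub>R real_exp v) ((1 / real n) *\<^sub>R (real_exp v + (\<chi> i. 1)))" for v :: "'n \<Rightarrow>\<^sub>0 nat"
  define CQ where "CQ v = cbox ((1 / real n) *\<^sub>R real_exp v) ((1 / real n) *\<^sub>R (real_exp v + (\<chi> i. 1)))" for v :: "'n \<Rightarrow>\<^sub>0 nat"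
  show "emeasure lborel {x. x \<notin> NP V 1 \<and> x - w \<in> NPsat V} \<le> ennreal (card D / real n ^ CARD('n))"
  proof -
    have "{x. x \<notin> NP V 1 \<and> x - w \<in> NPsat V} \<subseteq> (\<Union>v\<in>D. CQ v)"
    proof
      fix x assume "x \<in> {x. x \<notin> NP V 1 \<and> x - w \<in> NPsat V}"
      hence x: "x \<notin> NP V 1" "x - w \<in> NPsat V" by auto
      have xw: "0 \<le> (x - w) $ i" for i using x(2) NP_nonneg unfolding NPsat_def by blast
      have x0: "0 \<le> x $ i" for i
      proof -
        have "0 \<le> w $ i" by (simp add: w)
        thus ?thesis using xw[of i] by simp
      qed
      \<comment> \<open>The corner of the lattice cube that contains the scaled point.\<close>
      obtain v where v0: "\<forall>i\<in>UNIV. lookup v i = nat \<lfloor>real n * x $ i\<rfloor>"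
      proof -
        let ?c = "\<Sum>i\<in>UNIV. Poly_Mapping.single i (nat \<lfloor>real n * x $ i\<rfloor>)"
        have "lookup ?c j = (\<Sum>i\<in>UNIV. if j = i then nat \<lfloor>real n * x $ i\<rfloor> else 0)" for j
          unfolding lookup_sum by (rule sum.cong) (auto simp: lookup_single when_def)
        thus thesis using that[of ?c] by simp
      qed
      have v: "real (lookup v i) \<le> real n * x $ i" "real n * x $ i \<le> real (lookup v i) + 1" for i
        using v0 x0[of i] by (simp_all add: mult_nonneg_nonneg)
      have "v \<notin> pexps V n"
      proof
        assume "v \<in> pexps V n"
        hence "(1 / real n) *\<^sub>R real_exp v \<in> NP V 1" using pexps_imp_NP[OF V(1)] NP_divide_iff[OF n] by blast
        hence "x \<in> NP V 1"
          by (rule NP_up) (use v n in \<open>simp add: pos_divide_le_eq mult.commute\<close>)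
        thus False using x(1) by simp
      qed
      moreover have "v \<in> pexps (zcoord i ` V) n" for i
      proof (rule NP_imp_pexps[OF _ _ Kz kz])
        show "real n *\<^sub>R (x - w) \<in> NP (zcoord i ` V) (real n)"
          using x(2) NP_scale[of "x - w" _ 1 "real n"] unfolding NPsat_def by simp
        fix j
        have "real n * w $ j = real kap + 1" using n by (simp add: w)
        thus "(real n *\<^sub>R (x - w)) $ j \<le> real (lookup v j) - real kap"
          using v(2)[of j] by (simp add: right_diff_distrib)
      qed (use V in auto)
      ultimately have "v \<in> D" unfolding D_def sat_pexps by blast
      moreover have "x \<in> CQ v" unfolding CQ_def mem_box_cart
        using v n by (simp add: pos_divide_le_eq pos_le_divide_eq mult.commute)
      ultimately show "x \<in> (\<Union>v\<in>D. CQ v)" by blast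
    qed
    hence "emeasure lborel {x. x \<notin> NP V 1 \<and> x - w \<in> NPsat V} \<le> emeasure lborel (\<Union>v\<in>D. CQ v)"
      by (rule emeasure_mono) (use finD in \<open>auto simp: CQ_def\<close>)
    also have "\<dots> \<le> ennreal (card D / real n ^ CARD('n))"
      unfolding CQ_def by (rule emeasure_cubes(2)[OF finD n])
    finally show ?thesis .
  qed
  show "ennreal (card D / real n ^ CARD('n))
      \<le> emeasure lborel {x \<in> NPsat V. x - w \<notin> NP V 1 \<and> (\<forall>i. x $ i \<le> real K + 1)}"
  proof -
    have "(\<Union>v\<in>D. Q v) \<subseteq> {x \<in> NPsat V. x - w \<notin> NP V 1 \<and> (\<forall>i. x $ i \<le> real K + 1)}"
    proof
      fix x assume "x \<in> (\<Union>v\<in>D. Q v)"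
      then obtain v where v: "v \<in> D" "x \<in> Q v" by blast
      have b: "real (lookup v i) < real n * x $ i" "real n * x $ i < real (lookup v i) + 1" for i
        using v(2) n unfolding Q_def mem_box_cart
        by (simp_all add: pos_divide_less_eq pos_less_divide_eq mult.commute)
      have "(1 / real n) *\<^sub>R real_exp v \<in> NPsat V"
        unfolding inP
      proof
        fix i
        have "v \<in> pexps (zcoord i ` V) n" using v(1) unfolding D_def sat_pexps by blast
        thus "real_exp v \<in> NP (zcoord i ` V) (real n)" using V(1) by (intro pexps_imp_NP) simp_all
      qed
      hence 1: "x \<in> NPsat V"
        by (rule NPsat_up) (use b n in \<open>simp add: pos_divide_le_eq mult.commute less_imp_le\<close>)
      have 2: "x - w \<notin> NP V 1"
      proof
        assume "x - w \<in> NP V 1"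
        hence xN: "real n *\<^sub>R (x - w) \<in> NP V (real n)" using NP_scale[of "x - w" V 1 "real n"] by simp
        have "v \<in> pexps V n"
        proof (rule NP_imp_pexps[OF V K order_refl xN])
          fix j
          have "real n * w $ j = real kap + 1" using n by (simp add: w)
          thus "(real n *\<^sub>R (x - w)) $ j \<le> real (lookup v j) - real (card V * K)"
            using b(2)[of j] unfolding kap_def by (simp add: right_diff_distrib)
        qed
        thus False using v(1) by (simp add: D_def)
      qed
      \<comment> \<open>This confines the enlarged region to a box, so its measure is finite and
        decreasing limits are available in \<open>card_sat_diff_limit\<close>.\<close>
      have "x $ i \<le> real K + 1" for i
      proof -
        have vD: "v \<in> sat (pexps V n)" "v \<notin> pexps V n" using v(1) unfolding D_def by blast+
        have "lookup v i < n * K" by (rule sat_diff_bounded[OF _ vD]) (rule K)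
        hence "real (Suc (lookup v i)) \<le> real (n * K)" by (simp only: of_nat_le_iff Suc_leI)
        hence "real (lookup v i) + 1 \<le> real n * real K" by simp
        hence "real n * x $ i \<le> real n * real K" using b(2)[of i] by linarith
        hence "x $ i \<le> real K" using n by simp
        thus ?thesis by linarith
      qed
      thus "x \<in> {x \<in> NPsat V. x - w \<notin> NP V 1 \<and> (\<forall>i. x $ i \<le> real K + 1)}" using 1 2 by blast
    qed
    moreover have "{x \<in> NPsat V. x - w \<notin> NP V 1 \<and> (\<forall>i. x $ i \<le> real K + 1)} \<in> sets lborel"
    proof -
      have "closed {x. x - w \<in> NP V 1}"
        using continuous_closed_vimage[OF closed_NP[OF V(1)], of "\<lambda>x. x - w"] by (simp add: vimage_def)
      moreover have "closed {x :: real ^ 'n. \<forall>i. x $ i \<le> real K + 1}"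
        by (intro closed_Collect_all closed_Collect_le continuous_intros)
      ultimately have "NPsat V \<inter> - {x. x - w \<in> NP V 1} \<inter> {x. \<forall>i. x $ i \<le> real K + 1} \<in> sets borel"
        using closed_NPsat[OF V(1)] by (intro sets.Int borel_comp borel_closed)
      moreover have "NPsat V \<inter> - {x. x - w \<in> NP V 1} \<inter> {x. \<forall>i. x $ i \<le> real K + 1} =
        {x \<in> NPsat V. x - w \<notin> NP V 1 \<and> (\<forall>i. x $ i \<le> real K + 1)}" by blast
      ultimately show ?thesis by simp
    qed
    ultimately have "emeasure lborel (\<Union>v\<in>D. Q v) \<le> emeasure lborel {x \<in> NPsat V. x - w \<notin> NP V 1 \<and> (\<forall>i. x $ i \<le> real K + 1)}"
      by (rule emeasure_mono)
    thus ?thesis unfolding Q_def emeasure_cubes(1)[OF finD n] .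
  qed
qed

text \<open>The inner regions \<open>L\<close> increase and the outer regions \<open>U\<close>
  decrease as the shift tends to 0. They miss or exceed the target only on frontiers of convex sets,
  so both measures tend to the same volume and squeeze the count.\<close>

lemma card_sat_diff_limit:
  fixes V :: "('n::finite \<Rightarrow>\<^sub>0 nat) set"
  assumes V: "finite V" "V \<noteq> {}"
  shows "(\<lambda>n. ennreal (card (sat (pexps V n) - pexps V n) / real n ^ CARD('n))) \<longlonglongrightarrow> emeasure lebesgue (NPsat V - NP V 1)"
    and "emeasure lebesgue (NPsat V - NP V 1) < \<infinity>"
proof -
  let ?P = "NP V 1" and ?S = "NPsat V"
  obtain K where K: "\<And>v i. v \<in> V \<Longrightarrow> lookup v i \<le> K" using exps_bound_obtain[OF V(1)] by blast
  define r where "r = real (card V * K) + 1"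
  have r0: "r \<ge> 0" by (simp add: r_def)
  define w :: "nat \<Rightarrow> real ^ 'n" where "w n = (\<chi> i. r / real (Suc n))" for n
  define B where "B = {x :: real ^ 'n. \<forall>i. x $ i \<le> real K + 1}"
  define L where "L n = {x. x \<notin> ?P \<and> x - w n \<in> ?S}" for n
  define U where "U n = {x \<in> ?S. x - w n \<notin> ?P \<and> (\<forall>i. x $ i \<le> real K + 1)}" for n
  define D where "D n = ennreal (card (sat (pexps V n) - pexps V n) / real n ^ CARD('n))" for n
  define m where "m = emeasure lborel (?S - ?P)"
  have LD: "emeasure lborel (L n) \<le> D (Suc n)" and DU: "D (Suc n) \<le> emeasure lborel (U n)" for n
    using card_sat_diff_bounds[OF V K, where n = "Suc n"] unfolding L_def U_def D_def w_def r_def by simp_all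
  have wmono: "w n' $ i \<le> w n $ i" if "n \<le> n'" for n n' i
    using that r0 by (simp add: w_def frac_le)
  have w0: "w \<longlonglongrightarrow> 0"
  proof (rule vec_tendstoI)
    fix i
    have "(\<lambda>n. r / real (Suc n)) \<longlonglongrightarrow> 0" by (rule LIMSEQ_Suc[OF lim_const_over_n])
    thus "(\<lambda>n. w n $ i) \<longlonglongrightarrow> 0 $ i" by (simp add: w_def)
  qed
  have ev: "\<forall>\<^sub>F n in sequentially. x - w n \<in> interior A" if "x \<in> interior A" for x and A :: "(real ^ 'n) set"
  proof -
    have "(\<lambda>n. x - w n) \<longlonglongrightarrow> x - 0" by (intro tendsto_diff tendsto_const w0)
    thus ?thesis using that by (intro topological_tendstoD) auto
  qed
  have cl: "closed ?P" "closed ?S" "closed B"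
    using closed_NP closed_NPsat V(1) unfolding B_def
    by (auto intro!: closed_Collect_all closed_Collect_le continuous_intros)
  have clw: "closed {x. x - w n \<in> A}" if "closed A" for A n
    using continuous_closed_vimage[OF that, of "\<lambda>x. x - w n"] by (simp add: vimage_def)
  have mL: "L n \<in> sets lborel" for n
  proof -
    have "L n = {x. x - w n \<in> ?S} - ?P" by (auto simp: L_def)
    thus ?thesis using borel_closed[OF clw[OF cl(2)]] borel_closed[OF cl(1)] by simp
  qed
  have mU: "U n \<in> sets lborel" for n
  proof -
    have "U n = (?S \<inter> B) - {x. x - w n \<in> ?P}" by (auto simp: U_def B_def)
    thus ?thesis using borel_closed[OF clw[OF cl(1)]] borel_closed[OF cl(2)] borel_closed[OF cl(3)] by simp
  qed
  have mD: "?S - ?P \<in> sets lborel" using borel_closed[OF cl(1)] borel_closed[OF cl(2)] by simp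
  have incL: "incseq L"
  proof (rule incseq_SucI, rule subsetI)
    fix n x assume "x \<in> L n"
    hence x: "x \<notin> ?P" "x - w n \<in> ?S" by (auto simp: L_def)
    have "x - w (Suc n) \<in> ?S" by (rule NPsat_up[OF x(2)]) (use wmono[of n "Suc n"] in simp)
    thus "x \<in> L (Suc n)" using x(1) by (simp add: L_def)
  qed
  have decU: "decseq U"
  proof (rule decseq_SucI, rule subsetI)
    fix n x assume "x \<in> U (Suc n)"
    hence x: "x \<in> ?S" "x - w (Suc n) \<notin> ?P" "\<forall>i. x $ i \<le> real K + 1" by (auto simp: U_def)
    have "x - w n \<notin> ?P"
    proof
      assume "x - w n \<in> ?P"
      hence "x - w (Suc n) \<in> ?P" by (rule NP_up) (use wmono[of n "Suc n"] in simp)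
      thus False using x(2) by simp
    qed
    thus "x \<in> U n" using x by (simp add: U_def)
  qed
  have finU: "emeasure lborel (U n) < \<infinity>" for n
  proof -
    define tc :: "real ^ 'n" where "tc = (\<chi> i. real K + 1)"
    have "U n \<subseteq> cbox 0 tc"
    proof
      fix x assume x: "x \<in> U n"
      \<comment> \<open>Nonnegativity follows from any single member of the intersection, so an
        arbitrary index is taken.\<close>
      hence "x \<in> NP (zcoord undefined ` V) 1" unfolding U_def NPsat_def by blast
      from NP_nonneg[OF this] have "0 \<le> x $ i" for i .
      thus "x \<in> cbox 0 tc" using x by (simp add: mem_box_cart U_def tc_def)
    qed
    hence "emeasure lborel (U n) \<le> emeasure lborel (cbox 0 tc)"
      by (rule emeasure_mono) simp
    also have "\<dots> < \<infinity>" by (rule emeasure_lborel_cbox_finite)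
    finally show ?thesis .
  qed
  have lL: "(\<lambda>n. emeasure lborel (L n)) \<longlonglongrightarrow> emeasure lborel (\<Union>n. L n)"
    by (rule Lim_emeasure_incseq[OF _ incL]) (use mL in blast)
  have lU: "(\<lambda>n. emeasure lborel (U n)) \<longlonglongrightarrow> emeasure lborel (\<Inter>n. U n)"
  proof (rule Lim_emeasure_decseq[OF _ decU])
    show "range U \<subseteq> sets lborel" using mU by blast
    show "emeasure lborel (U n) \<noteq> \<infinity>" for n using finU[of n] by simp
  qed
  have nullborel: "frontier C \<in> null_sets lborel" if "convex C" for C :: "(real ^ 'n) set"
  proof -
    have "frontier C \<in> null_sets lebesgue"
      using negligible_convex_frontier[OF that] by (simp add: negligible_iff_null_sets)
    moreover have "frontier C \<in> sets lborel" using borel_closed[OF frontier_closed] by simp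
    ultimately show ?thesis by (simp add: null_sets_def)
  qed
  have mle: "m \<le> emeasure lborel (\<Union>n. L n)"
  proof -
    have "?S - ?P \<subseteq> (\<Union>n. L n) \<union> frontier ?S"
    proof
      fix x assume x: "x \<in> ?S - ?P"
      show "x \<in> (\<Union>n. L n) \<union> frontier ?S"
      proof (cases "x \<in> interior ?S")
        case True
        then obtain n where "x - w n \<in> interior ?S" using eventually_happens[OF ev[OF True]] by auto
        hence "x \<in> L n" using x interior_subset unfolding L_def by blast
        thus ?thesis by blast
      next
        case False
        thus ?thesis using x closure_subset unfolding frontier_def by blast
      qed
    qed
    hence "m \<le> emeasure lborel ((\<Union>n. L n) \<union> frontier ?S)"
      unfolding m_def using mL borel_closed[OF frontier_closed] by (intro emeasure_mono) auto
    also have "\<dots> = emeasure lborel (\<Union>n. L n)"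
      using mL by (intro emeasure_Un_null_set nullborel convex_NPsat) auto
    finally show ?thesis .
  qed
  have Ule: "emeasure lborel (\<Inter>n. U n) \<le> m"
  proof -
    have "(\<Inter>n. U n) \<subseteq> (?S - ?P) \<union> frontier ?P"
    proof
      fix x assume "x \<in> (\<Inter>n. U n)"
      hence x: "x \<in> ?S" "\<And>n. x - w n \<notin> ?P" by (auto simp: U_def)
      have "x \<notin> interior ?P"
      proof
        assume "x \<in> interior ?P"
        then obtain n where "x - w n \<in> interior ?P" using eventually_happens[OF ev] by auto
        thus False using x(2) interior_subset by blast
      qed
      thus "x \<in> (?S - ?P) \<union> frontier ?P" using x(1) closure_subset unfolding frontier_def by blast
    qed
    hence "emeasure lborel (\<Inter>n. U n) \<le> emeasure lborel ((?S - ?P) \<union> frontier ?P)"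
      using mD borel_closed[OF frontier_closed] by (intro emeasure_mono) auto
    also have "\<dots> = m" unfolding m_def by (intro emeasure_Un_null_set nullborel convex_NP mD)
    finally show ?thesis .
  qed
  \<comment> \<open>This closes the cycle of inequalities with \<open>mle\<close> and
    \<open>Ule\<close>, so all the measures in it equal \<open>m\<close>.\<close>
  have "emeasure lborel (\<Union>n. L n) \<le> emeasure lborel (\<Inter>n. U n)"
    by (rule LIMSEQ_le[OF lL lU]) (use order_trans[OF LD DU] in blast)
  hence eq: "emeasure lborel (\<Union>n. L n) = m" "emeasure lborel (\<Inter>n. U n) = m"
    using mle Ule by (auto intro: antisym order_trans)
  have "(\<lambda>n. D (Suc n)) \<longlonglongrightarrow> m"
  proof (rule tendsto_sandwich)
    show "(\<lambda>n. emeasure lborel (L n)) \<longlonglongrightarrow> m" using lL eq by simp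
    show "(\<lambda>n. emeasure lborel (U n)) \<longlonglongrightarrow> m" using lU eq by simp
  qed (use LD DU in simp_all)
  hence "D \<longlonglongrightarrow> m" by (rule LIMSEQ_imp_Suc)
  moreover have me: "emeasure lebesgue (?S - ?P) = m"
    unfolding m_def using mD by simp
  ultimately show "D \<longlonglongrightarrow> emeasure lebesgue (?S - ?P)" by simp
  have "m \<le> emeasure lborel (U 0)" unfolding eq(2)[symmetric] by (rule emeasure_mono[OF _ mU]) blast
  also have "\<dots> < \<infinity>" by (rule finU)
  finally show "emeasure lebesgue (?S - ?P) < \<infinity>" unfolding me .
qed


section \<open>The local ring of a polynomial ring at the origin\<close>

lemma mpoly_ring_simps [simp]:
  "carrier mpoly_ring = UNIV" "mult mpoly_ring = (*)" "add mpoly_ring = (+)"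
  "one mpoly_ring = 1" "zero mpoly_ring = 0"
  by (simp_all add: mpoly_ring_def ring_of_type_algebra_def)

lemma cring_mpoly_ring: "cring (mpoly_ring :: ('n::finite, 'k::field) mpoly ring)"
  unfolding mpoly_ring_def by (rule cring_from_type_algebra)

lemma poly_mapping_sum_single:
  fixes p :: "'a \<Rightarrow>\<^sub>0 'b::comm_monoid_add"
  assumes "finite Y" "keys p \<subseteq> Y"
  shows "p = (\<Sum>v\<in>Y. Poly_Mapping.single v (lookup p v))"
proof (rule poly_mapping_eqI)
  fix u
  have "lookup (\<Sum>v\<in>Y. Poly_Mapping.single v (lookup p v)) u = (\<Sum>v\<in>Y. if u = v then lookup p v else 0)"
    unfolding lookup_sum by (rule sum.cong) (auto simp: lookup_single when_def)
  also have "\<dots> = lookup p u"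
    using assms by (auto simp: in_keys_iff)
  finally show "lookup p u = lookup (\<Sum>v\<in>Y. Poly_Mapping.single v (lookup p v)) u" ..
qed

lemma lookup_mult_0:
  fixes p q :: "('n::finite, 'k::field) mpoly"
  shows "lookup (p * q) 0 = lookup p 0 * lookup q 0"
proof -
  have "lookup (p * q) (0 + 0) = lookup p 0 * lookup q 0"
  proof (rule lookup_mult_unique)
    fix u v :: "'n \<Rightarrow>\<^sub>0 nat" assume "u + v = 0 + 0"
    hence "pdeg (u + v) = 0" by simp
    hence "pdeg u + pdeg v = 0" by (simp add: pdeg_add)
    thus "u = 0 \<and> v = 0" by simp
  qed
  thus ?thesis by simp
qed

lemma lookup_single_0_mult:
  fixes q :: "('n::finite, 'k::field) mpoly"
  shows "lookup (Poly_Mapping.single 0 k * q) v = k * lookup q v"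
proof -
  have "lookup (Poly_Mapping.single 0 k * q) (0 + v) = lookup (Poly_Mapping.single 0 k :: ('n, 'k) mpoly) 0 * lookup q v"
    by (rule lookup_mult_unique) (auto split: if_splits)
  thus ?thesis by simp
qed

lemma single_split: "Poly_Mapping.single (u + v) c = Poly_Mapping.single u c * (monom_pol v :: ('n::finite, 'k::field) mpoly)"
  by (simp add: monom_pol_def mult_single)

text \<open>Identifies the admissible denominators as the polynomials with nonzero constant
  term.\<close>

lemma genideal_var_pol:
  "genideal mpoly_ring (range var_pol) = {p :: ('n::finite, 'k::field) mpoly. lookup p 0 = 0}"
proof
  interpret A: cring "mpoly_ring :: ('n, 'k) mpoly ring" by (rule cring_mpoly_ring)
  let ?J = "genideal mpoly_ring (range var_pol) :: ('n, 'k) mpoly set"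
  have sub: "subgroup {p :: ('n, 'k) mpoly. lookup p 0 = 0} (add_monoid mpoly_ring)"
  proof (rule A.add.subgroupI)
    fix a :: "('n, 'k) mpoly" assume a: "a \<in> {p. lookup p 0 = 0}"
    have "a \<oplus>\<^bsub>mpoly_ring\<^esub> (- a) = \<zero>\<^bsub>mpoly_ring\<^esub>" by simp
    hence "\<ominus>\<^bsub>mpoly_ring\<^esub> a = - a" by (intro A.minus_equality) (simp_all add: add.commute)
    thus "\<ominus>\<^bsub>mpoly_ring\<^esub> a \<in> {p. lookup p 0 = 0}" using a by simp
  qed (auto simp: lookup_add intro: exI[of _ 0])
  have "ideal {p :: ('n, 'k) mpoly. lookup p 0 = 0} mpoly_ring"
    by (rule idealI[OF A.ring_axioms sub]) (simp_all add: lookup_mult_0)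
  moreover have "var_pol i \<in> {p :: ('n, 'k) mpoly. lookup p 0 = 0}" for i
  proof -
    have "pdeg (Poly_Mapping.single i 1) \<noteq> pdeg 0" by simp
    hence "Poly_Mapping.single i (1::nat) \<noteq> 0" by (rule contrapos_nn) simp
    thus ?thesis by (simp add: var_pol_def monom_pol_def lookup_single when_def)
  qed
  ultimately show "?J \<subseteq> {p. lookup p 0 = 0}" by (intro A.genideal_minimal) auto
  have ideal: "ideal ?J mpoly_ring" by (rule A.genideal_ideal) simp
  interpret J: ideal ?J mpoly_ring by (rule ideal)
  have var: "var_pol i \<in> ?J" for i by (rule subsetD[OF A.genideal_self]) simp_all
  have mono: "Poly_Mapping.single v c \<in> ?J" if v: "v \<noteq> 0" for v :: "'n \<Rightarrow>\<^sub>0 nat" and c :: 'k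
  proof -
    have "pdeg v \<noteq> 0" using v by simp
    then obtain k where "pdeg v = Suc k" using not0_implies_Suc by blast
    then obtain i w where w: "v = Poly_Mapping.single i 1 + w" by (rule pdeg_Suc_obtain)
    have "Poly_Mapping.single v c = Poly_Mapping.single w c * var_pol i"
      unfolding w var_pol_def add.commute[of "Poly_Mapping.single i 1"] by (rule single_split)
    thus ?thesis using J.I_l_closed[OF var, of "Poly_Mapping.single w c" i] by simp
  qed
  show "{p. lookup p 0 = 0} \<subseteq> ?J"
  proof
    fix p :: "('n, 'k) mpoly" assume p: "p \<in> {p. lookup p 0 = 0}"
    have "(\<Sum>v\<in>Y. Poly_Mapping.single v (lookup p v)) \<in> ?J" if "finite Y" "Y \<subseteq> keys p" for Y
      using that
    proof (induction Y rule: finite_induct)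
      case empty show ?case using J.zero_closed by simp
    next
      case (insert v Y)
      have "v \<noteq> 0" using insert(4) p by (auto simp: in_keys_iff)
      thus ?case using J.a_closed[OF mono insert(3)] insert by simp
    qed
    from this[OF finite_keys subset_refl] show "p \<in> ?J"
      using poly_mapping_sum_single[OF finite_keys subset_refl, of p] by simp
  qed
qed

lemma nonvanishing_iff [simp]: "(s :: ('n::finite, 'k::field) mpoly) \<in> nonvanishing \<longleftrightarrow> lookup s 0 \<noteq> 0"
  by (simp add: nonvanishing_def genideal_var_pol)

section \<open>Fractions with denominator nonvanishing at the origin\<close>

abbreviation lfrac :: "('n::finite, 'k::field) mpoly \<Rightarrow> ('n, 'k) mpoly \<Rightarrow> ('n, 'k) loc_mpoly" where
  "lfrac \<equiv> loc_frac mpoly_ring nonvanishing"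

lemma mpoly_mult_cancel:
  fixes a b u :: "('n::finite, 'k::field) mpoly"
  assumes "u * a = u * b" "u \<noteq> 0"
  shows "a = b"
proof -
  have "u * (a - b) = 0" using assms(1) by (simp add: right_diff_distrib)
  thus ?thesis using assms(2) by (simp add: mpoly_mult_eq_0_iff)
qed

lemma nonvanishing_nonzero: "lookup (s :: ('n::finite, 'k::field) mpoly) 0 \<noteq> 0 \<Longrightarrow> s \<noteq> 0"
  by auto

text \<open>The polynomial ring is a domain, so the auxiliary factor in \<open>loc_rel\<close>
  cancels and fractions compare by cross-multiplication.\<close>

lemma frac_eq_set:
  fixes a s :: "('n::finite, 'k::field) mpoly"
  assumes "lookup s 0 \<noteq> 0"
  shows "lfrac a s = {(b, t). lookup t 0 \<noteq> 0 \<and> a * t = b * s}"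
proof -
  have "(\<exists>u\<in>nonvanishing. u * (a * t) = u * (b * s)) \<longleftrightarrow> a * t = b * s" for b t :: "('n, 'k) mpoly"
  proof
    assume "\<exists>u\<in>nonvanishing. u * (a * t) = u * (b * s)"
    then obtain u :: "('n, 'k) mpoly" where u: "lookup u 0 \<noteq> 0" "u * (a * t) = u * (b * s)" by auto
    show "a * t = b * s" by (rule mpoly_mult_cancel[OF u(2) nonvanishing_nonzero[OF u(1)]])
  next
    assume "a * t = b * s"
    moreover have "(1 :: ('n, 'k) mpoly) \<in> nonvanishing" by simp
    ultimately show "\<exists>u\<in>nonvanishing. u * (a * t) = u * (b * s)" by (intro bexI[of _ 1]) simp_all
  qed
  thus ?thesis using assms unfolding loc_frac_def loc_rel_def by auto
qed

lemma frac_eq_iff: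
  fixes a s b t :: "('n::finite, 'k::field) mpoly"
  assumes "lookup s 0 \<noteq> 0" "lookup t 0 \<noteq> 0"
  shows "lfrac a s = lfrac b t \<longleftrightarrow> a * t = b * s"
proof
  assume "lfrac a s = lfrac b t"
  moreover have "(b, t) \<in> lfrac b t" using assms(2) by (simp add: frac_eq_set)
  ultimately have "(b, t) \<in> lfrac a s" by simp
  thus "a * t = b * s" using assms(1) by (simp add: frac_eq_set)
next
  assume eq: "a * t = b * s"
  have "a * r = c * s \<longleftrightarrow> b * r = c * t" for c r
  proof
    assume *: "a * r = c * s"
    have "s * (b * r) = (b * s) * r" by (simp add: ac_simps)
    also have "\<dots> = (a * r) * t" unfolding eq[symmetric] by (simp add: ac_simps)
    also have "\<dots> = s * (c * t)" unfolding * by (simp add: ac_simps)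
    finally show "b * r = c * t" by (rule mpoly_mult_cancel) (rule nonvanishing_nonzero[OF assms(1)])
  next
    assume *: "b * r = c * t"
    have "t * (a * r) = (a * t) * r" by (simp add: ac_simps)
    also have "\<dots> = (b * r) * s" unfolding eq by (simp add: ac_simps)
    also have "\<dots> = t * (c * s)" unfolding * by (simp add: ac_simps)
    finally show "a * r = c * s" by (rule mpoly_mult_cancel) (rule nonvanishing_nonzero[OF assms(2)])
  qed
  thus "lfrac a s = lfrac b t" unfolding frac_eq_set[OF assms(1)] frac_eq_set[OF assms(2)] by simp
qed

lemma frac_mem_E:
  fixes a s :: "('n::finite, 'k::field) mpoly"
  assumes "p \<in> lfrac a s" "lookup s 0 \<noteq> 0"
  shows "lookup (snd p) 0 \<noteq> 0 \<and> lfrac (fst p) (snd p) = lfrac a s"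
proof -
  obtain b t where p: "p = (b, t)" by (cases p)
  have "lookup t 0 \<noteq> 0" "a * t = b * s" using assms p by (simp_all add: frac_eq_set)
  thus ?thesis using p assms(2) frac_eq_iff[of t s b a] by simp
qed

lemma frac_self: "lookup (s :: ('n::finite, 'k::field) mpoly) 0 \<noteq> 0 \<Longrightarrow> (a, s) \<in> lfrac a s"
  by (simp add: frac_eq_set)

lemma loc_ring_carrier: "x \<in> carrier (loc_ring :: ('n::finite, 'k::field) loc_mpoly ring) \<longleftrightarrow>
  (\<exists>a s. lookup s 0 \<noteq> 0 \<and> x = lfrac a s)"
proof -
  have c: "carrier loc_ring = (UNIV \<times> nonvanishing) // loc_rel mpoly_ring (nonvanishing :: ('n, 'k) mpoly set)"
    by (simp add: loc_ring_def localization_def)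
  show ?thesis
  proof
    assume "x \<in> carrier (loc_ring :: ('n, 'k) loc_mpoly ring)"
    then obtain p where p: "p \<in> UNIV \<times> nonvanishing" "x = loc_rel mpoly_ring nonvanishing `` {p}"
      unfolding c by (elim quotientE)
    obtain a s where "p = (a, s)" by (cases p)
    hence "lookup s 0 \<noteq> 0 \<and> x = lfrac a s" using p by (simp add: loc_frac_def)
    thus "\<exists>a s. lookup s 0 \<noteq> 0 \<and> x = lfrac a s" by blast
  next
    assume "\<exists>a s. lookup s 0 \<noteq> 0 \<and> x = lfrac a s"
    then obtain a s where "lookup s 0 \<noteq> 0" "x = lfrac a s" by blast
    thus "x \<in> carrier loc_ring" unfolding c loc_frac_def by (simp add: quotientI)
  qed
qed

lemma frac_carrier [simp]: "lookup s 0 \<noteq> 0 \<Longrightarrow> lfrac a s \<in> carrier loc_ring"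
  unfolding loc_ring_carrier by blast

lemma loc_ring_one: "\<one>\<^bsub>loc_ring\<^esub> = lfrac 1 1" and loc_ring_zero: "\<zero>\<^bsub>loc_ring\<^esub> = lfrac 0 1"
  by (simp_all add: loc_ring_def localization_def)

text \<open>The operations of \<open>localization\<close> are unions over all representatives. Once
  all representatives give the same fraction, the union is that fraction, so well-definedness and
  evaluation are one step.\<close>

lemma UN_const: "U \<noteq> {} \<Longrightarrow> (\<And>x. x \<in> U \<Longrightarrow> f x = c) \<Longrightarrow> (\<Union>x\<in>U. f x) = c"
  by auto

lemma loc_ring_mult:
  fixes a s b t :: "('n::finite, 'k::field) mpoly"
  assumes s: "lookup s 0 \<noteq> 0" and t: "lookup t 0 \<noteq> 0"
  shows "lfrac a s \<otimes>\<^bsub>loc_ring\<^esub> lfrac b t = lfrac (a * b) (s * t)"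
proof -
  have "lfrac a s \<otimes>\<^bsub>loc_ring\<^esub> lfrac b t = (\<Union>p\<in>lfrac a s. \<Union>q\<in>lfrac b t. lfrac (fst p * fst q) (snd p * snd q))"
    by (simp add: loc_ring_def localization_def case_prod_beta)
  also have "\<dots> = lfrac (a * b) (s * t)"
  proof (rule UN_const, use frac_self[OF s] in blast, rule UN_const, use frac_self[OF t] in blast)
    fix p q assume p: "p \<in> lfrac a s" and q: "q \<in> lfrac b t"
    have nz: "lookup (snd p) 0 \<noteq> 0" "lookup (snd q) 0 \<noteq> 0"
      using frac_mem_E[OF p s] frac_mem_E[OF q t] by simp_all
    have eq: "fst p * s = a * snd p" "fst q * t = b * snd q"
      using frac_mem_E[OF p s] frac_mem_E[OF q t] frac_eq_iff s t by blast+
    have "fst p * fst q * (s * t) = (fst p * s) * (fst q * t)" by (simp add: ac_simps)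
    also have "\<dots> = a * b * (snd p * snd q)" unfolding eq by (simp add: ac_simps)
    finally show "lfrac (fst p * fst q) (snd p * snd q) = lfrac (a * b) (s * t)"
      using nz s t by (subst frac_eq_iff) (simp_all add: lookup_mult_0)
  qed
  finally show ?thesis .
qed

lemma loc_ring_add:
  fixes a s b t :: "('n::finite, 'k::field) mpoly"
  assumes s: "lookup s 0 \<noteq> 0" and t: "lookup t 0 \<noteq> 0"
  shows "lfrac a s \<oplus>\<^bsub>loc_ring\<^esub> lfrac b t = lfrac (a * t + b * s) (s * t)"
proof -
  have "lfrac a s \<oplus>\<^bsub>loc_ring\<^esub> lfrac b t =
    (\<Union>p\<in>lfrac a s. \<Union>q\<in>lfrac b t. lfrac (fst p * snd q + fst q * snd p) (snd p * snd q))"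
    by (simp add: loc_ring_def localization_def case_prod_beta)
  also have "\<dots> = lfrac (a * t + b * s) (s * t)"
  proof (rule UN_const, use frac_self[OF s] in blast, rule UN_const, use frac_self[OF t] in blast)
    fix p q assume p: "p \<in> lfrac a s" and q: "q \<in> lfrac b t"
    have nz: "lookup (snd p) 0 \<noteq> 0" "lookup (snd q) 0 \<noteq> 0"
      using frac_mem_E[OF p s] frac_mem_E[OF q t] by simp_all
    have eq: "fst p * s = a * snd p" "fst q * t = b * snd q"
      using frac_mem_E[OF p s] frac_mem_E[OF q t] frac_eq_iff s t by blast+
    have "(fst p * snd q + fst q * snd p) * (s * t) = (fst p * s) * (snd q * t) + (fst q * t) * (snd p * s)"
      by (simp add: algebra_simps)
    also have "\<dots> = (a * t + b * s) * (snd p * snd q)" unfolding eq by (simp add: algebra_simps)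
    finally show "lfrac (fst p * snd q + fst q * snd p) (snd p * snd q) = lfrac (a * t + b * s) (s * t)"
      using nz s t by (subst frac_eq_iff) (simp_all add: lookup_mult_0)
  qed
  finally show ?thesis .
qed

lemma frac_cases:
  assumes "x \<in> carrier (loc_ring :: ('n::finite, 'k::field) loc_mpoly ring)"
  obtains a s where "lookup s 0 \<noteq> 0" "x = lfrac a s"
  using assms unfolding loc_ring_carrier by blast

lemma cring_loc_ring: "cring (loc_ring :: ('n::finite, 'k::field) loc_mpoly ring)"
proof (rule cringI)
  let ?R = "loc_ring :: ('n, 'k) loc_mpoly ring"
  note simps = loc_ring_mult loc_ring_add loc_ring_one loc_ring_zero lookup_mult_0 frac_eq_iff algebra_simps
  show "abelian_group ?R"
  proof (rule abelian_groupI)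
    fix x y z assume "x \<in> carrier ?R" "y \<in> carrier ?R" "z \<in> carrier ?R"
    then obtain a s b t c r where *: "lookup s 0 \<noteq> 0" "x = lfrac a s" "lookup t 0 \<noteq> 0" "y = lfrac b t" "lookup r 0 \<noteq> 0" "z = lfrac c r"
      by (elim frac_cases) blast
    show "x \<oplus>\<^bsub>?R\<^esub> y \<oplus>\<^bsub>?R\<^esub> z = x \<oplus>\<^bsub>?R\<^esub> (y \<oplus>\<^bsub>?R\<^esub> z)" using * by (simp add: simps)
  next
    fix x y assume "x \<in> carrier ?R" "y \<in> carrier ?R"
    then obtain a s b t where *: "lookup s 0 \<noteq> 0" "x = lfrac a s" "lookup t 0 \<noteq> 0" "y = lfrac b t"
      by (elim frac_cases) blast
    show "x \<oplus>\<^bsub>?R\<^esub> y \<in> carrier ?R" "x \<oplus>\<^bsub>?R\<^esub> y = y \<oplus>\<^bsub>?R\<^esub> x" using * by (simp_all add: simps)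
  next
    fix x assume "x \<in> carrier ?R"
    then obtain a s where *: "lookup s 0 \<noteq> 0" "x = lfrac a s" by (elim frac_cases) blast
    show "\<zero>\<^bsub>?R\<^esub> \<oplus>\<^bsub>?R\<^esub> x = x" using * by (simp add: simps)
    have "lfrac (- a) s \<oplus>\<^bsub>?R\<^esub> x = \<zero>\<^bsub>?R\<^esub>" using * by (simp add: simps)
    thus "\<exists>y\<in>carrier ?R. y \<oplus>\<^bsub>?R\<^esub> x = \<zero>\<^bsub>?R\<^esub>" using * by (intro bexI[of _ "lfrac (- a) s"]) simp_all
  qed (simp add: loc_ring_zero)
  show "comm_monoid ?R"
  proof (rule comm_monoidI)
    fix x y z assume "x \<in> carrier ?R" "y \<in> carrier ?R" "z \<in> carrier ?R"
    then obtain a s b t c r where *: "lookup s 0 \<noteq> 0" "x = lfrac a s" "lookup t 0 \<noteq> 0" "y = lfrac b t" "lookup r 0 \<noteq> 0" "z = lfrac c r"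
      by (elim frac_cases) blast
    show "x \<otimes>\<^bsub>?R\<^esub> y \<otimes>\<^bsub>?R\<^esub> z = x \<otimes>\<^bsub>?R\<^esub> (y \<otimes>\<^bsub>?R\<^esub> z)" using * by (simp add: simps)
  next
    fix x y assume "x \<in> carrier ?R" "y \<in> carrier ?R"
    then obtain a s b t where *: "lookup s 0 \<noteq> 0" "x = lfrac a s" "lookup t 0 \<noteq> 0" "y = lfrac b t"
      by (elim frac_cases) blast
    show "x \<otimes>\<^bsub>?R\<^esub> y \<in> carrier ?R" "x \<otimes>\<^bsub>?R\<^esub> y = y \<otimes>\<^bsub>?R\<^esub> x" using * by (simp_all add: simps)
  next
    fix x assume "x \<in> carrier ?R"
    then obtain a s where *: "lookup s 0 \<noteq> 0" "x = lfrac a s" by (elim frac_cases) blast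
    show "\<one>\<^bsub>?R\<^esub> \<otimes>\<^bsub>?R\<^esub> x = x" using * by (simp add: simps)
  qed (simp add: loc_ring_one)
  fix x y z assume "x \<in> carrier ?R" "y \<in> carrier ?R" "z \<in> carrier ?R"
  then obtain a s b t c r where *: "lookup s 0 \<noteq> 0" "x = lfrac a s" "lookup t 0 \<noteq> 0" "y = lfrac b t" "lookup r 0 \<noteq> 0" "z = lfrac c r"
    by (elim frac_cases) blast
  show "(x \<oplus>\<^bsub>?R\<^esub> y) \<otimes>\<^bsub>?R\<^esub> z = x \<otimes>\<^bsub>?R\<^esub> z \<oplus>\<^bsub>?R\<^esub> y \<otimes>\<^bsub>?R\<^esub> z" using * by (simp add: simps)
qed

lemmas ideal_a_closed = additive_subgroup.a_closed[OF ideal.axioms(1)]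
lemmas ideal_zero_closed = additive_subgroup.zero_closed[OF ideal.axioms(1)]

subsection \<open>Monomial ideals\<close>

text \<open>Only one representative is required to have its numerator supported in \<open>E\<close>;
  for upward closed \<open>E\<close> every representative then has, by
  \<open>mono_ideal_mem_iff\<close>.\<close>

definition mono_ideal :: "('n \<Rightarrow>\<^sub>0 nat) set \<Rightarrow> ('n::finite, 'k::field) loc_mpoly set" where
  "mono_ideal E = {lfrac a s | a s. lookup s 0 \<noteq> 0 \<and> keys a \<subseteq> E}"

lemma keys_mult_upclosed:
  fixes a u :: "('n::finite, 'k::field) mpoly"
  assumes "upclosed E" "keys a \<subseteq> E"
  shows "keys (u * a) \<subseteq> E"
proof
  fix v assume "v \<in> keys (u * a)"
  then obtain p q where pq: "v = p + q" "q \<in> keys a" using keys_mult[of u a] by blast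
  hence "q + p \<in> E" using assms unfolding upclosed_def by blast
  thus "v \<in> E" using pq(1) by (simp add: add.commute)
qed

text \<open>A term of \<open>a\<close> outside \<open>E\<close> of lowest degree survives in
  \<open>u * a\<close>: any other contribution to this exponent would come from a term of
  \<open>a\<close> that is also outside \<open>E\<close>, because \<open>E\<close> is upward closed,
  and of smaller degree. What remains is the product with the constant term of
  \<open>u\<close>.\<close>

lemma keys_nonvanishing_mult:
  fixes a u :: "('n::finite, 'k::field) mpoly"
  assumes E: "upclosed E" and u: "lookup u 0 \<noteq> 0" and ua: "keys (u * a) \<subseteq> E"
  shows "keys a \<subseteq> E"
proof (rule ccontr)
  assume "\<not> keys a \<subseteq> E"
  then obtain v0 where "v0 \<in> keys a - E" by blast
  from ex_has_least_nat[of "\<lambda>v. v \<in> keys a - E", OF this, of pdeg]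
  obtain v where v: "v \<in> keys a - E" "\<And>w. w \<in> keys a - E \<Longrightarrow> pdeg v \<le> pdeg w" by blast
  have "lookup (u * a) (0 + v) = lookup u 0 * lookup a v"
  proof (rule lookup_mult_unique)
    fix u' v' assume *: "u' \<in> keys u" "v' \<in> keys a" "u' + v' = 0 + v"
    hence uv: "v = v' + u'" by (simp add: add.commute)
    have "v' \<notin> E" using v(1) E uv unfolding upclosed_def by blast
    hence "pdeg v \<le> pdeg v'" using v(2) *(2) by blast
    hence "pdeg u' = 0" using uv by (simp add: pdeg_add)
    thus "u' = 0 \<and> v' = v" using uv by simp
  qed
  hence "lookup (u * a) v \<noteq> 0" using u v(1) by (simp add: in_keys_iff)
  hence "v \<in> E" using ua by (auto simp: in_keys_iff)
  thus False using v(1) by blast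
qed

lemma mono_ideal_mem_iff:
  fixes a s :: "('n::finite, 'k::field) mpoly"
  assumes "upclosed E" "lookup s 0 \<noteq> 0"
  shows "lfrac a s \<in> mono_ideal E \<longleftrightarrow> keys a \<subseteq> E"
proof
  assume "lfrac a s \<in> mono_ideal E"
  then obtain b t where bt: "lfrac a s = lfrac b t" "lookup t 0 \<noteq> 0" "keys b \<subseteq> E" unfolding mono_ideal_def by blast
  have "t * a = s * b" using bt(1) frac_eq_iff[OF assms(2) bt(2)] by (simp add: mult.commute)
  hence "keys (t * a) \<subseteq> E" using keys_mult_upclosed[OF assms(1) bt(3)] by simp
  thus "keys a \<subseteq> E" using keys_nonvanishing_mult[OF assms(1) bt(2)] by blast
next
  assume "keys a \<subseteq> E"
  thus "lfrac a s \<in> mono_ideal E" using assms(2) unfolding mono_ideal_def by blast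
qed

lemma mono_ideal_subset_carrier: "mono_ideal E \<subseteq> carrier loc_ring"
  unfolding mono_ideal_def by auto

lemma ideal_mono_ideal:
  assumes E: "upclosed E"
  shows "ideal (mono_ideal E :: ('n::finite, 'k::field) loc_mpoly set) loc_ring"
proof -
  interpret R: cring "loc_ring :: ('n, 'k) loc_mpoly ring" by (rule cring_loc_ring)
  let ?I = "mono_ideal E :: ('n, 'k) loc_mpoly set"
  have mult: "x \<otimes>\<^bsub>loc_ring\<^esub> a \<in> ?I" if xa: "a \<in> ?I" "x \<in> carrier loc_ring" for a x
  proof -
    obtain p s where p: "a = lfrac p s" "lookup s 0 \<noteq> 0" "keys p \<subseteq> E" using xa(1) unfolding mono_ideal_def by blast
    obtain q t where q: "x = lfrac q t" "lookup t 0 \<noteq> 0" using xa(2) unfolding loc_ring_carrier by blast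
    show ?thesis unfolding p q using p q keys_mult_upclosed[OF E p(3), of q]
      by (simp add: loc_ring_mult mono_ideal_mem_iff[OF E] lookup_mult_0)
  qed
  have sub: "subgroup ?I (add_monoid loc_ring)"
  proof (rule R.add.subgroupI)
    show "?I \<subseteq> carrier loc_ring" by (rule mono_ideal_subset_carrier)
    have "lfrac 0 1 \<in> ?I" by (simp add: mono_ideal_mem_iff[OF E])
    thus "?I \<noteq> {}" by blast
  next
    fix a assume a: "a \<in> ?I"
    hence ac: "a \<in> carrier loc_ring" using mono_ideal_subset_carrier by blast
    have "(\<ominus>\<^bsub>loc_ring\<^esub> \<one>\<^bsub>loc_ring\<^esub>) \<otimes>\<^bsub>loc_ring\<^esub> a \<in> ?I" by (rule mult[OF a]) simp
    thus "\<ominus>\<^bsub>loc_ring\<^esub> a \<in> ?I" using ac by (simp add: R.l_minus)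
  next
    fix a b assume "a \<in> ?I" "b \<in> ?I"
    then obtain p s q t where *: "a = lfrac p s" "lookup s 0 \<noteq> 0" "keys p \<subseteq> E" "b = lfrac q t" "lookup t 0 \<noteq> 0" "keys q \<subseteq> E"
      unfolding mono_ideal_def by blast
    have "keys (t * p + s * q) \<subseteq> E"
      using keys_add[of "t * p" "s * q"] keys_mult_upclosed[OF E *(3), of t] keys_mult_upclosed[OF E *(6), of s] by blast
    thus "a \<oplus>\<^bsub>loc_ring\<^esub> b \<in> ?I"
      using * by (simp add: loc_ring_add mono_ideal_mem_iff[OF E] lookup_mult_0 mult.commute)
  qed
  show ?thesis
  proof (rule idealI[OF R.ring_axioms sub])
    fix a x :: "('n, 'k) loc_mpoly" assume a: "a \<in> ?I" and x: "x \<in> carrier loc_ring"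
    show xa: "x \<otimes>\<^bsub>loc_ring\<^esub> a \<in> ?I" by (rule mult[OF a x])
    have "a \<in> carrier loc_ring" using a mono_ideal_subset_carrier by blast
    thus "a \<otimes>\<^bsub>loc_ring\<^esub> x \<in> ?I" using xa R.m_comm[of a x] x by simp
  qed
qed

lemma in_loc_carrier [simp]: "in_loc p \<in> carrier loc_ring"
  by (simp add: in_loc_def)

lemma in_loc_add: "in_loc (p + q) = in_loc p \<oplus>\<^bsub>loc_ring\<^esub> in_loc q"
  by (simp add: in_loc_def loc_ring_add)

lemma in_loc_mult: "in_loc (p * q) = in_loc p \<otimes>\<^bsub>loc_ring\<^esub> in_loc q"
  by (simp add: in_loc_def loc_ring_mult)

lemma in_loc_0: "in_loc 0 = \<zero>\<^bsub>loc_ring\<^esub>" and in_loc_1: "in_loc 1 = \<one>\<^bsub>loc_ring\<^esub>"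
  by (simp_all add: in_loc_def loc_ring_zero loc_ring_one)

lemma frac_eq_mult: "lookup s 0 \<noteq> 0 \<Longrightarrow> lfrac a s = lfrac 1 s \<otimes>\<^bsub>loc_ring\<^esub> in_loc a"
  by (simp add: in_loc_def loc_ring_mult)

lemma in_loc_eq_mult: "lookup s 0 \<noteq> 0 \<Longrightarrow> in_loc a = in_loc s \<otimes>\<^bsub>loc_ring\<^esub> lfrac a s"
  by (simp add: in_loc_def loc_ring_mult frac_eq_iff mult.commute)

lemma in_loc_mem_iff:
  assumes "upclosed E"
  shows "in_loc a \<in> mono_ideal E \<longleftrightarrow> keys a \<subseteq> E"
  unfolding in_loc_def by (rule mono_ideal_mem_iff[OF assms]) simp

lemma in_loc_mem_ideal:
  fixes L :: "('n::finite, 'k::field) loc_mpoly set"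
  assumes L: "ideal L loc_ring" and m: "\<And>v. v \<in> keys a \<Longrightarrow> in_loc (Poly_Mapping.single v (lookup a v)) \<in> L"
  shows "in_loc a \<in> L"
proof -
  interpret L: ideal L loc_ring by (rule L)
  have "in_loc (\<Sum>v\<in>Y. Poly_Mapping.single v (lookup a v)) \<in> L" if "finite Y" "Y \<subseteq> keys a" for Y
    using that
  proof (induction Y rule: finite_induct)
    case empty show ?case using ideal_zero_closed[OF L] by (simp add: in_loc_0)
  next
    case (insert v Y)
    have "in_loc (Poly_Mapping.single v (lookup a v)) \<oplus>\<^bsub>loc_ring\<^esub> in_loc (\<Sum>v\<in>Y. Poly_Mapping.single v (lookup a v)) \<in> L"
      by (rule ideal_a_closed[OF L]) (use insert m in auto)
    thus ?case using insert by (simp add: in_loc_add)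
  qed
  from this[OF finite_keys subset_refl] show ?thesis
    using poly_mapping_sum_single[OF finite_keys subset_refl, of a] by simp
qed

lemma mono_ideal_subset_ideal:
  fixes L :: "('n::finite, 'k::field) loc_mpoly set"
  assumes L: "ideal L loc_ring" and m: "\<And>v c. v \<in> E \<Longrightarrow> in_loc (Poly_Mapping.single v c) \<in> L"
  shows "mono_ideal E \<subseteq> L"
proof
  interpret L: ideal L loc_ring by (rule L)
  fix x assume "x \<in> (mono_ideal E :: ('n, 'k) loc_mpoly set)"
  then obtain a s where x: "x = lfrac a s" "lookup s 0 \<noteq> 0" "keys a \<subseteq> E" unfolding mono_ideal_def by blast
  have "in_loc a \<in> L"
  proof (rule in_loc_mem_ideal[OF L])
    fix v assume "v \<in> keys a"
    hence "v \<in> E" using x(3) by blast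
    thus "in_loc (Poly_Mapping.single v (lookup a v)) \<in> L" by (rule m)
  qed
  hence "lfrac 1 s \<otimes>\<^bsub>loc_ring\<^esub> in_loc a \<in> L" using x(2) by (intro L.I_l_closed) simp_all
  thus "x \<in> L" using x(1) frac_eq_mult[OF x(2), of a] by argo
qed

lemma ideal_of_exps_eq: "ideal_of_exps V = (mono_ideal (upc V) :: ('n::finite, 'k::field) loc_mpoly set)"
proof
  interpret R: cring "loc_ring :: ('n, 'k) loc_mpoly ring" by (rule cring_loc_ring)
  let ?G = "(\<lambda>v. in_loc (monom_pol v)) ` V :: ('n, 'k) loc_mpoly set"
  have G: "?G \<subseteq> carrier loc_ring" by auto
  have m: "keys (monom_pol v :: ('n, 'k) mpoly) = {v}" for v by (simp add: monom_pol_def)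
  show "ideal_of_exps V \<subseteq> (mono_ideal (upc V) :: ('n, 'k) loc_mpoly set)"
    unfolding ideal_of_exps_def
  proof (rule R.genideal_minimal[OF ideal_mono_ideal[OF upclosed_upc]], rule image_subsetI)
    fix v assume "v \<in> V"
    hence "v \<in> upc V" using subset_upc by blast
    thus "(in_loc (monom_pol v) :: ('n, 'k) loc_mpoly) \<in> mono_ideal (upc V)"
      unfolding in_loc_mem_iff[OF upclosed_upc] m by simp
  qed
  have I: "ideal (ideal_of_exps V :: ('n, 'k) loc_mpoly set) loc_ring"
    unfolding ideal_of_exps_def by (rule R.genideal_ideal[OF G])
  interpret I: ideal "ideal_of_exps V :: ('n, 'k) loc_mpoly set" loc_ring by (rule I)
  show "mono_ideal (upc V) \<subseteq> (ideal_of_exps V :: ('n, 'k) loc_mpoly set)"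
  proof (rule mono_ideal_subset_ideal[OF I])
    fix v and c :: 'k assume "v \<in> upc V"
    then obtain w where w: "w \<in> V" "ple w v" unfolding upc_def by blast
    have "v = (v - w) + w" using ple_diff_add[OF w(2)] by (simp add: add.commute)
    hence "Poly_Mapping.single v c = Poly_Mapping.single ((v - w) + w) c" by simp
    hence "Poly_Mapping.single v c = Poly_Mapping.single (v - w) c * monom_pol w" by (simp only: single_split)
    moreover have "in_loc (monom_pol w) \<in> (ideal_of_exps V :: ('n, 'k) loc_mpoly set)"
      unfolding ideal_of_exps_def using R.genideal_self[OF G] w(1) by blast
    ultimately show "in_loc (Poly_Mapping.single v c) \<in> (ideal_of_exps V :: ('n, 'k) loc_mpoly set)"
      by (simp add: in_loc_mult I.I_l_closed)
  qed
qed

lemma max_id_eq: "max_id = (mono_ideal {v. v \<noteq> 0} :: ('n::finite, 'k::field) loc_mpoly set)"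
proof -
  have "max_id = (ideal_of_exps (range (\<lambda>i. Poly_Mapping.single i 1)) :: ('n, 'k) loc_mpoly set)"
    by (simp add: max_id_def ideal_of_exps_def var_pol_def image_image)
  moreover have "upc (range (\<lambda>i::'n. Poly_Mapping.single i 1)) = {v. v \<noteq> 0}"
  proof (intro equalityI subsetI)
    fix v :: "'n \<Rightarrow>\<^sub>0 nat" assume "v \<in> upc (range (\<lambda>i. Poly_Mapping.single i 1))"
    then obtain i where "ple (Poly_Mapping.single i 1) v" unfolding upc_def by blast
    hence "1 \<le> pdeg v" using pdeg_mono by fastforce
    thus "v \<in> {v. v \<noteq> 0}" by auto
  next
    fix v :: "'n \<Rightarrow>\<^sub>0 nat" assume "v \<in> {v. v \<noteq> 0}"
    hence "pdeg v \<noteq> 0" by simp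
    then obtain k where "pdeg v = Suc k" using not0_implies_Suc by blast
    then obtain i w where vw: "v = Poly_Mapping.single i 1 + w" by (rule pdeg_Suc_obtain)
    have "ple (Poly_Mapping.single i 1) v" unfolding vw by (rule ple_add)
    thus "v \<in> upc (range (\<lambda>i. Poly_Mapping.single i 1))" unfolding upc_def by blast
  qed
  ultimately show ?thesis by (simp add: ideal_of_exps_eq)
qed

lemma upclosed_sum: "upclosed E \<Longrightarrow> upclosed {u + v | u v. u \<in> E \<and> v \<in> E'}"
proof -
  assume E: "upclosed E"
  show ?thesis
    unfolding upclosed_def
  proof (intro ballI allI)
    fix x w assume "x \<in> {u + v | u v. u \<in> E \<and> v \<in> E'}"
    then obtain u v where "x = u + v" "u \<in> E" "v \<in> E'" by blast
    moreover from this have "u + w \<in> E" using E unfolding upclosed_def by blast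
    moreover have "u + v + w = (u + w) + v" by (simp add: ac_simps)
    ultimately show "x + w \<in> {u + v | u v. u \<in> E \<and> v \<in> E'}" by auto
  qed
qed

lemma ideal_prod_mono_ideal:
  assumes E: "upclosed E" and E': "upclosed E'"
  shows "ideal_prod loc_ring (mono_ideal E) (mono_ideal E') =
    (mono_ideal {u + v | u v. u \<in> E \<and> v \<in> E'} :: ('n::finite, 'k::field) loc_mpoly set)" (is "?L = mono_ideal ?S")
proof
  interpret R: cring "loc_ring :: ('n, 'k) loc_mpoly ring" by (rule cring_loc_ring)
  have S: "upclosed ?S" by (rule upclosed_sum[OF E])
  interpret S: ideal "mono_ideal ?S :: ('n, 'k) loc_mpoly set" loc_ring by (rule ideal_mono_ideal[OF S])
  show "?L \<subseteq> mono_ideal ?S"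
  proof
    fix x assume "x \<in> ?L"
    thus "x \<in> mono_ideal ?S"
    proof induction
      case (prod i j)
      then obtain a s b t where *: "i = lfrac a s" "lookup s 0 \<noteq> 0" "keys a \<subseteq> E" "j = lfrac b t" "lookup t 0 \<noteq> 0" "keys b \<subseteq> E'"
        unfolding mono_ideal_def by blast
      have "keys (a * b) \<subseteq> ?S" using keys_mult[of a b] *(3,6) by blast
      thus ?case using * by (simp add: loc_ring_mult mono_ideal_mem_iff[OF S] lookup_mult_0)
    next
      case (sum s1 s2) thus ?case by (intro ideal_a_closed[OF ideal_mono_ideal[OF S]])
    qed
  qed
  have L: "ideal ?L loc_ring" by (rule R.ideal_prod_is_ideal[OF ideal_mono_ideal[OF E] ideal_mono_ideal[OF E']])
  show "mono_ideal ?S \<subseteq> ?L"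
  proof (rule mono_ideal_subset_ideal[OF L])
    fix v and c :: 'k assume "v \<in> ?S"
    then obtain u w where v: "v = u + w" "u \<in> E" "w \<in> E'" by blast
    have "in_loc (Poly_Mapping.single u c) \<otimes>\<^bsub>loc_ring\<^esub> in_loc (monom_pol w) \<in> ?L"
      by (rule ideal_prod.prod) (use v keys_single[of u c] in \<open>auto simp: in_loc_mem_iff[OF E] in_loc_mem_iff[OF E'] monom_pol_def split: if_splits\<close>)
    thus "in_loc (Poly_Mapping.single v c) \<in> ?L" unfolding v(1) single_split in_loc_mult .
  qed
qed

lemma carrier_eq_mono_ideal: "carrier loc_ring = (mono_ideal UNIV :: ('n::finite, 'k::field) loc_mpoly set)"
proof (rule Set.set_eqI)
  fix x :: "('n, 'k) loc_mpoly"
  show "x \<in> carrier loc_ring \<longleftrightarrow> x \<in> mono_ideal UNIV" unfolding loc_ring_carrier mono_ideal_def by blast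
qed

lemma ideal_pow_mono_ideal:
  "ideal_pow loc_ring (mono_ideal (upc V)) n = (mono_ideal (pexps V n) :: ('n::finite, 'k::field) loc_mpoly set)"
proof (induction n)
  case 0
  show ?case by (simp add: ideals_set_def carrier_eq_mono_ideal nat_pow_def)
next
  case (Suc n)
  have "ideal_pow loc_ring (mono_ideal (upc V)) (Suc n) =
     ideal_prod loc_ring (ideal_pow loc_ring (mono_ideal (upc V)) n) (mono_ideal (upc V) :: ('n, 'k) loc_mpoly set)"
    by (simp add: nat_pow_def ideals_set_def)
  also have "\<dots> = mono_ideal {u + v | u v. u \<in> pexps V n \<and> v \<in> upc V}"
    unfolding Suc by (rule ideal_prod_mono_ideal[OF upclosed_pexps upclosed_upc])
  also have "{u + v | u v. u \<in> pexps V n \<and> v \<in> upc V} = pexps V (Suc n)"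
    using pexps_add[of V n "Suc 0"] by (simp only: pexps_1 add_Suc_right add_0_right)
  finally show ?case .
qed

lemma mono_ideal_le_iff:
  assumes "upclosed E" "upclosed E'"
  shows "(mono_ideal E :: ('n::finite, 'k::field) loc_mpoly set) \<subseteq> mono_ideal E' \<longleftrightarrow> E \<subseteq> E'"
proof
  assume sub: "(mono_ideal E :: ('n, 'k) loc_mpoly set) \<subseteq> mono_ideal E'"
  show "E \<subseteq> E'"
  proof
    fix v assume "v \<in> E"
    hence "(in_loc (monom_pol v) :: ('n, 'k) loc_mpoly) \<in> mono_ideal E"
      unfolding in_loc_mem_iff[OF assms(1)] by (simp add: monom_pol_def)
    hence "(in_loc (monom_pol v) :: ('n, 'k) loc_mpoly) \<in> mono_ideal E'" using sub by blast
    thus "v \<in> E'" unfolding in_loc_mem_iff[OF assms(2)] by (simp add: monom_pol_def)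
  qed
next
  assume "E \<subseteq> E'" thus "(mono_ideal E :: ('n, 'k) loc_mpoly set) \<subseteq> mono_ideal E'"
    unfolding mono_ideal_def by blast
qed

text \<open>Every generating set of exponents contains \<open>minl U\<close>, which already
  generates. It is therefore the only irredundant one, and the definite description in
  \<open>min_exps\<close> denotes it.\<close>

lemma min_exps_mono_ideal:
  fixes U :: "('n::finite \<Rightarrow>\<^sub>0 nat) set"
  assumes U: "upclosed U"
  shows "min_exps (mono_ideal U :: ('n, 'k::field) loc_mpoly set) = minl U"
proof -
  let ?I = "mono_ideal U :: ('n, 'k) loc_mpoly set"
  have eq: "ideal_of_exps W = ?I \<longleftrightarrow> upc W = U" for W
    unfolding ideal_of_exps_eq
    using mono_ideal_le_iff[OF upclosed_upc U, of W, where 'k = 'k] mono_ideal_le_iff[OF U upclosed_upc, of W, where 'k = 'k]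
    by (simp only: set_eq_subset)
  have sub: "minl U \<subseteq> W" if "upc W = U" for W using minl_upc_subset[of W] that by simp
  have m: "minimally_generates (minl U) ?I"
    unfolding minimally_generates_def eq using upc_minl[OF U] sub by blast
  show ?thesis
    unfolding min_exps_def
  proof (rule the_equality)
    show "minimally_generates (minl U) ?I" by (rule m)
    fix W assume "minimally_generates W ?I"
    hence W: "upc W = U" "\<And>W'. W' \<subset> W \<Longrightarrow> upc W' \<noteq> U" unfolding minimally_generates_def eq by blast+
    show "W = minl U"
    proof (rule ccontr)
      assume "W \<noteq> minl U"
      hence "minl U \<subset> W" using sub[OF W(1)] by blast
      thus False using W(2) upc_minl[OF U] by blast
    qed
  qed
qed

section \<open>The length of the zeroth local cohomology\<close>

lemma ideal_rcos_eq_iff: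
  fixes I :: "('n::finite, 'k::field) loc_mpoly set"
  assumes "ideal I loc_ring" "x \<in> carrier loc_ring"
  shows "I +>\<^bsub>loc_ring\<^esub> x = I \<longleftrightarrow> x \<in> I"
proof -
  interpret R: cring "loc_ring :: ('n, 'k) loc_mpoly ring" by (rule cring_loc_ring)
  interpret I: ideal I loc_ring by (rule assms(1))
  have "I +>\<^bsub>loc_ring\<^esub> \<zero>\<^bsub>loc_ring\<^esub> = I" by (rule I.a_rcos_const) (rule ideal_zero_closed[OF assms(1)])
  thus ?thesis
    using R.quotient_eq_iff_same_a_r_cos[OF assms R.zero_closed] assms(2) by (simp add: a_minus_def)
qed

lemma max_id_pow: "ideal_pow loc_ring max_id j = (mono_ideal {v. j \<le> pdeg v} :: ('n::finite, 'k::field) loc_mpoly set)"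
proof -
  have up: "upclosed {v :: 'n \<Rightarrow>\<^sub>0 nat. k \<le> pdeg v}" for k by (simp add: upclosed_def pdeg_add)
  have one: "max_id = (mono_ideal {v. 1 \<le> pdeg v} :: ('n, 'k) loc_mpoly set)"
  proof -
    have "{v :: 'n \<Rightarrow>\<^sub>0 nat. v \<noteq> 0} = {v. 1 \<le> pdeg v}" by (auto simp: Suc_le_eq simp flip: pdeg_eq_0_iff)
    thus ?thesis unfolding max_id_eq by simp
  qed
  have sum: "{u + v | u v. u \<in> {v :: 'n \<Rightarrow>\<^sub>0 nat. j \<le> pdeg v} \<and> v \<in> {v. 1 \<le> pdeg v}} = {v. Suc j \<le> pdeg v}" for j
  proof (intro equalityI subsetI)
    fix v :: "'n \<Rightarrow>\<^sub>0 nat" assume "v \<in> {v. Suc j \<le> pdeg v}"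
    hence j: "Suc j \<le> pdeg v" by simp
    then obtain k where k: "pdeg v = Suc k" by (metis Suc_le_D)
    then obtain i w where w: "v = Poly_Mapping.single i 1 + w" "pdeg w = k" by (rule pdeg_Suc_obtain)
    have "v = w + Poly_Mapping.single i 1" using w(1) by (simp add: add.commute)
    moreover have "j \<le> pdeg w" using j k w(2) by simp
    ultimately show "v \<in> {u + v | u v. u \<in> {v. j \<le> pdeg v} \<and> v \<in> {v. 1 \<le> pdeg v}}" by force
  qed (auto simp: pdeg_add)
  show ?thesis
  proof (induction j)
    case 0
    show ?case by (simp add: ideals_set_def carrier_eq_mono_ideal nat_pow_def)
  next
    case (Suc j)
    have "ideal_pow loc_ring max_id (Suc j) =
       ideal_prod loc_ring (ideal_pow loc_ring max_id j) (max_id :: ('n, 'k) loc_mpoly set)"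
      by (simp add: nat_pow_def ideals_set_def)
    also have "\<dots> = mono_ideal {u + v | u v. u \<in> {v. j \<le> pdeg v} \<and> v \<in> {v. 1 \<le> pdeg v}}"
      unfolding Suc unfolding one by (rule ideal_prod_mono_ideal[OF up up])
    finally show ?case unfolding sum .
  qed
qed

text \<open>Powers of the maximal ideal are the monomial ideals of all exponents of large degree, so
  annihilation modulo the ideal is a condition on each exponent of the numerator, namely the one in
  \<open>mem_sat_iff\<close>.\<close>

lemma colon_max_id_iff:
  fixes a s :: "('n::finite, 'k::field) mpoly"
  assumes E: "upclosed E" and s: "lookup s 0 \<noteq> 0"
  shows "(\<exists>j. \<forall>y\<in>ideal_pow loc_ring max_id j. y \<otimes>\<^bsub>loc_ring\<^esub> lfrac a s \<in> mono_ideal E) \<longleftrightarrow> keys a \<subseteq> sat E"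
proof
  assume "\<exists>j. \<forall>y\<in>ideal_pow loc_ring max_id j. y \<otimes>\<^bsub>loc_ring\<^esub> lfrac a s \<in> mono_ideal E"
  then obtain j where j: "\<And>y. y \<in> ideal_pow loc_ring max_id j \<Longrightarrow> y \<otimes>\<^bsub>loc_ring\<^esub> lfrac a s \<in> mono_ideal E" by blast
  show "keys a \<subseteq> sat E"
  proof
    fix v assume v: "v \<in> keys a"
    have "v + w \<in> E" if w: "j \<le> pdeg w" for w
    proof -
      have up: "upclosed {v :: 'n \<Rightarrow>\<^sub>0 nat. j \<le> pdeg v}" by (simp add: upclosed_def pdeg_add)
      have "in_loc (monom_pol w) \<in> (ideal_pow loc_ring max_id j :: ('n, 'k) loc_mpoly set)"
        unfolding max_id_pow in_loc_mem_iff[OF up] using w by (simp add: monom_pol_def)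
      hence "in_loc (monom_pol w) \<otimes>\<^bsub>loc_ring\<^esub> lfrac a s \<in> mono_ideal E" by (rule j)
      hence "keys (monom_pol w * a) \<subseteq> E"
        unfolding in_loc_def using s by (simp add: loc_ring_mult mono_ideal_mem_iff[OF E])
      moreover have "lookup (monom_pol w * a) (w + v) = lookup (monom_pol w :: ('n, 'k) mpoly) w * lookup a v"
        by (rule lookup_mult_unique) (auto simp: monom_pol_def)
      hence "w + v \<in> keys (monom_pol w * a)" using v by (simp add: in_keys_iff monom_pol_def)
      ultimately show ?thesis by (auto simp: add.commute)
    qed
    thus "v \<in> sat E" unfolding mem_sat_iff[OF E] by blast
  qed
next
  assume "keys a \<subseteq> sat E"
  hence "\<forall>v\<in>keys a. \<exists>j. \<forall>w. j \<le> pdeg w \<longrightarrow> v + w \<in> E" using mem_sat_iff[OF E] by blast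
  from bchoice[OF this] obtain f where f: "\<forall>v\<in>keys a. \<forall>w. f v \<le> pdeg w \<longrightarrow> v + w \<in> E" ..
  \<comment> \<open>One power of the maximal ideal for all terms at once; the sum dominates the
    bound of each exponent.\<close>
  define j where "j = (\<Sum>v\<in>keys a. f v)"
  have "y \<otimes>\<^bsub>loc_ring\<^esub> lfrac a s \<in> mono_ideal E" if yj: "y \<in> ideal_pow loc_ring max_id j" for y
  proof -
    obtain b t where y: "y = lfrac b t" "lookup t 0 \<noteq> 0" "keys b \<subseteq> {v. j \<le> pdeg v}"
      using yj unfolding max_id_pow mono_ideal_def by blast
    have "keys (b * a) \<subseteq> E"
    proof
      fix v assume "v \<in> keys (b * a)"
      then obtain p q where pq: "v = p + q" "p \<in> keys b" "q \<in> keys a" using keys_mult[of b a] by blast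
      have "f q \<le> j" unfolding j_def by (rule member_le_sum[OF pq(3)]) simp_all
      hence "f q \<le> pdeg p" using pq(2) y(3) by auto
      hence "q + p \<in> E" using f pq(3) by blast
      thus "v \<in> E" using pq(1) by (simp add: add.commute)
    qed
    thus ?thesis unfolding y(1) using y(2) s by (simp add: loc_ring_mult mono_ideal_mem_iff[OF E] lookup_mult_0)
  qed
  thus "\<exists>j. \<forall>y\<in>ideal_pow loc_ring max_id j. y \<otimes>\<^bsub>loc_ring\<^esub> lfrac a s \<in> mono_ideal E" by blast
qed

text \<open>An element of least degree in \<open>D\<close> is not a proper multiple of anything else
  in \<open>E \<union> D\<close>, so it can be removed without losing upward closedness. Repeating
  this gives a chain that grows by one monomial at a time.\<close>

lemma upclosed_chain:
  fixes E :: "('n::finite \<Rightarrow>\<^sub>0 nat) set"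
  assumes "finite D" "upclosed (E \<union> D)" "upclosed E" "E \<inter> D = {}"
  shows "\<exists>U. (\<forall>i\<le>card D. upclosed (U i) \<and> E \<subseteq> U i \<and> U i \<subseteq> E \<union> D) \<and> (\<forall>i<card D. U i \<subset> U (Suc i))"
  using assms
proof (induction "card D" arbitrary: D)
  case 0
  thus ?case by (intro exI[of _ "\<lambda>_. E"]) simp
next
  case (Suc m)
  hence "D \<noteq> {}" by auto
  then obtain d0 where "d0 \<in> D" by blast
  from ex_has_least_nat[of "\<lambda>v. v \<in> D", OF this, of pdeg]
  obtain d where d: "d \<in> D" "\<And>w. w \<in> D \<Longrightarrow> pdeg d \<le> pdeg w" by blast
  have up: "upclosed (E \<union> (D - {d}))"
    unfolding upclosed_def
  proof (intro ballI allI)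
    fix u w assume u: "u \<in> E \<union> (D - {d})"
    have uw: "u + w \<in> E \<union> D" using u Suc(4) unfolding upclosed_def by blast
    have "u + w \<noteq> d"
    proof
      assume eq: "u + w = d"
      have "u \<notin> E" using eq d(1) Suc(5,6) unfolding upclosed_def by blast
      hence uD: "u \<in> D" "u \<noteq> d" using u by auto
      have "pdeg d = pdeg u + pdeg w" unfolding eq[symmetric] by (rule pdeg_add)
      hence "pdeg w = 0" using d(2)[OF uD(1)] by simp
      thus False using eq uD(2) by simp
    qed
    thus "u + w \<in> E \<union> (D - {d})" using uw by blast
  qed
  have cD: "card (D - {d}) = m" using Suc(2,3) d(1) by simp
  have disj: "E \<inter> (D - {d}) = {}" using Suc(6) by blast
  from Suc(1)[OF cD[symmetric] finite_Diff[OF Suc(3)] up Suc(5) disj, unfolded cD]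
  obtain U where U0: "(\<forall>i\<le>m. upclosed (U i) \<and> E \<subseteq> U i \<and> U i \<subseteq> E \<union> (D - {d})) \<and> (\<forall>i<m. U i \<subset> U (Suc i))" ..
  note U = U0[THEN conjunct1] U0[THEN conjunct2]
  define U' where "U' i = (if i \<le> m then U i else E \<union> D)" for i
  have "upclosed (U' i) \<and> E \<subseteq> U' i \<and> U' i \<subseteq> E \<union> D" for i
    using U(1) Suc(4) unfolding U'_def by auto
  moreover have "U' i \<subset> U' (Suc i)" if "i < Suc m" for i
  proof (cases "i = m")
    case True
    have "U m \<subseteq> E \<union> (D - {d})" using U(1) by blast
    moreover have "d \<notin> E" using d(1) Suc(6) by blast
    ultimately show ?thesis unfolding U'_def True using d(1) by auto
  next
    case False
    thus ?thesis using that U(2) by (simp add: U'_def)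
  qed
  ultimately show ?case unfolding Suc(2)[symmetric] by blast
qed

text \<open>The module consists of the classes of polynomials supported on \<open>D\<close>, up to
  denominators. Monomial submodules from \<open>upclosed_chain\<close> give a chain of length
  \<open>card D\<close>. A longer chain would provide more than \<open>card D\<close> polynomials
  supported on \<open>D\<close>, one new at each step, and a linear relation over the field
  contradicts their novelty.\<close>

lemma module_length_H0:
  fixes E :: "('n::finite \<Rightarrow>\<^sub>0 nat) set"
  assumes E: "upclosed E" and fin: "finite (sat E - E)"
  shows "module_length loc_ring (H0 loc_ring max_id (quot_module loc_ring (mono_ideal E :: ('n, 'k::field) loc_mpoly set)))
    = enat (card (sat E - E))"
proof -
  define R where "R = (loc_ring :: ('n, 'k) loc_mpoly ring)"
  define J where "J = (mono_ideal E :: ('n, 'k) loc_mpoly set)"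
  define D where "D = sat E - E"
  define M where "M = H0 R max_id (quot_module R J)"
  interpret R: cring R unfolding R_def by (rule cring_loc_ring)
  have Jid: "ideal J R" unfolding J_def R_def by (rule ideal_mono_ideal[OF E])
  interpret J: ideal J R by (rule Jid)
  note hom = J.rcos_ring_hom
  have Qgrp: "group (add_monoid (R Quot J))"
    by (rule abelian_group.a_group[OF ring.is_abelian_group[OF J.quotient_is_ring]])
  have ghom: "group_hom (add_monoid R) (add_monoid (R Quot J)) ((+>\<^bsub>R\<^esub>) J)"
    unfolding group_hom_def group_hom_axioms_def hom_def
    using R.a_group Qgrp ring_hom_closed[OF hom] ring_hom_add[OF hom] by simp
  have M_simps: "add M = add (R Quot J)" "zero M = J" "\<And>a U. a \<odot>\<^bsub>M\<^esub> U = (J +>\<^bsub>R\<^esub> a) \<otimes>\<^bsub>R Quot J\<^esub> U"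
    by (simp_all add: M_def H0_def quot_module_def FactRing_def)
  have smult: "a \<odot>\<^bsub>M\<^esub> (J +>\<^bsub>R\<^esub> x) = J +>\<^bsub>R\<^esub> (a \<otimes>\<^bsub>R\<^esub> x)" if "a \<in> carrier R" "x \<in> carrier R" for a x
    unfolding M_simps using ring_hom_mult[OF hom that] by simp
  have carrQ: "carrier (R Quot J) = (+>\<^bsub>R\<^esub>) J ` carrier R"
    by (auto simp: FactRing_def A_RCOSETS_def' )
  have zero_iff: "J +>\<^bsub>R\<^esub> x = J \<longleftrightarrow> x \<in> J" if "x \<in> carrier R" for x
    using ideal_rcos_eq_iff[of J x] Jid that unfolding R_def by blast
  have colon: "(\<exists>j. \<forall>y\<in>ideal_pow R max_id j. y \<odot>\<^bsub>quot_module R J\<^esub> (J +>\<^bsub>R\<^esub> x) = \<zero>\<^bsub>quot_module R J\<^esub>) \<longleftrightarrow> x \<in> mono_ideal (sat E)"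
    if x: "x \<in> carrier R" for x
  proof -
    obtain a s where as: "lookup s 0 \<noteq> 0" "x = lfrac a s" using x unfolding R_def by (elim frac_cases) blast
    have "y \<odot>\<^bsub>quot_module R J\<^esub> (J +>\<^bsub>R\<^esub> x) = \<zero>\<^bsub>quot_module R J\<^esub> \<longleftrightarrow> y \<otimes>\<^bsub>R\<^esub> x \<in> J" if "y \<in> ideal_pow R max_id j" for y j
    proof -
      have y: "y \<in> carrier R" using that mono_ideal_subset_carrier unfolding R_def max_id_pow by blast
      have "y \<odot>\<^bsub>quot_module R J\<^esub> (J +>\<^bsub>R\<^esub> x) = J +>\<^bsub>R\<^esub> (y \<otimes>\<^bsub>R\<^esub> x)"
        using smult[OF y x] unfolding M_def H0_def by simp
      moreover have "\<zero>\<^bsub>quot_module R J\<^esub> = J" by (simp add: quot_module_def FactRing_def)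
      ultimately show ?thesis using zero_iff[of "y \<otimes>\<^bsub>R\<^esub> x"] x y by simp
    qed
    hence "(\<exists>j. \<forall>y\<in>ideal_pow R max_id j. y \<odot>\<^bsub>quot_module R J\<^esub> (J +>\<^bsub>R\<^esub> x) = \<zero>\<^bsub>quot_module R J\<^esub>)
      \<longleftrightarrow> (\<exists>j. \<forall>y\<in>ideal_pow R max_id j. y \<otimes>\<^bsub>R\<^esub> x \<in> J)" by (simp cong: ball_cong)
    also have "\<dots> \<longleftrightarrow> keys a \<subseteq> sat E" unfolding as(2) R_def J_def by (rule colon_max_id_iff[OF E as(1)])
    also have "\<dots> \<longleftrightarrow> x \<in> mono_ideal (sat E)"
      unfolding as(2) by (rule mono_ideal_mem_iff[OF upclosed_sat[OF E] as(1), symmetric])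
    finally show ?thesis .
  qed
  have carrM: "carrier M = (+>\<^bsub>R\<^esub>) J ` mono_ideal (sat E)"
  proof -
    have c0: "carrier (quot_module R J) = (+>\<^bsub>R\<^esub>) J ` carrier R" using carrQ by (simp add: quot_module_def)
    have sub: "mono_ideal (sat E) \<subseteq> carrier R" unfolding R_def by (rule mono_ideal_subset_carrier)
    have mem: "U \<in> carrier M \<longleftrightarrow> U \<in> (+>\<^bsub>R\<^esub>) J ` carrier R \<and> (\<exists>j. \<forall>y\<in>ideal_pow R max_id j. y \<odot>\<^bsub>quot_module R J\<^esub> U = \<zero>\<^bsub>quot_module R J\<^esub>)" for U
      unfolding M_def H0_def c0[symmetric] by simp
    show ?thesis
    proof (intro equalityI subsetI)
      fix U assume U: "U \<in> carrier M"
      obtain x where x: "U = J +>\<^bsub>R\<^esub> x" "x \<in> carrier R" using U[unfolded mem] by (elim conjE imageE)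
      have "x \<in> mono_ideal (sat E)" using U[unfolded mem] unfolding x(1) colon[OF x(2)] by (rule conjunct2)
      thus "U \<in> (+>\<^bsub>R\<^esub>) J ` mono_ideal (sat E)" unfolding x(1) by (rule imageI)
    next
      fix U assume "U \<in> (+>\<^bsub>R\<^esub>) J ` mono_ideal (sat E)"
      then obtain x where x: "U = J +>\<^bsub>R\<^esub> x" "x \<in> mono_ideal (sat E)" by (elim imageE)
      have xc: "x \<in> carrier R" by (rule subsetD[OF sub x(2)])
      show "U \<in> carrier M" unfolding mem x(1) colon[OF xc] by (intro conjI imageI xc x(2))
    qed
  qed
  have upper: "n \<le> card D" if N: "\<forall>i\<le>n. submodule (N i) R M" "\<forall>i<n. N i \<subset> N (Suc i)" for n N
  proof (rule ccontr)
    assume "\<not> n \<le> card D"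
    hence big: "card D < card {..<n}" by simp
    have sg: "subgroup (N i) (add_monoid M)" if "i \<le> n" for i
      using N(1) that by (simp add: submodule_def)
    have Nsub: "N i \<subseteq> carrier M" if "i \<le> n" for i using subgroup.subset[OF sg[OF that]] by simp
    have Nadd: "J +>\<^bsub>R\<^esub> in_loc (p + q) \<in> N i"
      if "i \<le> n" "J +>\<^bsub>R\<^esub> in_loc p \<in> N i" "J +>\<^bsub>R\<^esub> in_loc q \<in> N i" for i and p q :: "('n, 'k) mpoly"
    proof -
      have "(J +>\<^bsub>R\<^esub> in_loc p) \<oplus>\<^bsub>M\<^esub> (J +>\<^bsub>R\<^esub> in_loc q) \<in> N i" using subgroup.m_closed[OF sg[OF that(1)] that(2,3)] by simp
      moreover have "(J +>\<^bsub>R\<^esub> in_loc p) \<oplus>\<^bsub>M\<^esub> (J +>\<^bsub>R\<^esub> in_loc q) = J +>\<^bsub>R\<^esub> in_loc (p + q)"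
        unfolding M_simps in_loc_add R_def[symmetric] by (rule ring_hom_add[OF hom, symmetric]) (simp_all add: R_def)
      ultimately show ?thesis by simp
    qed
    have Nsm: "J +>\<^bsub>R\<^esub> (a \<otimes>\<^bsub>R\<^esub> x) \<in> N i" if "i \<le> n" "a \<in> carrier R" "x \<in> carrier R" "J +>\<^bsub>R\<^esub> x \<in> N i" for i a x
      using submodule.smult_closed[OF N(1)[rule_format, OF that(1)] that(2,4)] smult[OF that(2,3)] by simp
    have Nmul: "J +>\<^bsub>R\<^esub> in_loc (c * p) \<in> N i"
      if "i \<le> n" "J +>\<^bsub>R\<^esub> in_loc p \<in> N i" for i and c p :: "('n, 'k) mpoly"
      using Nsm[OF that(1), of "in_loc c" "in_loc p"] that(2) unfolding in_loc_mult R_def by simp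
    have N0: "J \<in> N i" if "i \<le> n" for i using subgroup.one_closed[OF sg[OF that]] by (simp add: M_simps)
    \<comment> \<open>A class that is new at step i is made a polynomial by multiplying with its
      denominator, a unit, and its terms in \<open>E\<close> are dropped because they lie in
      \<open>J\<close>. Neither change affects membership in the submodules.\<close>
    have "\<exists>p :: ('n, 'k) mpoly. keys p \<subseteq> D \<and> J +>\<^bsub>R\<^esub> in_loc p \<in> N (Suc i) \<and> J +>\<^bsub>R\<^esub> in_loc p \<notin> N i" if i: "i < n" for i
    proof -
      obtain U where U: "U \<in> N (Suc i)" "U \<notin> N i" using N(2) i by blast
      have "U \<in> carrier M" using U(1) Nsub[of "Suc i"] i by auto
      then obtain x where x: "U = J +>\<^bsub>R\<^esub> x" "x \<in> mono_ideal (sat E)" unfolding carrM by blast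
      then obtain a s where as: "x = lfrac a s" "lookup s 0 \<noteq> 0" "keys a \<subseteq> sat E" unfolding mono_ideal_def by blast
      have xc: "x \<in> carrier R" unfolding R_def as(1) using as(2) by simp
      have 1: "J +>\<^bsub>R\<^esub> in_loc a \<in> N (Suc i)"
        using Nsm[of "Suc i" "in_loc s" x] i U(1) x(1) xc in_loc_eq_mult[OF as(2), of a] unfolding as(1) R_def by simp
      have 2: "J +>\<^bsub>R\<^esub> in_loc a \<notin> N i"
      proof
        assume "J +>\<^bsub>R\<^esub> in_loc a \<in> N i"
        hence "J +>\<^bsub>R\<^esub> (lfrac 1 s \<otimes>\<^bsub>R\<^esub> in_loc a) \<in> N i" by (intro Nsm) (use i as(2) in \<open>simp_all add: R_def\<close>)
        thus False using U(2) x(1) as(1) frac_eq_mult[OF as(2), of a] by (simp add: R_def)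
      qed
      define p where "p = (\<Sum>v\<in>keys a - E. Poly_Mapping.single v (lookup a v))"
      define q where "q = (\<Sum>v\<in>keys a \<inter> E. Poly_Mapping.single v (lookup a v))"
      have "a = q + p"
      proof -
        have "a = (\<Sum>v\<in>keys a. Poly_Mapping.single v (lookup a v))"
          by (rule poly_mapping_sum_single[OF finite_keys subset_refl])
        also have "\<dots> = q + p" unfolding p_def q_def
          by (subst sum.union_disjoint[symmetric]) (auto intro: sum.cong)
        finally show ?thesis .
      qed
      have ks: "keys (\<Sum>v\<in>Y. Poly_Mapping.single v (f v)) \<subseteq> Y" if "finite Y" for Y :: "('n \<Rightarrow>\<^sub>0 nat) set" and f :: "_ \<Rightarrow> 'k"
      proof
        fix u assume u: "u \<in> keys (\<Sum>v\<in>Y. Poly_Mapping.single v (f v))"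
        have "lookup (\<Sum>v\<in>Y. Poly_Mapping.single v (f v)) u = (\<Sum>v\<in>Y. if u = v then f v else 0)"
          unfolding lookup_sum by (rule sum.cong) (auto simp: lookup_single when_def)
        thus "u \<in> Y" using u that by (auto simp: in_keys_iff split: if_splits)
      qed
      have kq: "keys q \<subseteq> E" unfolding q_def by (rule subset_trans[OF ks Int_lower2]) simp
      have "keys a - E \<subseteq> D" using as(3) unfolding D_def by (rule Diff_mono) simp
      hence kp: "keys p \<subseteq> D" unfolding p_def by (rule subset_trans[OF ks, rotated]) simp
      have qJ: "in_loc q \<in> J" unfolding J_def in_loc_mem_iff[OF E] by (rule kq)
      have cp: "in_loc q \<in> carrier R" "in_loc p \<in> carrier R" "in_loc a \<in> carrier R" by (simp_all add: R_def)
      have "in_loc a \<ominus>\<^bsub>R\<^esub> in_loc p = in_loc q \<oplus>\<^bsub>R\<^esub> in_loc p \<ominus>\<^bsub>R\<^esub> in_loc p"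
        unfolding \<open>a = q + p\<close> in_loc_add R_def[symmetric] ..
      also have "\<dots> = in_loc q"
        unfolding a_minus_def using cp R.a_assoc[OF cp(1,2) R.a_inv_closed[OF cp(2)]] by (simp add: R.r_neg)
      finally have "in_loc a \<ominus>\<^bsub>R\<^esub> in_loc p \<in> J" using qJ by simp
      hence "J +>\<^bsub>R\<^esub> in_loc a = J +>\<^bsub>R\<^esub> in_loc p" using R.quotient_eq_iff_same_a_r_cos[OF Jid cp(3,2)] by blast
      thus ?thesis using 1 2 kp by (intro exI[of _ p]) simp
    qed
    hence "\<forall>i\<in>{..<n}. \<exists>p :: ('n, 'k) mpoly. keys p \<subseteq> D \<and> J +>\<^bsub>R\<^esub> in_loc p \<in> N (Suc i) \<and> J +>\<^bsub>R\<^esub> in_loc p \<notin> N i" by blast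
    from bchoice[OF this] obtain p :: "nat \<Rightarrow> ('n, 'k) mpoly" where
      p: "\<forall>i\<in>{..<n}. keys (p i) \<subseteq> D \<and> J +>\<^bsub>R\<^esub> in_loc (p i) \<in> N (Suc i) \<and> J +>\<^bsub>R\<^esub> in_loc (p i) \<notin> N i" ..
    have finD: "finite D" using fin by (simp add: D_def)
    obtain c :: "nat \<Rightarrow> 'k" where c: "\<exists>i\<in>{..<n}. c i \<noteq> 0" "\<forall>v\<in>D. (\<Sum>i\<in>{..<n}. c i * lookup (p i) v) = 0"
      using homogeneous_system_solution[OF finD finite_lessThan big, of "\<lambda>i. lookup (p i)"] by blast
    \<comment> \<open>Solving the relation for the last polynomial that occurs expresses it by
      earlier ones, all of which already lie in \<open>N t\<close>.\<close>
    define t where "t = Max {i \<in> {..<n}. c i \<noteq> 0}"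
    have t: "t < n" "c t \<noteq> 0" "\<And>i. i < n \<Longrightarrow> t < i \<Longrightarrow> c i = 0"
    proof -
      obtain i0 where "i0 \<in> {..<n}" "c i0 \<noteq> 0" using c(1) by (rule bexE)
      hence "i0 \<in> {i \<in> {..<n}. c i \<noteq> 0}" by simp
      hence ne: "{i \<in> {..<n}. c i \<noteq> 0} \<noteq> {}" by (metis empty_iff)
      have "t \<in> {i \<in> {..<n}. c i \<noteq> 0}" unfolding t_def by (rule Max_in[OF _ ne]) simp
      thus "t < n" "c t \<noteq> 0" by auto
      fix i assume i: "i < n" "t < i"
      show "c i = 0"
      proof (rule ccontr)
        assume "c i \<noteq> 0"
        hence "i \<le> t" unfolding t_def using i(1) by (intro Max_ge) auto
        thus False using i(2) by simp
      qed
    qed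
    have pt: "p t = (\<Sum>i<t. Poly_Mapping.single 0 (- c i / c t) * p i)"
    proof (rule poly_mapping_eqI)
      fix v
      have rhs: "lookup (\<Sum>i<t. Poly_Mapping.single 0 (- c i / c t) * p i) v = (\<Sum>i<t. - c i / c t * lookup (p i) v)"
        by (simp only: lookup_sum lookup_single_0_mult)
      show "lookup (p t) v = lookup (\<Sum>i<t. Poly_Mapping.single 0 (- c i / c t) * p i) v"
      proof (cases "v \<in> D")
        case True
        have "(\<Sum>i<n. c i * lookup (p i) v) = (\<Sum>i<Suc t. c i * lookup (p i) v)"
          by (rule sum.mono_neutral_right) (use t in auto)
        hence "0 = (\<Sum>i<t. c i * lookup (p i) v) + c t * lookup (p t) v" using c(2) True by simp
        hence "lookup (p t) v = - (\<Sum>i<t. c i * lookup (p i) v) / c t"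
          using t(2) by (simp add: field_simps add_eq_0_iff)
        also have "\<dots> = (\<Sum>i<t. - c i / c t * lookup (p i) v)"
          by (simp add: sum_negf[symmetric] sum_divide_distrib)
        finally show ?thesis unfolding rhs .
      next
        case False
        have z: "lookup (p i) v = 0" if "i < n" for i
        proof -
          have "keys (p i) \<subseteq> D" using p that by simp
          hence "v \<notin> keys (p i)" using False by blast
          thus ?thesis by (simp add: in_keys_iff)
        qed
        have "(\<Sum>i<t. - c i / c t * lookup (p i) v) = 0" by (rule sum.neutral) (use z t(1) in auto)
        thus ?thesis unfolding rhs using z[OF t(1)] by simp
      qed
    qed
    have mono: "N i \<subseteq> N j" if "i \<le> j" "j \<le> n" for i j :: nat
      using that
    proof (induction j rule: dec_induct)
      case (step m)
      thus ?case using N(2)[rule_format, of m] by auto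
    qed simp
    have "J +>\<^bsub>R\<^esub> in_loc (\<Sum>i<m. Poly_Mapping.single 0 (- c i / c t) * p i) \<in> N t" if "m \<le> t" for m
      using that
    proof (induction m)
      case 0
      have "J +>\<^bsub>R\<^esub> in_loc 0 = J" unfolding in_loc_0 R_def[symmetric] by (intro J.a_rcos_const ideal_zero_closed[OF Jid])
      thus ?case using N0 t(1) by simp
    next
      case (Suc m)
      have "J +>\<^bsub>R\<^esub> in_loc (p m) \<in> N t" using p mono[of "Suc m" t] Suc(2) t(1) by auto
      thus ?case using Nadd Nmul Suc t(1) by simp
    qed
    from this[OF order_refl] have "J +>\<^bsub>R\<^esub> in_loc (p t) \<in> N t" unfolding pt[symmetric] .
    thus False using p[rule_format, of t] t(1) by simp
  qed
  have lower: "\<exists>N. (\<forall>i\<le>card D. submodule (N i) R M) \<and> (\<forall>i<card D. N i \<subset> N (Suc i))"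
  proof -
    have ED: "E \<union> D = sat E" using subset_sat[of E] by (auto simp: D_def)
    obtain U where U: "\<forall>i\<le>card D. upclosed (U i) \<and> E \<subseteq> U i \<and> U i \<subseteq> sat E" "\<forall>i<card D. U i \<subset> U (Suc i)"
      using upclosed_chain[of D E] fin upclosed_sat[OF E] E unfolding ED by (auto simp: D_def)
    define N where "N i = (+>\<^bsub>R\<^esub>) J ` mono_ideal (U i)" for i
    have sgU: "subgroup ((+>\<^bsub>R\<^esub>) J ` mono_ideal W) (add_monoid (R Quot J))" if "upclosed W" for W
      by (rule group_hom.subgroup_img_is_subgroup[OF ghom])
         (rule additive_subgroup.a_subgroup[OF ideal.axioms(1)], unfold R_def, rule ideal_mono_ideal[OF that])
    have Qz: "zero (R Quot J) = J" by (simp add: FactRing_def)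
    have "submodule (N i) R M" if "i \<le> card D" for i
    proof -
      have Ui: "upclosed (U i)" "U i \<subseteq> sat E" using U(1) that by auto
      have sub: "N i \<subseteq> carrier M" unfolding N_def carrM
        using mono_ideal_le_iff[OF Ui(1) upclosed_sat[OF E], where 'k = 'k] Ui(2) by blast
      \<comment> \<open>Inverses in \<open>add_monoid M\<close> refer to the smaller carrier of
        \<open>M\<close>, so the subgroup is first restricted to that carrier within the quotient
        ring.\<close>
      have "subgroup (N i) ((add_monoid (R Quot J)) \<lparr>carrier := carrier M\<rparr>)"
        by (rule group.subgroup_incl) (use Qgrp sgU[OF Ui(1)] sgU[OF upclosed_sat[OF E]] sub in \<open>simp_all add: N_def carrM\<close>)
      hence "subgroup (N i) (add_monoid M)"
        by (simp add: subgroup_def m_inv_def M_simps Qz)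
      moreover have "a \<odot>\<^bsub>M\<^esub> x \<in> N i" if ax: "a \<in> carrier R" "x \<in> N i" for a x
      proof -
        note a = ax(1)
        obtain y where y: "x = J +>\<^bsub>R\<^esub> y" "y \<in> mono_ideal (U i)" using ax(2) unfolding N_def by (elim imageE)
        have yc: "y \<in> carrier R" using y(2) mono_ideal_subset_carrier unfolding R_def by blast
        have "a \<otimes>\<^bsub>R\<^esub> y \<in> mono_ideal (U i)"
          unfolding R_def by (rule ideal.I_l_closed[OF ideal_mono_ideal[OF Ui(1)] y(2)]) (use a in \<open>simp add: R_def\<close>)
        thus ?thesis unfolding y(1) smult[OF a yc] N_def by blast
      qed
      ultimately show ?thesis by (simp add: submodule_def submodule_axioms_def)
    qed
    moreover have "N i \<subset> N (Suc i)" if i: "i < card D" for i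
    proof
      have Ui: "upclosed (U i)" "E \<subseteq> U i" "upclosed (U (Suc i))" "U i \<subset> U (Suc i)"
        using U(1)[rule_format, of i] U(1)[rule_format, of "Suc i"] U(2)[rule_format, of i] i by simp_all
      show "N i \<subseteq> N (Suc i)" unfolding N_def
        using mono_ideal_le_iff[OF Ui(1,3), where 'k = 'k] Ui(4) by blast
      obtain v where v: "v \<in> U (Suc i)" "v \<notin> U i" using Ui(4) by blast
      let ?y = "in_loc (monom_pol v) :: ('n, 'k) loc_mpoly"
      have "J +>\<^bsub>R\<^esub> ?y \<in> N (Suc i)"
        unfolding N_def by (rule imageI) (use v(1) in \<open>simp add: in_loc_mem_iff[OF Ui(3)] monom_pol_def\<close>)
      moreover have "J +>\<^bsub>R\<^esub> ?y \<notin> N i"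
      proof
        assume "J +>\<^bsub>R\<^esub> ?y \<in> N i"
        then obtain z where z: "J +>\<^bsub>R\<^esub> ?y = J +>\<^bsub>R\<^esub> z" "z \<in> mono_ideal (U i)" unfolding N_def by blast
        have zc: "z \<in> carrier R" using z(2) mono_ideal_subset_carrier unfolding R_def by blast
        have yc: "?y \<in> carrier R" by (simp add: R_def)
        have "?y \<ominus>\<^bsub>R\<^esub> z \<in> J" using R.quotient_eq_iff_same_a_r_cos[OF Jid yc zc] z(1) by blast
        moreover have "J \<subseteq> mono_ideal (U i)" unfolding J_def using mono_ideal_le_iff[OF E Ui(1), where 'k = 'k] Ui(2) by blast
        ultimately have "(?y \<ominus>\<^bsub>R\<^esub> z) \<oplus>\<^bsub>R\<^esub> z \<in> mono_ideal (U i)"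
          unfolding R_def using z(2) by (intro ideal_a_closed[OF ideal_mono_ideal[OF Ui(1)]]) auto
        moreover have "(?y \<ominus>\<^bsub>R\<^esub> z) \<oplus>\<^bsub>R\<^esub> z = ?y" using yc zc by algebra
        ultimately have "?y \<in> mono_ideal (U i)" by simp
        thus False using v(2) by (simp add: in_loc_mem_iff[OF Ui(1)] monom_pol_def)
      qed
      ultimately show "N i \<noteq> N (Suc i)" by blast
    qed
    ultimately show ?thesis by blast
  qed
  have "module_length R M = enat (card D)"
    unfolding module_length_def
  proof (rule antisym)
    show "Sup {enat n | n. \<exists>N. (\<forall>i\<le>n. submodule (N i) R M) \<and> (\<forall>i<n. N i \<subset> N (Suc i))} \<le> enat (card D)"
      by (rule Sup_least) (use upper in auto)
    show "enat (card D) \<le> Sup {enat n | n. \<exists>N. (\<forall>i\<le>n. submodule (N i) R M) \<and> (\<forall>i<n. N i \<subset> N (Suc i))}"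
      by (rule Sup_upper) (use lower in blast)
  qed
  thus ?thesis by (simp add: R_def M_def J_def D_def)
qed


section \<open>The special fiber ring of a monomial ideal\<close>

text \<open>The exponents of the monomials in the product of the maximal ideal with the n-th power.
  Since \<open>pexps V n\<close> is upward closed, its elements outside this set are the minimal
  ones.\<close>

definition mexps :: "('n \<Rightarrow>\<^sub>0 nat) set \<Rightarrow> nat \<Rightarrow> ('n \<Rightarrow>\<^sub>0 nat) set" where
  "mexps V n = {u + v | u v. u \<in> {v. v \<noteq> 0} \<and> v \<in> pexps V n}"

definition fib_ideal :: "('n \<Rightarrow>\<^sub>0 nat) set \<Rightarrow> nat \<Rightarrow> ('n::finite, 'k::field) loc_mpoly set" where
  "fib_ideal V n = mono_ideal (mexps V n)"

text \<open>The Rees algebra over the polynomial ring, without denominators. It still maps onto the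
  fiber ring (\<open>carrier_fib\<close>), because a denominator acts there as a constant.\<close>

definition rees :: "('n::finite \<Rightarrow>\<^sub>0 nat) set \<Rightarrow> ('n, 'k::field) mpoly poly set" where
  "rees V = {p. \<forall>n. keys (Polynomial.coeff p n) \<subseteq> pexps V n}"

definition hfib :: "('n::finite \<Rightarrow>\<^sub>0 nat) set \<Rightarrow> ('n, 'k::field) mpoly poly \<Rightarrow> nat \<Rightarrow> ('n, 'k) loc_mpoly set" where
  "hfib V p n = fib_ideal V n +>\<^bsub>loc_ring\<^esub> in_loc (Polynomial.coeff p n)"

abbreviation fib :: "('n::finite \<Rightarrow>\<^sub>0 nat) set \<Rightarrow> (nat \<Rightarrow> ('n, 'k::field) loc_mpoly set) ring" where
  "fib V \<equiv> fiber_ring loc_ring max_id (mono_ideal (upc V))"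

lemma upclosed_nonzero: "upclosed {v :: 'n::finite \<Rightarrow>\<^sub>0 nat. v \<noteq> 0}"
proof -
  have "u + w \<noteq> 0" if "u \<noteq> 0" for u w :: "'n \<Rightarrow>\<^sub>0 nat"
  proof
    assume "u + w = 0"
    hence "pdeg (u + w) = 0" by simp
    thus False using that by (simp add: pdeg_add)
  qed
  thus ?thesis unfolding upclosed_def by blast
qed

lemma upclosed_mexps [simp]: "upclosed (mexps V n :: ('n::finite \<Rightarrow>\<^sub>0 nat) set)"
  unfolding mexps_def by (rule upclosed_sum[OF upclosed_nonzero])

lemma mexps_subset: "mexps V n \<subseteq> pexps V n"
proof
  fix x assume "x \<in> mexps V n"
  then obtain u v where "x = v + u" "v \<in> pexps V n" unfolding mexps_def by (auto simp: add.commute)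
  thus "x \<in> pexps V n" using upclosed_pexps[of V n] unfolding upclosed_def by blast
qed

lemma mexps_add:
  assumes "u \<in> mexps V i" "v \<in> pexps V j"
  shows "u + v \<in> mexps V (i + j)"
proof -
  obtain a b where ab: "u = a + b" "a \<noteq> 0" "b \<in> pexps V i" using assms(1) unfolding mexps_def by blast
  have "b + v \<in> pexps V (i + j)" using ab(3) assms(2) by (rule pexps_add_mem)
  moreover have "u + v = a + (b + v)" using ab(1) by (simp add: add.assoc)
  ultimately show ?thesis using ab(2) unfolding mexps_def by blast
qed

lemma fiber_ideal_eq:
  "ideal_prod loc_ring max_id (ideal_pow loc_ring (mono_ideal (upc V)) n) = (fib_ideal V n :: ('n::finite, 'k::field) loc_mpoly set)"
  unfolding max_id_eq ideal_pow_mono_ideal fib_ideal_def mexps_def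
  by (rule ideal_prod_mono_ideal[OF upclosed_nonzero upclosed_pexps])

lemma ideal_fib_ideal: "ideal (fib_ideal V n :: ('n::finite, 'k::field) loc_mpoly set) loc_ring"
  unfolding fib_ideal_def by (rule ideal_mono_ideal) simp

lemma fib_simps:
  "carrier (fib V :: (nat \<Rightarrow> ('n::finite, 'k::field) loc_mpoly set) ring) =
     {f. (\<forall>n. f n \<in> (\<lambda>a. fib_ideal V n +>\<^bsub>loc_ring\<^esub> a) ` mono_ideal (pexps V n)) \<and> finite {n. f n \<noteq> fib_ideal V n}}"
  "mult (fib V :: (nat \<Rightarrow> ('n, 'k) loc_mpoly set) ring) = (\<lambda>f g n. finsum (loc_ring Quot (fib_ideal V n))
     (\<lambda>i. rcoset_mult loc_ring (fib_ideal V n) (f i) (g (n - i))) {..n})"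
  "one (fib V :: (nat \<Rightarrow> ('n, 'k) loc_mpoly set) ring) = (\<lambda>n. if n = 0 then fib_ideal V n +>\<^bsub>loc_ring\<^esub> \<one>\<^bsub>loc_ring\<^esub> else fib_ideal V n)"
  "zero (fib V :: (nat \<Rightarrow> ('n, 'k) loc_mpoly set) ring) = fib_ideal V"
  "add (fib V :: (nat \<Rightarrow> ('n, 'k) loc_mpoly set) ring) = (\<lambda>f g n. f n <+>\<^bsub>loc_ring\<^esub> g n)"
  unfolding fiber_ring_def Let_def fiber_ideal_eq unfolding ideal_pow_mono_ideal by simp_all

lemma rees_coeff: "p \<in> rees V \<Longrightarrow> keys (Polynomial.coeff p n) \<subseteq> pexps V n"
  unfolding rees_def by blast

lemma rees_add: "p \<in> rees V \<Longrightarrow> q \<in> rees V \<Longrightarrow> p + q \<in> rees V"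
  by (simp add: rees_def) (meson Un_least keys_add order_trans)

lemma keys_coeff_mult:
  assumes "v \<in> keys (Polynomial.coeff (p * q) n)"
  obtains i a b where "i \<le> n" "a \<in> keys (Polynomial.coeff p i)" "b \<in> keys (Polynomial.coeff q (n - i))" "v = a + b"
proof -
  have "(\<Sum>i\<le>n. lookup (Polynomial.coeff p i * Polynomial.coeff q (n - i)) v) \<noteq> 0"
    using assms by (simp add: coeff_mult in_keys_iff lookup_sum)
  then obtain i where i: "i \<in> {..n}" "lookup (Polynomial.coeff p i * Polynomial.coeff q (n - i)) v \<noteq> 0"
    by (rule sum.not_neutral_contains_not_neutral)
  hence "v \<in> keys (Polynomial.coeff p i * Polynomial.coeff q (n - i))" by (simp add: in_keys_iff)
  then obtain a b where "v = a + b" "a \<in> keys (Polynomial.coeff p i)" "b \<in> keys (Polynomial.coeff q (n - i))"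
    using keys_mult by blast
  thus ?thesis using that i(1) by blast
qed

lemma rees_mult:
  assumes "p \<in> rees V" "q \<in> rees V"
  shows "p * q \<in> rees V"
proof -
  have "keys (Polynomial.coeff (p * q) n) \<subseteq> pexps V n" for n
  proof
    fix v assume "v \<in> keys (Polynomial.coeff (p * q) n)"
    then obtain i a b where ab: "i \<le> n" "v = a + b" "a \<in> keys (Polynomial.coeff p i)" "b \<in> keys (Polynomial.coeff q (n - i))"
      using keys_coeff_mult by blast
    have "a + b \<in> pexps V (i + (n - i))"
      using rees_coeff[OF assms(1)] rees_coeff[OF assms(2)] ab by (intro pexps_add_mem) blast+
    thus "v \<in> pexps V n" using ab(1,2) by simp
  qed
  thus ?thesis unfolding rees_def by blast
qed

lemma rees_const [simp]: "[:a:] \<in> rees V"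
  unfolding rees_def by (auto simp: coeff_pCons split: nat.split)

lemma rees_0 [simp]: "0 \<in> rees V" and rees_1 [simp]: "1 \<in> rees V"
  using rees_const[of 0] rees_const[of 1] by (simp_all add: one_pCons)

lemma rees_uminus: "p \<in> rees V \<Longrightarrow> - p \<in> rees V"
  using rees_mult[of "[:-1:]" V p] by simp

lemma rees_power: "p \<in> rees V \<Longrightarrow> p ^ n \<in> rees V"
  by (induction n) (simp_all add: rees_mult)

lemma rees_prod: "(\<And>i. i \<in> A \<Longrightarrow> f i \<in> rees V) \<Longrightarrow> prod f A \<in> rees V"
  by (induction A rule: infinite_finite_induct) (simp_all add: rees_mult)

lemma rees_sum: "(\<And>i. i \<in> A \<Longrightarrow> f i \<in> rees V) \<Longrightarrow> sum f A \<in> rees V"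
  by (induction A rule: infinite_finite_induct) (simp_all add: rees_add)

lemma rees_monom: "v \<in> pexps V n \<Longrightarrow> Polynomial.monom (Poly_Mapping.single v c) n \<in> rees V"
  unfolding rees_def by (auto split: if_splits)

section \<open>The fiber ring as an image of the Rees algebra\<close>

lemma hfib_add:
  fixes p q :: "('n::finite, 'k::field) mpoly poly"
  shows "hfib V p \<oplus>\<^bsub>fib V\<^esub> hfib V q = hfib V (p + q)"
proof
  fix n
  interpret J: ideal "fib_ideal V n :: ('n, 'k) loc_mpoly set" loc_ring by (rule ideal_fib_ideal)
  have "(hfib V p \<oplus>\<^bsub>fib V\<^esub> hfib V q) n = hfib V p n <+>\<^bsub>loc_ring\<^esub> hfib V q n"
    by (simp only: fib_simps)
  also have "\<dots> = hfib V (p + q) n"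
    unfolding hfib_def in_loc_add coeff_add by (rule J.a_rcos_sum) simp_all
  finally show "(hfib V p \<oplus>\<^bsub>fib V\<^esub> hfib V q) n = hfib V (p + q) n" .
qed

lemma rcos_in_loc_0:
  fixes I :: "('n::finite, 'k::field) loc_mpoly set"
  assumes "ideal I loc_ring"
  shows "I +>\<^bsub>loc_ring\<^esub> in_loc 0 = I"
  using ideal_zero_closed[OF assms] ideal_rcos_eq_iff[OF assms in_loc_carrier, of 0] by (simp add: in_loc_0)

lemma hfib_0: "hfib V (0 :: ('n::finite, 'k::field) mpoly poly) = \<zero>\<^bsub>fib V\<^esub>"
proof
  fix n
  show "hfib V (0 :: ('n, 'k) mpoly poly) n = \<zero>\<^bsub>fib V\<^esub> n"
    unfolding fib_simps hfib_def by (simp add: rcos_in_loc_0[OF ideal_fib_ideal])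
qed

lemma hfib_1: "hfib V (1 :: ('n::finite, 'k::field) mpoly poly) = \<one>\<^bsub>fib V\<^esub>"
proof
  fix n
  have "fib_ideal V m +>\<^bsub>loc_ring\<^esub> in_loc 0 = (fib_ideal V m :: ('n, 'k) loc_mpoly set)" for m
    by (rule rcos_in_loc_0[OF ideal_fib_ideal])
  thus "hfib V (1 :: ('n, 'k) mpoly poly) n = \<one>\<^bsub>fib V\<^esub> n"
    unfolding fib_simps hfib_def by (simp add: in_loc_1 coeff_pCons one_pCons split: nat.split)
qed

lemma rcos_eqI:
  fixes I :: "('n::finite, 'k::field) loc_mpoly set"
  assumes "ideal I loc_ring" "x \<ominus>\<^bsub>loc_ring\<^esub> y \<in> I" "x \<in> carrier loc_ring" "y \<in> carrier loc_ring"
  shows "I +>\<^bsub>loc_ring\<^esub> x = I +>\<^bsub>loc_ring\<^esub> y"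
proof -
  interpret R: cring "loc_ring :: ('n, 'k) loc_mpoly ring" by (rule cring_loc_ring)
  show ?thesis using R.quotient_eq_iff_same_a_r_cos[OF assms(1,3,4)] assms(2) by simp
qed

lemma mono_ideal_mult_mem:
  fixes x y :: "('n::finite, 'k::field) loc_mpoly"
  assumes "x \<in> mono_ideal E" "y \<in> mono_ideal E'" "\<And>u v. u \<in> E \<Longrightarrow> v \<in> E' \<Longrightarrow> u + v \<in> E''" "upclosed E''"
  shows "x \<otimes>\<^bsub>loc_ring\<^esub> y \<in> mono_ideal E''"
proof -
  obtain a s where a: "x = lfrac a s" "lookup s 0 \<noteq> 0" "keys a \<subseteq> E" using assms(1) unfolding mono_ideal_def by blast
  obtain b t where b: "y = lfrac b t" "lookup t 0 \<noteq> 0" "keys b \<subseteq> E'" using assms(2) unfolding mono_ideal_def by blast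
  have "keys (a * b) \<subseteq> E''"
  proof
    fix v assume "v \<in> keys (a * b)"
    then obtain p q where "v = p + q" "p \<in> keys a" "q \<in> keys b" using keys_mult by blast
    thus "v \<in> E''" using assms(3)[of p q] a(3) b(3) by blast
  qed
  thus ?thesis unfolding a(1) b(1) using a(2) b(2) by (simp add: loc_ring_mult mono_ideal_mem_iff[OF assms(4)] lookup_mult_0)
qed

text \<open>Changing the representatives by \<open>j1\<close> and \<open>j2\<close> changes the
  product by \<open>j1 \<otimes> b\<close> and \<open>x \<otimes> j2\<close>, and both lie in the
  maximal ideal times the power in degree \<open>i + j\<close>.\<close>

lemma rcoset_mult_fib:
  fixes x y :: "('n::finite, 'k::field) loc_mpoly"
  assumes x: "x \<in> mono_ideal (pexps V i)" and y: "y \<in> mono_ideal (pexps V j)"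
  shows "rcoset_mult loc_ring (fib_ideal V (i + j)) (fib_ideal V i +>\<^bsub>loc_ring\<^esub> x) (fib_ideal V j +>\<^bsub>loc_ring\<^esub> y)
    = fib_ideal V (i + j) +>\<^bsub>loc_ring\<^esub> (x \<otimes>\<^bsub>loc_ring\<^esub> y)"
proof -
  define R where "R = (loc_ring :: ('n, 'k) loc_mpoly ring)"
  define J where "J n = (fib_ideal V n :: ('n, 'k) loc_mpoly set)" for n
  interpret R: cring R unfolding R_def by (rule cring_loc_ring)
  have Jid: "ideal (J n) R" for n unfolding J_def R_def by (rule ideal_fib_ideal)
  have Jc: "J n \<subseteq> carrier R" for n unfolding J_def R_def fib_ideal_def by (rule mono_ideal_subset_carrier)
  have xc: "x \<in> carrier R" "y \<in> carrier R" using x y mono_ideal_subset_carrier unfolding R_def by blast+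
  have cos: "J n +>\<^bsub>R\<^esub> z = {j \<oplus>\<^bsub>R\<^esub> z | j. j \<in> J n}" for n z by (auto simp: a_r_coset_def')
  have ne: "J n +>\<^bsub>R\<^esub> z \<noteq> {}" for n z unfolding cos using ideal_zero_closed[OF Jid] by blast
  have "rcoset_mult R (J (i + j)) (J i +>\<^bsub>R\<^esub> x) (J j +>\<^bsub>R\<^esub> y) = J (i + j) +>\<^bsub>R\<^esub> (x \<otimes>\<^bsub>R\<^esub> y)"
    unfolding rcoset_mult_def
  proof (rule UN_const[OF ne], rule UN_const[OF ne])
    fix a b assume "a \<in> J i +>\<^bsub>R\<^esub> x" "b \<in> J j +>\<^bsub>R\<^esub> y"
    then obtain j1 j2 where ab: "a = j1 \<oplus>\<^bsub>R\<^esub> x" "j1 \<in> J i" "b = j2 \<oplus>\<^bsub>R\<^esub> y" "j2 \<in> J j" unfolding cos by blast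
    have jc: "j1 \<in> carrier R" "j2 \<in> carrier R" using ab Jc by blast+
    have bI: "b \<in> mono_ideal (pexps V j)"
    proof -
      have "j2 \<in> mono_ideal (pexps V j)" using ab(4) mono_ideal_le_iff[OF upclosed_mexps upclosed_pexps, of V j V j, where 'k = 'k] mexps_subset
        unfolding J_def fib_ideal_def by blast
      thus ?thesis unfolding ab(3) R_def by (rule ideal_a_closed[OF ideal_mono_ideal[OF upclosed_pexps] _ y])
    qed
    have t1: "j1 \<otimes>\<^bsub>R\<^esub> b \<in> J (i + j)"
      unfolding R_def J_def fib_ideal_def
      by (rule mono_ideal_mult_mem[OF ab(2)[unfolded J_def fib_ideal_def] bI mexps_add upclosed_mexps])
    have t2: "x \<otimes>\<^bsub>R\<^esub> j2 \<in> J (i + j)"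
      unfolding R_def J_def fib_ideal_def
    proof (rule mono_ideal_mult_mem[OF x ab(4)[unfolded J_def fib_ideal_def] _ upclosed_mexps])
      fix u v assume "u \<in> pexps V i" "v \<in> mexps V j"
      from mexps_add[OF this(2,1)] show "u + v \<in> mexps V (i + j)" by (simp add: add.commute)
    qed
    have "a \<otimes>\<^bsub>R\<^esub> b = (j1 \<otimes>\<^bsub>R\<^esub> b \<oplus>\<^bsub>R\<^esub> x \<otimes>\<^bsub>R\<^esub> j2) \<oplus>\<^bsub>R\<^esub> x \<otimes>\<^bsub>R\<^esub> y"
      unfolding ab using jc xc by (simp add: R.l_distr R.r_distr R.a_ac)
    hence "a \<otimes>\<^bsub>R\<^esub> b \<ominus>\<^bsub>R\<^esub> x \<otimes>\<^bsub>R\<^esub> y = (j1 \<otimes>\<^bsub>R\<^esub> b \<oplus>\<^bsub>R\<^esub> x \<otimes>\<^bsub>R\<^esub> j2) \<oplus>\<^bsub>R\<^esub> (x \<otimes>\<^bsub>R\<^esub> y \<oplus>\<^bsub>R\<^esub> \<ominus>\<^bsub>R\<^esub> (x \<otimes>\<^bsub>R\<^esub> y))"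
      unfolding a_minus_def using jc xc ab(3) by (simp add: R.a_assoc)
    also have "\<dots> = j1 \<otimes>\<^bsub>R\<^esub> b \<oplus>\<^bsub>R\<^esub> x \<otimes>\<^bsub>R\<^esub> j2" using jc xc ab(3) by (simp add: R.r_neg)
    also have "\<dots> \<in> J (i + j)" by (rule ideal_a_closed[OF Jid t1 t2])
    finally have "a \<otimes>\<^bsub>R\<^esub> b \<ominus>\<^bsub>R\<^esub> x \<otimes>\<^bsub>R\<^esub> y \<in> J (i + j)" .
    moreover have "a \<otimes>\<^bsub>R\<^esub> b \<in> carrier R" "x \<otimes>\<^bsub>R\<^esub> y \<in> carrier R" using ab jc xc by simp_all
    ultimately show "J (i + j) +>\<^bsub>R\<^esub> (a \<otimes>\<^bsub>R\<^esub> b) = J (i + j) +>\<^bsub>R\<^esub> (x \<otimes>\<^bsub>R\<^esub> y)"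
      unfolding R_def by (intro rcos_eqI Jid[unfolded R_def])
  qed
  thus ?thesis unfolding R_def J_def .
qed

lemma hfib_mult:
  fixes p q :: "('n::finite, 'k::field) mpoly poly"
  assumes "p \<in> rees V" "q \<in> rees V"
  shows "hfib V p \<otimes>\<^bsub>fib V\<^esub> hfib V q = hfib V (p * q)"
proof
  fix n
  define J where "J = (fib_ideal V n :: ('n, 'k) loc_mpoly set)"
  have Jid: "ideal J loc_ring" unfolding J_def by (rule ideal_fib_ideal)
  interpret J: ideal J loc_ring by (rule Jid)
  note hom = J.rcos_ring_hom
  have Qab: "abelian_monoid (loc_ring Quot J)"
    by (rule abelian_group.axioms(1)[OF ring.is_abelian_group[OF J.quotient_is_ring]])
  define g where "g i = Polynomial.coeff p i * Polynomial.coeff q (n - i)" for i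
  have fs: "finsum (loc_ring Quot J) (\<lambda>i. J +>\<^bsub>loc_ring\<^esub> in_loc (g i)) A = J +>\<^bsub>loc_ring\<^esub> in_loc (sum g A)" if "finite A" for A
    using that
  proof (induction A rule: finite_induct)
    case empty
    have "\<zero>\<^bsub>loc_ring Quot J\<^esub> = J" by (simp add: FactRing_def)
    thus ?case using ideal_rcos_eq_iff[OF Jid, of "in_loc 0"] ideal_zero_closed[OF Jid]
      by (simp add: abelian_monoid.finsum_empty[OF Qab] in_loc_0)
  next
    case (insert i A)
    have "finsum (loc_ring Quot J) (\<lambda>i. J +>\<^bsub>loc_ring\<^esub> in_loc (g i)) (insert i A) =
      (J +>\<^bsub>loc_ring\<^esub> in_loc (g i)) \<oplus>\<^bsub>loc_ring Quot J\<^esub> finsum (loc_ring Quot J) (\<lambda>i. J +>\<^bsub>loc_ring\<^esub> in_loc (g i)) A"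
      by (rule abelian_monoid.finsum_insert[OF Qab insert(1,2)]) (auto intro!: ring_hom_closed[OF hom])
    also have "\<dots> = J +>\<^bsub>loc_ring\<^esub> (in_loc (g i) \<oplus>\<^bsub>loc_ring\<^esub> in_loc (sum g A))"
      unfolding insert(3) by (rule ring_hom_add[OF hom, symmetric]) simp_all
    finally show ?case using insert by (simp add: in_loc_add)
  qed
  have "(hfib V p \<otimes>\<^bsub>fib V\<^esub> hfib V q) n = finsum (loc_ring Quot J) (\<lambda>i. rcoset_mult loc_ring J (hfib V p i) (hfib V q (n - i))) {..n}"
    by (simp only: fib_simps J_def)
  also have "\<dots> = finsum (loc_ring Quot J) (\<lambda>i. J +>\<^bsub>loc_ring\<^esub> in_loc (g i)) {..n}"
  proof (rule abelian_monoid.finsum_cong'[OF Qab refl])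
    show "(\<lambda>i. J +>\<^bsub>loc_ring\<^esub> in_loc (g i)) \<in> {..n} \<rightarrow> carrier (loc_ring Quot J)" by (auto intro!: ring_hom_closed[OF hom])
    fix i assume i: "i \<in> {..n}"
    have "rcoset_mult loc_ring (fib_ideal V (i + (n - i))) (hfib V p i) (hfib V q (n - i)) = fib_ideal V (i + (n - i)) +>\<^bsub>loc_ring\<^esub> in_loc (g i)"
      unfolding hfib_def g_def in_loc_mult
      by (rule rcoset_mult_fib) (simp_all add: in_loc_mem_iff rees_coeff assms)
    thus "rcoset_mult loc_ring J (hfib V p i) (hfib V q (n - i)) = J +>\<^bsub>loc_ring\<^esub> in_loc (g i)"
      using i by (simp add: J_def)
  qed
  also have "\<dots> = J +>\<^bsub>loc_ring\<^esub> in_loc (Polynomial.coeff (p * q) n)"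
    unfolding fs[OF finite_atMost] by (simp add: g_def coeff_mult)
  finally show "(hfib V p \<otimes>\<^bsub>fib V\<^esub> hfib V q) n = hfib V (p * q) n" by (simp add: hfib_def J_def)
qed

lemma hfib_eq_iff:
  fixes p q :: "('n::finite, 'k::field) mpoly poly"
  shows "hfib V p = hfib V q \<longleftrightarrow> (\<forall>n. keys (Polynomial.coeff p n - Polynomial.coeff q n) \<subseteq> mexps V n)"
proof -
  interpret R: cring "loc_ring :: ('n, 'k) loc_mpoly ring" by (rule cring_loc_ring)
  have "hfib V p n = hfib V q n \<longleftrightarrow> keys (Polynomial.coeff p n - Polynomial.coeff q n) \<subseteq> mexps V n" for n
  proof -
    let ?a = "Polynomial.coeff p n" and ?b = "Polynomial.coeff q n"
    have "in_loc ?a = in_loc (?a - ?b) \<oplus>\<^bsub>loc_ring\<^esub> in_loc ?b" by (simp add: in_loc_add[symmetric])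
    hence "in_loc ?a \<ominus>\<^bsub>loc_ring\<^esub> in_loc ?b = in_loc (?a - ?b) \<oplus>\<^bsub>loc_ring\<^esub> (in_loc ?b \<oplus>\<^bsub>loc_ring\<^esub> \<ominus>\<^bsub>loc_ring\<^esub> in_loc ?b)"
      unfolding a_minus_def by (simp add: R.a_assoc)
    hence "in_loc ?a \<ominus>\<^bsub>loc_ring\<^esub> in_loc ?b = in_loc (?a - ?b)" by (simp add: R.r_neg)
    hence "hfib V p n = hfib V q n \<longleftrightarrow> in_loc (?a - ?b) \<in> fib_ideal V n"
      unfolding hfib_def using R.quotient_eq_iff_same_a_r_cos[OF ideal_fib_ideal in_loc_carrier in_loc_carrier] by metis
    thus ?thesis unfolding fib_ideal_def in_loc_mem_iff[OF upclosed_mexps] .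
  qed
  thus ?thesis by (simp add: fun_eq_iff)
qed

text \<open>With \<open>c\<close> the inverse of the constant term of \<open>s\<close>, the
  polynomial \<open>1 - c * s\<close> has no constant term. Hence the fraction differs from
  \<open>c * a\<close> by an element of the maximal ideal times the power.\<close>

lemma fib_coset_polynomial:
  fixes x :: "('n::finite, 'k::field) loc_mpoly"
  assumes "x \<in> mono_ideal (pexps V n)"
  shows "\<exists>a. keys a \<subseteq> pexps V n \<and> fib_ideal V n +>\<^bsub>loc_ring\<^esub> x = fib_ideal V n +>\<^bsub>loc_ring\<^esub> in_loc a"
proof -
  interpret R: cring "loc_ring :: ('n, 'k) loc_mpoly ring" by (rule cring_loc_ring)
  obtain a s where as: "x = lfrac a s" "lookup s 0 \<noteq> 0" "keys a \<subseteq> pexps V n" using assms unfolding mono_ideal_def by blast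
  define c :: "('n, 'k) mpoly" where "c = Poly_Mapping.single 0 (1 / lookup s 0)"
  have keys_ca: "keys (c * a) \<subseteq> pexps V n" by (rule keys_mult_upclosed[OF upclosed_pexps as(3)])
  let ?z = "lfrac ((1 - c * s) * a) s"
  have "keys ((1 - c * s) * a) \<subseteq> mexps V n"
  proof
    fix v assume "v \<in> keys ((1 - c * s) * a)"
    then obtain p q where pq: "v = p + q" "p \<in> keys (1 - c * s)" "q \<in> keys a" using keys_mult by blast
    have "lookup (1 - c * s) 0 = 0" using as(2) by (simp add: lookup_minus c_def lookup_single_0_mult)
    hence "p \<noteq> 0" using pq(2) by (auto simp: in_keys_iff)
    thus "v \<in> mexps V n" unfolding mexps_def using pq(1,3) as(3) by blast
  qed
  hence z: "?z \<in> fib_ideal V n" unfolding fib_ideal_def mono_ideal_mem_iff[OF upclosed_mexps as(2)] .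
  have zc: "?z \<in> carrier loc_ring" using as(2) by simp
  have "x = ?z \<oplus>\<^bsub>loc_ring\<^esub> in_loc (c * a)"
    unfolding as(1) in_loc_def using as(2) by (simp add: loc_ring_add frac_eq_iff algebra_simps)
  hence "x \<ominus>\<^bsub>loc_ring\<^esub> in_loc (c * a) = ?z \<oplus>\<^bsub>loc_ring\<^esub> (in_loc (c * a) \<oplus>\<^bsub>loc_ring\<^esub> \<ominus>\<^bsub>loc_ring\<^esub> in_loc (c * a))"
    unfolding a_minus_def using zc by (simp add: R.a_assoc)
  hence "x \<ominus>\<^bsub>loc_ring\<^esub> in_loc (c * a) = ?z" using zc by (simp add: R.r_neg)
  hence "x \<ominus>\<^bsub>loc_ring\<^esub> in_loc (c * a) \<in> fib_ideal V n" using z by simp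
  moreover have "x \<in> carrier loc_ring" using assms mono_ideal_subset_carrier by blast
  ultimately have "fib_ideal V n +>\<^bsub>loc_ring\<^esub> x = fib_ideal V n +>\<^bsub>loc_ring\<^esub> in_loc (c * a)"
    by (intro rcos_eqI ideal_fib_ideal in_loc_carrier)
  thus ?thesis using keys_ca by blast
qed

lemma carrier_fib: "carrier (fib V) = hfib V ` (rees V :: ('n::finite, 'k::field) mpoly poly set)"
proof (intro equalityI subsetI)
  fix f assume "f \<in> carrier (fib V :: (nat \<Rightarrow> ('n, 'k) loc_mpoly set) ring)"
  hence f: "\<And>n. f n \<in> (\<lambda>a. fib_ideal V n +>\<^bsub>loc_ring\<^esub> a) ` mono_ideal (pexps V n)" "finite {n. f n \<noteq> fib_ideal V n}"
    unfolding fib_simps by simp_all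
  have z: "fib_ideal V n +>\<^bsub>loc_ring\<^esub> in_loc 0 = (fib_ideal V n :: ('n, 'k) loc_mpoly set)" for n
    by (rule rcos_in_loc_0[OF ideal_fib_ideal])
  have "\<exists>a :: ('n, 'k) mpoly. keys a \<subseteq> pexps V n \<and> f n = fib_ideal V n +>\<^bsub>loc_ring\<^esub> in_loc a" for n
  proof -
    obtain x where "f n = fib_ideal V n +>\<^bsub>loc_ring\<^esub> x" "x \<in> mono_ideal (pexps V n)" using f(1)[of n] by (elim imageE)
    from fib_coset_polynomial[OF this(2)] obtain a :: "('n, 'k) mpoly"
      where "keys a \<subseteq> pexps V n" "fib_ideal V n +>\<^bsub>loc_ring\<^esub> x = fib_ideal V n +>\<^bsub>loc_ring\<^esub> in_loc a" by (elim exE conjE)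
    thus ?thesis using \<open>f n = _\<close> by (intro exI[of _ a]) simp
  qed
  hence "\<forall>n. \<exists>a :: ('n, 'k) mpoly. keys a \<subseteq> pexps V n \<and> f n = fib_ideal V n +>\<^bsub>loc_ring\<^esub> in_loc a" ..
  from choice[OF this] obtain a :: "nat \<Rightarrow> ('n, 'k) mpoly"
    where a: "\<forall>n. keys (a n) \<subseteq> pexps V n \<and> f n = fib_ideal V n +>\<^bsub>loc_ring\<^esub> in_loc (a n)" ..
  define p where "p = (\<Sum>n\<in>{n. f n \<noteq> fib_ideal V n}. Polynomial.monom (a n) n)"
  have cp: "Polynomial.coeff p n = (if f n \<noteq> fib_ideal V n then a n else 0)" for n
  proof -
    have "Polynomial.coeff p n = (\<Sum>m\<in>{n. f n \<noteq> fib_ideal V n}. if m = n then a m else 0)"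
      by (simp add: p_def Polynomial.coeff_sum)
    thus ?thesis using f(2) by simp
  qed
  have "p \<in> rees V" unfolding rees_def using cp a by simp
  moreover have "hfib V p = f"
  proof
    fix n show "hfib V p n = f n" unfolding hfib_def cp using a z by simp
  qed
  ultimately show "f \<in> hfib V ` (rees V :: ('n, 'k) mpoly poly set)" by blast
next
  fix f assume "f \<in> hfib V ` (rees V :: ('n, 'k) mpoly poly set)"
  then obtain p :: "('n, 'k) mpoly poly" where p: "f = hfib V p" "p \<in> rees V" by blast
  have "f n \<in> (\<lambda>a. fib_ideal V n +>\<^bsub>loc_ring\<^esub> a) ` mono_ideal (pexps V n)" for n
    unfolding p(1) hfib_def by (rule imageI) (simp add: in_loc_mem_iff rees_coeff[OF p(2)])
  moreover have "{n. f n \<noteq> fib_ideal V n} \<subseteq> {..Polynomial.degree p}"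
  proof
    fix n assume n: "n \<in> {n. f n \<noteq> fib_ideal V n}"
    show "n \<in> {..Polynomial.degree p}"
    proof (rule ccontr)
      assume "n \<notin> {..Polynomial.degree p}"
      hence "Polynomial.coeff p n = 0" by (simp add: coeff_eq_0)
      hence "f n = hfib V 0 n" unfolding p(1) hfib_def by simp
      moreover have "hfib V 0 n = (fib_ideal V n :: ('n, 'k) loc_mpoly set)"
        unfolding hfib_def coeff_0 by (rule rcos_in_loc_0[OF ideal_fib_ideal])
      ultimately show False using n by simp
    qed
  qed
  hence "finite {n. f n \<noteq> fib_ideal V n}" by (rule finite_subset) simp
  ultimately show "f \<in> carrier (fib V)" unfolding fib_simps by simp
qed

text \<open>\<open>hfib\<close> is onto and respects the operations on \<open>rees V\<close>, so
  every axiom is inherited from polynomials and no coset needs to be handled.\<close>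

lemma cring_fib: "cring (fib V :: (nat \<Rightarrow> ('n::finite, 'k::field) loc_mpoly set) ring)"
proof -
  let ?F = "fib V :: (nat \<Rightarrow> ('n, 'k) loc_mpoly set) ring"
  have cE: "\<exists>p\<in>rees V. x = hfib V p" if "x \<in> carrier ?F" for x using that unfolding carrier_fib by blast
  have cI: "hfib V p \<in> carrier ?F" if "p \<in> rees V" for p using that unfolding carrier_fib by blast
  show ?thesis
  proof (rule cringI)
    show "abelian_group ?F"
    proof (rule abelian_groupI)
      fix x y z assume "x \<in> carrier ?F" "y \<in> carrier ?F" "z \<in> carrier ?F"
      then obtain p q r where "p \<in> rees V" "x = hfib V p" "q \<in> rees V" "y = hfib V q" "r \<in> rees V" "z = hfib V r" using cE by metis
      thus "x \<oplus>\<^bsub>?F\<^esub> y \<oplus>\<^bsub>?F\<^esub> z = x \<oplus>\<^bsub>?F\<^esub> (y \<oplus>\<^bsub>?F\<^esub> z)" by (simp add: hfib_add rees_add add.assoc)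
    next
      fix x y assume "x \<in> carrier ?F" "y \<in> carrier ?F"
      then obtain p q where *: "p \<in> rees V" "x = hfib V p" "q \<in> rees V" "y = hfib V q" using cE by metis
      show "x \<oplus>\<^bsub>?F\<^esub> y \<in> carrier ?F" using * by (simp add: hfib_add cI rees_add)
      show "x \<oplus>\<^bsub>?F\<^esub> y = y \<oplus>\<^bsub>?F\<^esub> x" using * by (simp add: hfib_add add.commute)
    next
      fix x assume "x \<in> carrier ?F"
      then obtain p where *: "p \<in> rees V" "x = hfib V p" using cE by metis
      show "\<zero>\<^bsub>?F\<^esub> \<oplus>\<^bsub>?F\<^esub> x = x" using * by (simp add: hfib_add hfib_0[symmetric])
      have "hfib V (- p) \<oplus>\<^bsub>?F\<^esub> x = \<zero>\<^bsub>?F\<^esub>" using * by (simp add: hfib_add hfib_0[symmetric])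
      thus "\<exists>y\<in>carrier ?F. y \<oplus>\<^bsub>?F\<^esub> x = \<zero>\<^bsub>?F\<^esub>" using cI[OF rees_uminus[OF *(1)]] by blast
    next
      show "\<zero>\<^bsub>?F\<^esub> \<in> carrier ?F" using cI[OF rees_0] by (simp add: hfib_0)
    qed
    show "comm_monoid ?F"
    proof (rule comm_monoidI)
      fix x y z assume "x \<in> carrier ?F" "y \<in> carrier ?F" "z \<in> carrier ?F"
      then obtain p q r where "p \<in> rees V" "x = hfib V p" "q \<in> rees V" "y = hfib V q" "r \<in> rees V" "z = hfib V r" using cE by metis
      thus "x \<otimes>\<^bsub>?F\<^esub> y \<otimes>\<^bsub>?F\<^esub> z = x \<otimes>\<^bsub>?F\<^esub> (y \<otimes>\<^bsub>?F\<^esub> z)" by (simp add: hfib_mult rees_mult mult.assoc)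
    next
      fix x y assume "x \<in> carrier ?F" "y \<in> carrier ?F"
      then obtain p q where *: "p \<in> rees V" "x = hfib V p" "q \<in> rees V" "y = hfib V q" using cE by metis
      show "x \<otimes>\<^bsub>?F\<^esub> y \<in> carrier ?F" using * by (simp add: hfib_mult cI rees_mult)
      show "x \<otimes>\<^bsub>?F\<^esub> y = y \<otimes>\<^bsub>?F\<^esub> x" using * by (simp add: hfib_mult mult.commute)
    next
      fix x assume "x \<in> carrier ?F"
      then obtain p where *: "p \<in> rees V" "x = hfib V p" using cE by metis
      show "\<one>\<^bsub>?F\<^esub> \<otimes>\<^bsub>?F\<^esub> x = x" using * by (simp add: hfib_mult hfib_1[symmetric])
    next
      show "\<one>\<^bsub>?F\<^esub> \<in> carrier ?F" using cI[OF rees_1] by (simp add: hfib_1)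
    qed
    fix x y z assume "x \<in> carrier ?F" "y \<in> carrier ?F" "z \<in> carrier ?F"
    then obtain p q r where "p \<in> rees V" "x = hfib V p" "q \<in> rees V" "y = hfib V q" "r \<in> rees V" "z = hfib V r" using cE by metis
    thus "(x \<oplus>\<^bsub>?F\<^esub> y) \<otimes>\<^bsub>?F\<^esub> z = x \<otimes>\<^bsub>?F\<^esub> z \<oplus>\<^bsub>?F\<^esub> y \<otimes>\<^bsub>?F\<^esub> z"
      by (simp add: hfib_mult hfib_add rees_add rees_mult distrib_right)
  qed
qed


section \<open>Primes of the fiber ring attached to faces of the exponent monoid\<close>

definition fib_face :: "('n::finite \<Rightarrow>\<^sub>0 nat) set \<Rightarrow> (nat \<Rightarrow> ('n \<Rightarrow>\<^sub>0 nat) set) \<Rightarrow> bool" where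
  "fib_face V Q \<longleftrightarrow> 0 \<in> Q 0 \<and> (\<forall>n. Q n \<subseteq> pexps V n - mexps V n) \<and>
     (\<forall>n m. \<forall>v\<in>pexps V n. \<forall>w\<in>pexps V m. v + w \<in> Q (n + m) \<longleftrightarrow> v \<in> Q n \<and> w \<in> Q m)"

text \<open>In \<open>fib_face\<close> a sum lies in \<open>Q\<close> exactly when both summands do,
  which makes the exponents off \<open>Q\<close> a graded prime. Since \<open>Q\<close> avoids
  \<open>mexps\<close>, the kernel of \<open>hfib\<close> lies off \<open>Q\<close> and the
  condition descends to the fiber ring.\<close>

definition face_prime :: "('n::finite \<Rightarrow>\<^sub>0 nat) set \<Rightarrow> (nat \<Rightarrow> ('n \<Rightarrow>\<^sub>0 nat) set) \<Rightarrow> (nat \<Rightarrow> ('n, 'k::field) loc_mpoly set) set" where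
  "face_prime V Q = hfib V ` {p \<in> rees V. \<forall>n. keys (Polynomial.coeff p n) \<inter> Q n = {}}"

lemma face_prime_mem_iff:
  fixes p :: "('n::finite, 'k::field) mpoly poly"
  assumes Q: "fib_face V Q" and p: "p \<in> rees V"
  shows "hfib V p \<in> face_prime V Q \<longleftrightarrow> (\<forall>n. keys (Polynomial.coeff p n) \<inter> Q n = {})"
proof
  assume "hfib V p \<in> face_prime V Q"
  then obtain q :: "('n, 'k) mpoly poly" where q: "hfib V p = hfib V q" "\<forall>n. keys (Polynomial.coeff q n) \<inter> Q n = {}"
    unfolding face_prime_def by blast
  show "\<forall>n. keys (Polynomial.coeff p n) \<inter> Q n = {}"
  proof (rule allI, rule ccontr)
    fix n assume "keys (Polynomial.coeff p n) \<inter> Q n \<noteq> {}"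
    then obtain v where v: "v \<in> keys (Polynomial.coeff p n)" "v \<in> Q n" by blast
    have "v \<notin> mexps V n" using v(2) Q unfolding fib_face_def by blast
    hence "v \<notin> keys (Polynomial.coeff p n - Polynomial.coeff q n)" using q(1) unfolding hfib_eq_iff by blast
    hence "v \<in> keys (Polynomial.coeff q n)" using v(1) by (simp add: in_keys_iff lookup_minus)
    thus False using v(2) q(2) by blast
  qed
next
  assume "\<forall>n. keys (Polynomial.coeff p n) \<inter> Q n = {}"
  thus "hfib V p \<in> face_prime V Q" unfolding face_prime_def using p by blast
qed

lemma ex_max_nat:
  fixes f :: "'a \<Rightarrow> nat"
  assumes "finite S" "S \<noteq> {}"
  shows "\<exists>u\<in>S. \<forall>u'\<in>S. f u' \<le> f u"
proof -
  have "Max (f ` S) \<in> f ` S" using assms by simp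
  then obtain u where u: "u \<in> S" "Max (f ` S) = f u" by (elim imageE)
  have "f u' \<le> f u" if "u' \<in> S" for u' unfolding u(2)[symmetric] using that assms by simp
  thus ?thesis using u(1) by (intro bexI ballI)
qed

text \<open>A leading-term argument restricted to \<open>Q\<close>: first the highest degree in
  which each factor meets \<open>Q\<close>, then the heaviest exponent there. The face property
  forces any other decomposition of the resulting exponent to consist of exponents in
  \<open>Q\<close>, so the two maximality choices exclude it.\<close>

lemma fib_face_hit_mult:
  fixes p q :: "('n::finite, 'k::field) mpoly poly"
  assumes Q: "fib_face V Q" and p: "p \<in> rees V" and q: "q \<in> rees V"
    and hp: "\<exists>n. keys (Polynomial.coeff p n) \<inter> Q n \<noteq> {}" and hq: "\<exists>n. keys (Polynomial.coeff q n) \<inter> Q n \<noteq> {}"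
  shows "\<exists>n. keys (Polynomial.coeff (p * q) n) \<inter> Q n \<noteq> {}"
proof -
  have top: "\<exists>N. keys (Polynomial.coeff r N) \<inter> Q N \<noteq> {} \<and> (\<forall>n. keys (Polynomial.coeff r n) \<inter> Q n \<noteq> {} \<longrightarrow> n \<le> N)"
    if hit: "\<exists>n. keys (Polynomial.coeff r n) \<inter> Q n \<noteq> {}" for r :: "('n, 'k) mpoly poly"
  proof -
    have bnd: "\<forall>n. keys (Polynomial.coeff r n) \<inter> Q n \<noteq> {} \<longrightarrow> n < Suc (Polynomial.degree r)"
      using coeff_eq_0[of r] by (metis Int_empty_left keys_zero not_le less_Suc_eq_le)
    obtain n0 where n0: "keys (Polynomial.coeff r n0) \<inter> Q n0 \<noteq> {}" using hit ..
    show ?thesis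
      by (rule ex_has_greatest_nat[of "\<lambda>n. keys (Polynomial.coeff r n) \<inter> Q n \<noteq> {}" n0 "\<lambda>n. n" "Suc (Polynomial.degree r)", OF n0 bnd])
  qed
  obtain N where "keys (Polynomial.coeff p N) \<inter> Q N \<noteq> {} \<and> (\<forall>n. keys (Polynomial.coeff p n) \<inter> Q n \<noteq> {} \<longrightarrow> n \<le> N)"
    using top[OF hp] ..
  hence N: "keys (Polynomial.coeff p N) \<inter> Q N \<noteq> {}" "\<And>n. keys (Polynomial.coeff p n) \<inter> Q n \<noteq> {} \<Longrightarrow> n \<le> N"
    by simp_all
  obtain M where "keys (Polynomial.coeff q M) \<inter> Q M \<noteq> {} \<and> (\<forall>n. keys (Polynomial.coeff q n) \<inter> Q n \<noteq> {} \<longrightarrow> n \<le> M)"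
    using top[OF hq] ..
  hence M: "keys (Polynomial.coeff q M) \<inter> Q M \<noteq> {}" "\<And>n. keys (Polynomial.coeff q n) \<inter> Q n \<noteq> {} \<Longrightarrow> n \<le> M"
    by simp_all
  define A where "A = keys (Polynomial.coeff p N) \<inter> Q N"
  define B where "B = keys (Polynomial.coeff q M) \<inter> Q M"
  have fin: "finite A" "finite B" unfolding A_def B_def by simp_all
  have "\<exists>wt :: ('n \<Rightarrow>\<^sub>0 nat) \<Rightarrow> nat. (\<forall>u v. wt (u + v) = wt u + wt v) \<and> inj_on wt (A \<union> B)"
    by (rule ex_separating_weight[OF finite_UnI[OF fin]]) (intro exI conjI allI; assumption)
  then obtain wt :: "('n \<Rightarrow>\<^sub>0 nat) \<Rightarrow> nat" where "(\<forall>u v. wt (u + v) = wt u + wt v) \<and> inj_on wt (A \<union> B)" ..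
  hence wt: "\<And>u v. wt (u + v) = wt u + wt v" "inj_on wt (A \<union> B)" by simp_all
  have "A \<noteq> {}" "B \<noteq> {}" using N(1) M(1) unfolding A_def B_def by simp_all
  obtain u where u: "u \<in> A" "\<And>u'. u' \<in> A \<Longrightarrow> wt u' \<le> wt u"
    using ex_max_nat[OF fin(1) \<open>A \<noteq> {}\<close>, of wt] by (elim bexE) simp
  obtain v where v: "v \<in> B" "\<And>u'. u' \<in> B \<Longrightarrow> wt u' \<le> wt v"
    using ex_max_nat[OF fin(2) \<open>B \<noteq> {}\<close>, of wt] by (elim bexE) simp
  have Qadd: "v + w \<in> Q (n + m) \<longleftrightarrow> v \<in> Q n \<and> w \<in> Q m" if "v \<in> pexps V n" "w \<in> pexps V m" for v w n m
    using Q that unfolding fib_face_def by blast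
  have up: "u \<in> pexps V N" "v \<in> pexps V M" using u(1) v(1) rees_coeff[OF p] rees_coeff[OF q] unfolding A_def B_def by blast+
  have uvQ: "u + v \<in> Q (N + M)" using Qadd[OF up] u(1) v(1) unfolding A_def B_def by blast
  have split: "i = N \<and> a \<in> A \<and> b \<in> B"
    if i: "i \<le> N + M" and a: "a \<in> keys (Polynomial.coeff p i)" and b: "b \<in> keys (Polynomial.coeff q (N + M - i))" and ab: "a + b = u + v" for i a b
  proof -
    have "a \<in> pexps V i" "b \<in> pexps V (N + M - i)" using a b rees_coeff[OF p] rees_coeff[OF q] by blast+
    moreover have "a + b \<in> Q (i + (N + M - i))" using uvQ i unfolding ab by simp
    ultimately have Qa: "a \<in> Q i" "b \<in> Q (N + M - i)" using Qadd by blast+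
    have "i \<le> N" using N(2)[of i] a Qa(1) by blast
    moreover have "N + M - i \<le> M" using M(2)[of "N + M - i"] b Qa(2) by blast
    ultimately have iN: "i = N" using i by linarith
    show ?thesis using iN a b Qa unfolding A_def B_def by simp
  qed
  have "lookup (Polynomial.coeff (p * q) (N + M)) (u + v) = (\<Sum>i\<le>N + M. lookup (Polynomial.coeff p i * Polynomial.coeff q (N + M - i)) (u + v))"
    by (simp add: coeff_mult lookup_sum)
  also have "\<dots> = (\<Sum>i\<in>{N}. lookup (Polynomial.coeff p i * Polynomial.coeff q (N + M - i)) (u + v))"
  proof (rule sum.mono_neutral_right)
    show "\<forall>i\<in>{..N + M} - {N}. lookup (Polynomial.coeff p i * Polynomial.coeff q (N + M - i)) (u + v) = 0"
    proof (rule ballI, rule ccontr)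
      fix i assume i: "i \<in> {..N + M} - {N}" and "lookup (Polynomial.coeff p i * Polynomial.coeff q (N + M - i)) (u + v) \<noteq> 0"
      hence "u + v \<in> keys (Polynomial.coeff p i * Polynomial.coeff q (N + M - i))" by (simp add: in_keys_iff)
      then obtain a b where "u + v = a + b" "a \<in> keys (Polynomial.coeff p i)" "b \<in> keys (Polynomial.coeff q (N + M - i))"
        using keys_mult by blast
      thus False using split[of i a b] i by simp
    qed
  qed auto
  also have "\<dots> = lookup (Polynomial.coeff p N * Polynomial.coeff q M) (u + v)" by simp
  also have "\<dots> = lookup (Polynomial.coeff p N) u * lookup (Polynomial.coeff q M) v"
  proof (rule lookup_mult_unique)
    fix u' v' assume "u' \<in> keys (Polynomial.coeff p N)" "v' \<in> keys (Polynomial.coeff q M)" and eq: "u' + v' = u + v"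
    hence uv': "u' \<in> A" "v' \<in> B" using split[of N u' v'] by simp_all
    have "wt u' + wt v' = wt u + wt v" using eq wt(1) by metis
    hence "wt u' = wt u" "wt v' = wt v" using u(2)[OF uv'(1)] v(2)[OF uv'(2)] by linarith+
    thus "u' = u \<and> v' = v" using wt(2) uv' u(1) v(1) by (meson UnI1 UnI2 inj_onD)
  qed
  also have "\<dots> \<noteq> 0" using u(1) v(1) unfolding A_def B_def by (simp add: in_keys_iff)
  finally have "u + v \<in> keys (Polynomial.coeff (p * q) (N + M))" by (simp add: in_keys_iff)
  thus ?thesis using uvQ by blast
qed

lemma primeideal_face_prime:
  assumes Q: "fib_face V Q"
  shows "primeideal (face_prime V Q :: (nat \<Rightarrow> ('n::finite, 'k::field) loc_mpoly set) set) (fib V)"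
proof -
  let ?F = "fib V :: (nat \<Rightarrow> ('n, 'k) loc_mpoly set) ring"
  let ?P = "face_prime V Q :: (nat \<Rightarrow> ('n, 'k) loc_mpoly set) set"
  interpret F: cring ?F by (rule cring_fib)
  have cE: "\<exists>p\<in>rees V. x = hfib V p" if "x \<in> carrier ?F" for x using that unfolding carrier_fib by blast
  have cI: "hfib V p \<in> carrier ?F" if "p \<in> rees V" for p using that unfolding carrier_fib by blast
  have PE: "\<exists>p. p \<in> rees V \<and> x = hfib V p \<and> (\<forall>n. keys (Polynomial.coeff p n) \<inter> Q n = {})" if "x \<in> ?P" for x
    using that unfolding face_prime_def by blast
  have Qadd: "v + w \<in> Q (n + m) \<longleftrightarrow> v \<in> Q n \<and> w \<in> Q m" if "v \<in> pexps V n" "w \<in> pexps V m" for v w n m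
    using Q that unfolding fib_face_def by blast
  note iff = face_prime_mem_iff[OF Q]
  have sub: "?P \<subseteq> carrier ?F" unfolding face_prime_def carrier_fib by blast
  have mult: "x \<otimes>\<^bsub>?F\<^esub> a \<in> ?P" if ax: "a \<in> ?P" "x \<in> carrier ?F" for a x
  proof -
    obtain p where p: "p \<in> rees V" "a = hfib V p" "\<forall>n. keys (Polynomial.coeff p n) \<inter> Q n = {}" using PE[OF ax(1)] by blast
    obtain q where q: "q \<in> rees V" "x = hfib V q" using cE[OF ax(2)] by blast
    have "keys (Polynomial.coeff (q * p) n) \<inter> Q n = {}" for n
    proof (rule ccontr)
      assume "keys (Polynomial.coeff (q * p) n) \<inter> Q n \<noteq> {}"
      then obtain v where v: "v \<in> keys (Polynomial.coeff (q * p) n)" "v \<in> Q n" by blast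
      obtain i a b where iab: "i \<le> n" "a \<in> keys (Polynomial.coeff q i)" "b \<in> keys (Polynomial.coeff p (n - i))" "v = a + b"
        using keys_coeff_mult[OF v(1)] by blast
      have "a \<in> pexps V i" "b \<in> pexps V (n - i)" using iab(2,3) rees_coeff[OF q(1)] rees_coeff[OF p(1)] by blast+
      moreover have "a + b \<in> Q (i + (n - i))" using v(2) iab(1,4) by simp
      ultimately have "b \<in> Q (n - i)" using Qadd by blast
      thus False using iab(3) p(3) by blast
    qed
    thus ?thesis unfolding p q using iff[OF rees_mult[OF q(1) p(1)]] p q by (simp add: hfib_mult)
  qed
  have "subgroup ?P (add_monoid ?F)"
  proof (rule F.add.subgroupI[OF sub])
    have "hfib V 0 \<in> ?P" using iff[OF rees_0] by simp
    thus "?P \<noteq> {}" by blast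
  next
    fix a assume a: "a \<in> ?P"
    have "(\<ominus>\<^bsub>?F\<^esub> \<one>\<^bsub>?F\<^esub>) \<otimes>\<^bsub>?F\<^esub> a \<in> ?P" by (rule mult[OF a]) simp
    thus "\<ominus>\<^bsub>?F\<^esub> a \<in> ?P" using subsetD[OF sub a] by (simp add: F.l_minus)
  next
    fix a b assume "a \<in> ?P" "b \<in> ?P"
    then obtain p q where p: "p \<in> rees V" "a = hfib V p" "\<forall>n. keys (Polynomial.coeff p n) \<inter> Q n = {}"
      and q: "q \<in> rees V" "b = hfib V q" "\<forall>n. keys (Polynomial.coeff q n) \<inter> Q n = {}" using PE by metis
    have "keys (Polynomial.coeff (p + q) n) \<inter> Q n = {}" for n
      using keys_add[of "Polynomial.coeff p n" "Polynomial.coeff q n"] p(3)[rule_format, of n] q(3)[rule_format, of n]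
      unfolding coeff_add by blast
    thus "a \<oplus>\<^bsub>?F\<^esub> b \<in> ?P" unfolding p q hfib_add using iff[OF rees_add[OF p(1) q(1)]] by simp
  qed
  hence "ideal ?P ?F"
  proof (rule idealI[OF F.ring_axioms])
    fix a x assume ax: "a \<in> ?P" "x \<in> carrier ?F"
    show "x \<otimes>\<^bsub>?F\<^esub> a \<in> ?P" by (rule mult[OF ax])
    thus "a \<otimes>\<^bsub>?F\<^esub> x \<in> ?P" using F.m_comm[OF ax(2) subsetD[OF sub ax(1)]] by simp
  qed
  thus ?thesis
  proof (rule primeidealI[OF _ F.is_cring])
    have "hfib V 1 \<notin> ?P"
    proof
      assume "hfib V (1 :: ('n, 'k) mpoly poly) \<in> ?P"
      hence "keys (Polynomial.coeff (1 :: ('n, 'k) mpoly poly) 0) \<inter> Q 0 = {}" using iff[OF rees_1] by blast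
      thus False using Q unfolding fib_face_def by simp
    qed
    thus "carrier ?F \<noteq> ?P" using cI[OF rees_1] by blast
  next
    fix a b assume a: "a \<in> carrier ?F" and b: "b \<in> carrier ?F" and ab: "a \<otimes>\<^bsub>?F\<^esub> b \<in> ?P"
    obtain p q where p: "p \<in> rees V" "a = hfib V p" and q: "q \<in> rees V" "b = hfib V q" using cE a b by metis
    have "\<forall>n. keys (Polynomial.coeff (p * q) n) \<inter> Q n = {}"
      using ab iff[OF rees_mult[OF p(1) q(1)]] unfolding p(2) q(2) hfib_mult[OF p(1) q(1)] by blast
    hence "(\<forall>n. keys (Polynomial.coeff p n) \<inter> Q n = {}) \<or> (\<forall>n. keys (Polynomial.coeff q n) \<inter> Q n = {})"
      using fib_face_hit_mult[OF Q p(1) q(1)] by blast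
    thus "a \<in> ?P \<or> b \<in> ?P" unfolding p(2) q(2) using iff[OF p(1)] iff[OF q(1)] by blast
  qed
qed

text \<open>Passing to a smaller face enlarges the prime; the monomial at an exponent lost from the
  face shows that the inclusion is strict.\<close>

lemma face_prime_psubset:
  fixes V :: "('n::finite \<Rightarrow>\<^sub>0 nat) set"
  assumes Q: "fib_face V Q" "fib_face V Q'" "\<And>n. Q' n \<subseteq> Q n" and v: "v \<in> Q n" "v \<notin> Q' n"
  shows "(face_prime V Q :: (nat \<Rightarrow> ('n, 'k::field) loc_mpoly set) set) \<subset> face_prime V Q'"
proof (rule psubsetI)
  show "(face_prime V Q :: (nat \<Rightarrow> ('n, 'k) loc_mpoly set) set) \<subseteq> face_prime V Q'"
    unfolding face_prime_def using Q(3) by (intro image_mono) blast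
  let ?p = "Polynomial.monom (Poly_Mapping.single v 1) n :: ('n, 'k) mpoly poly"
  have "v \<in> pexps V n" using Q(1) v(1) unfolding fib_face_def by blast
  hence p: "?p \<in> rees V" by (rule rees_monom)
  have "keys (Polynomial.coeff ?p n) \<inter> Q n \<noteq> {}" using v(1) by simp
  hence "hfib V ?p \<notin> face_prime V Q" using face_prime_mem_iff[OF Q(1) p] by blast
  moreover have "keys (Polynomial.coeff ?p m) \<inter> Q' m = {}" for m using v(2) by (cases "n = m") simp_all
  hence "hfib V ?p \<in> face_prime V Q'" using face_prime_mem_iff[OF Q(2) p] by blast
  ultimately show "(face_prime V Q :: (nat \<Rightarrow> ('n, 'k) loc_mpoly set) set) \<noteq> face_prime V Q'" by blast
qed


section \<open>Upper bound for the dimension of the fiber ring\<close>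

definition rees_prime :: "('n::finite \<Rightarrow>\<^sub>0 nat) set \<Rightarrow> ('n, 'k::field) mpoly poly set \<Rightarrow> bool" where
  "rees_prime V T \<longleftrightarrow> T \<subseteq> rees V \<and> (\<forall>p\<in>rees V. (\<forall>n. keys (Polynomial.coeff p n) \<subseteq> mexps V n) \<longrightarrow> p \<in> T) \<and>
     (\<forall>p\<in>T. \<forall>q\<in>T. p + q \<in> T) \<and> (\<forall>p\<in>rees V. \<forall>q\<in>T. p * q \<in> T) \<and>
     (\<forall>p\<in>rees V. \<forall>q\<in>rees V. p * q \<in> T \<longrightarrow> p \<in> T \<or> q \<in> T) \<and> 1 \<notin> T"

text \<open>Pulling a prime back along \<open>hfib\<close> allows the whole argument to run with
  polynomials; the only trace of the fiber ring is that the polynomials with exponents in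
  \<open>mexps\<close> belong to the prime.\<close>

lemma rees_prime_primeideal:
  fixes P :: "(nat \<Rightarrow> ('n::finite, 'k::field) loc_mpoly set) set"
  assumes P: "primeideal P (fib V)"
  shows "rees_prime V {p \<in> rees V. hfib V p \<in> P}"
proof -
  have cI: "hfib V p \<in> carrier (fib V)" if "p \<in> rees V" for p :: "('n, 'k) mpoly poly" using that unfolding carrier_fib by blast
  have idl: "ideal P (fib V)" using P by (rule primeideal.axioms(1))
  have add: "x \<oplus>\<^bsub>fib V\<^esub> y \<in> P" if "x \<in> P" "y \<in> P" for x y
    using additive_subgroup.a_closed[OF ideal.axioms(1)[OF idl] that] .
  have zero: "\<zero>\<^bsub>fib V\<^esub> \<in> P" using additive_subgroup.zero_closed[OF ideal.axioms(1)[OF idl]] .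
  have mult: "x \<otimes>\<^bsub>fib V\<^esub> y \<in> P" if "x \<in> carrier (fib V)" "y \<in> P" for x y
    using ideal.I_l_closed[OF idl that(2,1)] .
  have prime: "x \<in> P \<or> y \<in> P" if "x \<in> carrier (fib V)" "y \<in> carrier (fib V)" "x \<otimes>\<^bsub>fib V\<^esub> y \<in> P" for x y
    using primeideal.I_prime[OF P that] .
  have one: "\<one>\<^bsub>fib V\<^esub> \<notin> P"
  proof
    assume "\<one>\<^bsub>fib V\<^esub> \<in> P"
    from ideal.one_imp_carrier[OF idl this] show False using primeideal.I_notcarr[OF P] by simp
  qed
  have z: "hfib V p \<in> P" if "\<forall>n. keys (Polynomial.coeff p n) \<subseteq> mexps V n" for p :: "('n, 'k) mpoly poly"
  proof -
    have "hfib V p = hfib V 0" unfolding hfib_eq_iff using that by simp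
    thus ?thesis using zero by (simp add: hfib_0)
  qed
  show ?thesis
    unfolding rees_prime_def
  proof (intro conjI ballI impI)
    fix p q :: "('n, 'k) mpoly poly"
    show "{p \<in> rees V. hfib V p \<in> P} \<subseteq> rees V" by blast
    show "p \<in> {p \<in> rees V. hfib V p \<in> P}" if "p \<in> rees V" "\<forall>n. keys (Polynomial.coeff p n) \<subseteq> mexps V n"
      using that z by simp
    show "p + q \<in> {p \<in> rees V. hfib V p \<in> P}" if "p \<in> {p \<in> rees V. hfib V p \<in> P}" "q \<in> {p \<in> rees V. hfib V p \<in> P}"
      using that add[of "hfib V p" "hfib V q"] by (simp add: rees_add hfib_add)
    show "p * q \<in> {p \<in> rees V. hfib V p \<in> P}" if "p \<in> rees V" "q \<in> {p \<in> rees V. hfib V p \<in> P}"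
      using that mult[of "hfib V p" "hfib V q"] cI by (simp add: rees_mult hfib_mult)
    show "p \<in> {p \<in> rees V. hfib V p \<in> P} \<or> q \<in> {p \<in> rees V. hfib V p \<in> P}"
      if "p \<in> rees V" "q \<in> rees V" "p * q \<in> {p \<in> rees V. hfib V p \<in> P}"
      using that prime[of "hfib V p" "hfib V q"] cI by (simp add: hfib_mult)
    show "(1 :: ('n, 'k) mpoly poly) \<notin> {p \<in> rees V. hfib V p \<in> P}" using one by (simp add: hfib_1)
  qed
qed

lemma rees_primeD:
  assumes "rees_prime V T"
  shows rees_prime_subset: "p \<in> T \<Longrightarrow> p \<in> rees V"
    and rees_prime_mexps: "p \<in> rees V \<Longrightarrow> (\<And>n. keys (Polynomial.coeff p n) \<subseteq> mexps V n) \<Longrightarrow> p \<in> T"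
    and rees_prime_add: "p \<in> T \<Longrightarrow> q \<in> T \<Longrightarrow> p + q \<in> T"
    and rees_prime_mult: "p \<in> rees V \<Longrightarrow> q \<in> T \<Longrightarrow> p * q \<in> T"
    and rees_prime_disj: "p \<in> rees V \<Longrightarrow> q \<in> rees V \<Longrightarrow> p * q \<in> T \<Longrightarrow> p \<in> T \<or> q \<in> T"
    and rees_prime_one: "1 \<notin> T"
  using assms by (auto simp only: rees_prime_def)

lemma rees_prime_power:
  assumes "rees_prime V T" "p \<in> rees V" "p ^ n \<in> T"
  shows "p \<in> T"
  using assms(3)
proof (induction n)
  case 0
  thus ?case using rees_prime_one[OF assms(1)] by simp
next
  case (Suc n)
  hence "p \<in> T \<or> p ^ n \<in> T" using rees_prime_disj[OF assms(1,2) rees_power[OF assms(2)]] by simp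
  thus ?case using Suc.IH by blast
qed

text \<open>Factor out the lowest power of \<open>x j\<close> occurring: since \<open>x j\<close> is not in \<open>T j\<close> but lies in
  \<open>T (Suc j)\<close>, a relation modulo \<open>T j\<close> yields one modulo \<open>T (Suc j)\<close> among the remaining factors.\<close>

lemma rees_prime_chain_independent:
  fixes x :: "nat \<Rightarrow> ('n::finite, 'k::field) mpoly poly" and c :: "(nat \<Rightarrow> nat) \<Rightarrow> 'k"
  assumes T: "\<And>i. i \<le> m \<Longrightarrow> rees_prime V (T i)" "\<And>i. i < m \<Longrightarrow> T i \<subseteq> T (Suc i)"
    and x: "\<And>i. i < m \<Longrightarrow> x i \<in> T (Suc i)" "\<And>i. i < m \<Longrightarrow> x i \<notin> T i"
    and j: "j \<le> m"
    and Y: "finite Y" "Y \<noteq> {}" "inj_on (\<lambda>a. restrict a {j..<m}) Y" "\<And>a. a \<in> Y \<Longrightarrow> c a \<noteq> 0"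
  shows "(\<Sum>a\<in>Y. [:Poly_Mapping.single 0 (c a):] * (\<Prod>i=j..<m. x i ^ a i)) \<notin> T j"
  using j Y
proof (induction "m - j" arbitrary: j Y)
  case 0
  hence jm: "j = m" by simp
  obtain a where a: "a \<in> Y" using 0 by blast
  \<comment> \<open>No factor is left: restriction to an empty range of indices is injective only on
    a singleton, and the sum is a nonzero constant, hence a unit.\<close>
  have "Y = {a}"
  proof (rule equalityI)
    show "Y \<subseteq> {a}"
    proof
      fix b assume "b \<in> Y"
      moreover have "restrict b {j..<m} = restrict a {j..<m}" using jm by (simp add: fun_eq_iff)
      ultimately show "b \<in> {a}" using inj_onD[OF 0(5), of b a] a by simp
    qed
  qed (use a in simp)
  moreover have "[:Poly_Mapping.single 0 (c a):] \<notin> T m"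
  proof
    assume "[:Poly_Mapping.single 0 (c a):] \<in> T m"
    hence "[:Poly_Mapping.single 0 (1 / c a):] * [:Poly_Mapping.single 0 (c a):] \<in> T m"
      by (rule rees_prime_mult[OF T(1)[OF order_refl] rees_const])
    moreover have "[:Poly_Mapping.single 0 (1 / c a):] * [:Poly_Mapping.single 0 (c a):] = (1 :: ('n, 'k) mpoly poly)"
      using 0(6)[OF a] by (simp add: Poly_Mapping.mult_single one_pCons single_one)
    ultimately show False using rees_prime_one[OF T(1)[of m]] by simp
  qed
  ultimately show ?case using jm by simp
next
  case (Suc k)
  hence jm: "j < m" by simp
  have Tj: "rees_prime V (T j)" and TS: "rees_prime V (T (Suc j))" using T(1) jm by simp_all
  have xr: "x i \<in> rees V" if "i < m" for i using rees_prime_subset[OF T(1)[of "Suc i"] x(1)[OF that]] that by simp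
  define e where "e = Min ((\<lambda>a. a j) ` Y)"
  have e_le: "e \<le> a j" if "a \<in> Y" for a unfolding e_def using that Suc.prems by simp
  have "e \<in> (\<lambda>a. a j) ` Y" unfolding e_def using Suc.prems by (intro Min_in) simp_all
  then obtain a0 where a0: "a0 \<in> Y" "a0 j = e" by blast
  define Y0 where "Y0 = {a \<in> Y. a j = e}"
  define g where "g a = [:Poly_Mapping.single 0 (c a):] * (\<Prod>i=Suc j..<m. x i ^ a i)" for a
  have gr: "g a \<in> rees V" for a unfolding g_def by (intro rees_mult rees_const rees_prod rees_power xr) simp
  define S' where "S' = (\<Sum>a\<in>Y. x j ^ (a j - e) * g a)"
  define R where "R = (\<Sum>a\<in>Y - Y0. x j ^ (a j - e - 1) * g a)"
  have S'r: "S' \<in> rees V" and Rr: "R \<in> rees V" unfolding S'_def R_def using xr[OF jm] gr by (intro rees_sum rees_mult rees_power; simp)+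
  have g0: "(\<Sum>a\<in>Y0. g a) \<notin> T (Suc j)"
    unfolding g_def
  proof (rule Suc.hyps(1))
    show "k = m - Suc j" "Suc j \<le> m" using Suc.hyps(2) jm by simp_all
    show "finite Y0" "Y0 \<noteq> {}" using Suc.prems a0 unfolding Y0_def by auto
    show "c a \<noteq> 0" if "a \<in> Y0" for a using that Suc.prems(5) unfolding Y0_def by simp
    show "inj_on (\<lambda>a. restrict a {Suc j..<m}) Y0"
    proof (rule inj_onI)
      fix a b assume a: "a \<in> Y0" and b: "b \<in> Y0" and eq: "restrict a {Suc j..<m} = restrict b {Suc j..<m}"
      have "a i = b i" if "i \<in> {j..<m}" for i
      proof (cases "i = j")
        case True
        thus ?thesis using a b unfolding Y0_def by simp
      next
        case False
        thus ?thesis using fun_cong[OF eq, of i] that by simp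
      qed
      hence "restrict a {j..<m} = restrict b {j..<m}" by (rule restrict_ext)
      thus "a = b" using Suc.prems(4) a b unfolding Y0_def inj_on_def by blast
    qed
  qed
  have S: "(\<Sum>a\<in>Y. [:Poly_Mapping.single 0 (c a):] * (\<Prod>i=j..<m. x i ^ a i)) = x j ^ e * S'"
    unfolding S'_def sum_distrib_left
  proof (rule sum.cong[OF refl])
    fix a assume "a \<in> Y"
    hence "x j ^ a j = x j ^ e * x j ^ (a j - e)" using e_le by (simp add: power_add[symmetric])
    thus "[:Poly_Mapping.single 0 (c a):] * (\<Prod>i=j..<m. x i ^ a i) = x j ^ e * (x j ^ (a j - e) * g a)"
      unfolding g_def prod.atLeast_Suc_lessThan[OF jm] by (simp only: mult_ac)
  qed
  have split: "S' = (\<Sum>a\<in>Y0. g a) + x j * R"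
  proof -
    have "S' = (\<Sum>a\<in>Y - Y0. x j ^ (a j - e) * g a) + (\<Sum>a\<in>Y0. x j ^ (a j - e) * g a)"
      unfolding S'_def by (rule sum.subset_diff) (use Suc.prems in \<open>auto simp: Y0_def\<close>)
    also have "(\<Sum>a\<in>Y0. x j ^ (a j - e) * g a) = (\<Sum>a\<in>Y0. g a)"
      by (rule sum.cong) (simp_all add: Y0_def)
    also have "(\<Sum>a\<in>Y - Y0. x j ^ (a j - e) * g a) = x j * R"
      unfolding R_def sum_distrib_left
    proof (rule sum.cong[OF refl])
      fix a assume "a \<in> Y - Y0"
      hence "e < a j" using e_le[of a] unfolding Y0_def by auto
      hence "x j ^ (a j - e) = x j * x j ^ (a j - e - 1)" by (simp add: power_Suc[symmetric] Suc_diff_Suc)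
      thus "x j ^ (a j - e) * g a = x j * (x j ^ (a j - e - 1) * g a)" by (simp only: mult_ac)
    qed
    finally show ?thesis by (simp only: add.commute)
  qed
  show ?case
  proof
    assume "(\<Sum>a\<in>Y. [:Poly_Mapping.single 0 (c a):] * (\<Prod>i=j..<m. x i ^ a i)) \<in> T j"
    hence "x j ^ e \<in> T j \<or> S' \<in> T j"
      unfolding S by (rule rees_prime_disj[OF Tj rees_power[OF xr[OF jm]] S'r])
    hence "S' \<in> T j" using rees_prime_power[OF Tj xr[OF jm]] x(2)[OF jm] by blast
    hence "S' \<in> T (Suc j)" using T(2)[OF jm] by blast
    moreover have "(- R) * x j \<in> T (Suc j)"
      by (rule rees_prime_mult[OF TS rees_uminus[OF Rr] x(1)[OF jm]])
    ultimately have "S' + (- R) * x j \<in> T (Suc j)" by (rule rees_prime_add[OF TS])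
    moreover have "S' + (- R) * x j = (\<Sum>a\<in>Y0. g a)" unfolding split by (simp add: mult.commute)
    ultimately show False using g0 by simp
  qed
qed

text \<open>These exponents are minimal in \<open>pexps V n\<close>, so they are sums of exactly n
  generators, bounded by \<open>n * K\<close>, and pairwise incomparable. All but one coordinate
  therefore determine them, which accounts for the exponent \<open>CARD('n) - 1\<close>.\<close>

lemma card_fiber_exps:
  fixes V :: "('n::finite \<Rightarrow>\<^sub>0 nat) set"
  assumes "\<And>v i. v \<in> V \<Longrightarrow> lookup v i \<le> K"
  shows "finite (pexps V n - mexps V n) \<and> card (pexps V n - mexps V n) \<le> (n * K + 1) ^ (CARD('n) - 1)"
proof -
  obtain i0 :: 'n where True by blast
  let ?W = "pexps V n - mexps V n"
  let ?r = "\<lambda>v :: 'n \<Rightarrow>\<^sub>0 nat. restrict (lookup v) (UNIV - {i0})"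
  have bd: "lookup v i \<le> n * K" if vW: "v \<in> ?W" for v i
  proof -
    obtain u where u: "u \<in> nsum V n" "ple u v" using vW unfolding pexps_def upc_def by blast
    have "v = (v - u) + u" using ple_diff_add[OF u(2)] by (simp add: add.commute)
    moreover have "u \<in> pexps V n" unfolding pexps_def using u(1) subset_upc by blast
    ultimately have "v - u = 0" using vW unfolding mexps_def by blast
    hence "v = u" using \<open>v = (v - u) + u\<close> by simp
    thus ?thesis using nsum_bound[OF assms u(1)] by simp
  qed
  have le: "u = v" if uv: "u \<in> ?W" "v \<in> ?W" "?r u = ?r v" "lookup u i0 \<le> lookup v i0" for u v
  proof -
    have "lookup u i = lookup v i" if "i \<noteq> i0" for i using fun_cong[OF uv(3), of i] that by simp
    hence "ple u v" unfolding ple_def using uv(4) by (metis order_refl)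
    from ple_diff_add[OF this] have *: "v = (v - u) + u" by (simp add: add.commute)
    hence "v - u = 0" using uv(1,2) unfolding mexps_def by blast
    thus ?thesis using * by simp
  qed
  have inj: "inj_on ?r ?W"
  proof (rule inj_onI)
    fix u v assume "u \<in> ?W" "v \<in> ?W" "?r u = ?r v"
    thus "u = v" using le[of u v] le[of v u] by (metis linear)
  qed
  have sub: "?r ` ?W \<subseteq> PiE (UNIV - {i0}) (\<lambda>_. {..n * K})" using bd by (intro image_subsetI) (auto intro!: restrict_PiE_iff[THEN iffD2])
  have finP: "finite (PiE (UNIV - {i0}) (\<lambda>_ :: 'n. {..n * K}))" by (intro finite_PiE) simp_all
  have "card ?W \<le> card (PiE (UNIV - {i0}) (\<lambda>_ :: 'n. {..n * K}))" by (rule card_inj_on_le[OF inj sub finP])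
  also have "\<dots> = (n * K + 1) ^ (CARD('n) - 1)" by (simp add: card_PiE card_Diff_singleton)
  finally have "card ?W \<le> (n * K + 1) ^ (CARD('n) - 1)" .
  moreover have "finite ?W" using finite_imageD[OF finite_subset[OF sub finP] inj] .
  ultimately show ?thesis by blast
qed


text \<open>The \<open>(N + 1)\<^sup>m\<close> products of powers at most \<open>N\<close> of the elements separating a chain of length
  \<open>m\<close> are independent, but they live in a space of dimension of order \<open>N\<^sup>d\<close>.\<close>

lemma krull_dim_fib_le:
  fixes V :: "('n::finite \<Rightarrow>\<^sub>0 nat) set"
  assumes "finite V"
  shows "krull_dim (fib V :: (nat \<Rightarrow> ('n, 'k::field) loc_mpoly set) ring) \<le> enat CARD('n)"
  unfolding krull_dim_def
proof (rule Sup_least)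
  let ?F = "fib V :: (nat \<Rightarrow> ('n, 'k) loc_mpoly set) ring"
  fix h assume "h \<in> {enat n | n. \<exists>P. (\<forall>i\<le>n. primeideal (P i) ?F) \<and> (\<forall>i<n. P i \<subset> P (Suc i))}"
  then obtain m P where hm: "h = enat m" and P: "\<And>i. i \<le> m \<Longrightarrow> primeideal (P i) ?F" "\<And>i. i < m \<Longrightarrow> P i \<subset> P (Suc i)" by blast
  define d where "d = CARD('n)"
  have dpos: "d > 0" unfolding d_def by simp
  have "\<not> d < m"
  proof
    assume dm: "d < m"
    define T where "T i = {p \<in> rees V. hfib V p \<in> P i}" for i
    have T1: "rees_prime V (T i)" if "i \<le> m" for i unfolding T_def by (rule rees_prime_primeideal[OF P(1)[OF that]])
    have T2: "T i \<subseteq> T (Suc i)" if "i < m" for i using P(2)[OF that] unfolding T_def by blast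
    have "\<exists>p :: ('n, 'k) mpoly poly. i < m \<longrightarrow> p \<in> T (Suc i) \<and> p \<notin> T i" for i
    proof (cases "i < m")
      case True
      then obtain y where y: "y \<in> P (Suc i)" "y \<notin> P i" using P(2) by blast
      have "P (Suc i) \<subseteq> carrier ?F"
        using P(1)[of "Suc i"] True by (intro additive_subgroup.a_subset ideal.axioms(1) primeideal.axioms(1)) simp
      hence "y \<in> hfib V ` rees V" using y(1) unfolding carrier_fib by (rule subsetD)
      then obtain p :: "('n, 'k) mpoly poly" where "y = hfib V p" "p \<in> rees V" by (elim imageE)
      thus ?thesis using y unfolding T_def by (intro exI[of _ p]) simp
    qed simp
    hence "\<forall>i. \<exists>p :: ('n, 'k) mpoly poly. i < m \<longrightarrow> p \<in> T (Suc i) \<and> p \<notin> T i" ..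
    from choice[OF this] obtain x :: "nat \<Rightarrow> ('n, 'k) mpoly poly" where "\<forall>i. i < m \<longrightarrow> x i \<in> T (Suc i) \<and> x i \<notin> T i" ..
    hence x: "\<And>i. i < m \<Longrightarrow> x i \<in> T (Suc i)" "\<And>i. i < m \<Longrightarrow> x i \<notin> T i" by simp_all
    have xr: "x i \<in> rees V" if "i < m" for i using x(1)[OF that] unfolding T_def by simp
    obtain K where K: "\<And>v i. v \<in> V \<Longrightarrow> lookup v i \<le> K" using exps_bound_obtain[OF assms] by blast
    define D where "D = (\<Sum>i<m. Polynomial.degree (x i))"
    have D: "Polynomial.degree (x i) \<le> D" if "i < m" for i unfolding D_def using that by (intro member_le_sum) simp_all
    \<comment> \<open>Chosen to close the estimate: with t = m N D, the factors t + 1 and t K + 1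
      are at most m D + 1 and m D K + 1 times N + 1. The number of equations is then at most N (N +
      1)^d, which is less than the (N + 1)^m unknowns as soon as d < m.\<close>
    define N where "N = (m * D + 1) * (m * D * K + 1) ^ (d - 1)"
    define t where "t = m * (N * D)"
    define Y0 where "Y0 = PiE {0..<m} (\<lambda>_. {..N})"
    have finY0: "finite Y0" unfolding Y0_def by (intro finite_PiE) simp_all
    have cardY0: "card Y0 = (N + 1) ^ m" unfolding Y0_def by (simp add: card_PiE)
    define p where "p a = (\<Prod>i=0..<m. x i ^ a i)" for a
    have pr: "p a \<in> rees V" for a unfolding p_def by (intro rees_prod rees_power xr) simp
    have degp: "Polynomial.degree (p a) \<le> t" if "a \<in> Y0" for a
    proof -
      have "Polynomial.degree (\<Prod>i=0..<m. x i ^ a i) \<le> (\<Sum>i=0..<m. Polynomial.degree (x i ^ a i))"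
        using degree_prod_sum_le[of "{0..<m}" "\<lambda>i. x i ^ a i"] by (simp add: o_def)
      also have "\<dots> \<le> (\<Sum>i=0..<m. N * D)"
      proof (rule sum_mono)
        fix i assume i: "i \<in> {0..<m}"
        have "a i \<le> N" using that i unfolding Y0_def by (auto simp: PiE_iff)
        have "Polynomial.degree (x i ^ a i) \<le> Polynomial.degree (x i) * a i" by (rule degree_power_le)
        also have "\<dots> \<le> D * N" using D[of i] i \<open>a i \<le> N\<close> by (intro mult_le_mono) simp_all
        finally show "Polynomial.degree (x i ^ a i) \<le> N * D" by (simp add: mult.commute)
      qed
      also have "\<dots> = t" by (simp add: t_def)
      finally show ?thesis by (simp add: p_def)
    qed
    define B where "B = (SIGMA n:{..t}. pexps V n - mexps V n)"
    have fc: "finite (pexps V n - mexps V n)" "card (pexps V n - mexps V n) \<le> (n * K + 1) ^ (d - 1)" for n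
      using card_fiber_exps[of V K n] K unfolding d_def by simp_all
    have finB: "finite B" unfolding B_def using fc by (intro finite_SigmaI) simp_all
    have "card B = (\<Sum>n\<le>t. card (pexps V n - mexps V n))" unfolding B_def using fc by (intro card_SigmaI) simp_all
    also have "\<dots> \<le> (\<Sum>n\<le>t. (t * K + 1) ^ (d - 1))"
    proof (rule sum_mono)
      fix n assume "n \<in> {..t}"
      hence "(n * K + 1) ^ (d - 1) \<le> (t * K + 1) ^ (d - 1)" by (intro power_mono add_mono mult_le_mono) simp_all
      thus "card (pexps V n - mexps V n) \<le> (t * K + 1) ^ (d - 1)" using fc(2)[of n] by (rule le_trans[rotated])
    qed
    also have "\<dots> = (t + 1) * (t * K + 1) ^ (d - 1)" by simp
    also have "\<dots> \<le> ((m * D + 1) * (N + 1)) * ((m * D * K + 1) * (N + 1)) ^ (d - 1)"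
      by (intro mult_le_mono power_mono) (simp_all add: t_def algebra_simps)
    also have "\<dots> = N * ((N + 1) * (N + 1) ^ (d - 1))"
      unfolding power_mult_distrib N_def by (simp only: mult_ac)
    also have "(N + 1) * (N + 1) ^ (d - 1) = (N + 1) ^ d" using dpos by (cases d) simp_all
    also have "N * (N + 1) ^ d < (N + 1) ^ Suc d" by simp
    also have "\<dots> \<le> (N + 1) ^ m" using dm by (intro power_increasing) simp_all
    finally have "card B < card Y0" unfolding cardY0 .
    from homogeneous_system_solution[OF finB finY0 this, of "\<lambda>a (n, v). lookup (Polynomial.coeff (p a) n) v"]
    obtain c :: "(nat \<Rightarrow> nat) \<Rightarrow> 'k" where c: "\<exists>a\<in>Y0. c a \<noteq> 0"
      "\<forall>b\<in>B. (\<Sum>a\<in>Y0. c a * (case b of (n, v) \<Rightarrow> lookup (Polynomial.coeff (p a) n) v)) = 0" by (elim exE conjE)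
    define Y where "Y = {a \<in> Y0. c a \<noteq> 0}"
    define S where "S = (\<Sum>a\<in>Y. [:Poly_Mapping.single 0 (c a):] * p a)"
    have "S \<notin> T 0"
      unfolding S_def p_def
    proof (rule rees_prime_chain_independent[where T = T and x = x and m = m and j = 0 and V = V, OF T1 T2 x])
      show "finite Y" "Y \<noteq> {}" using finY0 c(1) unfolding Y_def by auto
      show "c a \<noteq> 0" if "a \<in> Y" for a using that unfolding Y_def by simp
      show "inj_on (\<lambda>a. restrict a {0..<m}) Y"
      proof (rule inj_onI)
        fix a b assume ab: "a \<in> Y" "b \<in> Y" and eq: "restrict a {0..<m} = restrict b {0..<m}"
        have "restrict f {0..<m} = f" if "f \<in> Y" for f
        proof -
          have "f \<in> Y0" using that unfolding Y_def by simp
          thus ?thesis unfolding Y0_def by (rule PiE_restrict)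
        qed
        thus "a = b" using ab eq by simp
      qed
    qed simp_all
    \<comment> \<open>The equations kill all coefficients of \<open>S\<close> at exponents outside
      \<open>mexps\<close> up to degree \<open>t\<close>, and no product reaches a higher degree.
      Thus \<open>S\<close> maps to 0 in the fiber ring.\<close>
    moreover have "S \<in> T 0"
    proof (rule rees_prime_mexps[OF T1[OF le0]])
      show Sr: "S \<in> rees V" unfolding S_def by (intro rees_sum rees_mult rees_const pr)
      fix n show "keys (Polynomial.coeff S n) \<subseteq> mexps V n"
      proof (rule subsetI, rule ccontr)
        fix v assume v: "v \<in> keys (Polynomial.coeff S n)" and nv: "v \<notin> mexps V n"
        have lk: "lookup (Polynomial.coeff S n) v = (\<Sum>a\<in>Y. c a * lookup (Polynomial.coeff (p a) n) v)"
          unfolding S_def by (simp add: Polynomial.coeff_sum lookup_sum lookup_single_0_mult)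
        also have "\<dots> = (\<Sum>a\<in>Y0. c a * lookup (Polynomial.coeff (p a) n) v)"
          unfolding Y_def using finY0 by (intro sum.mono_neutral_left) auto
        finally have lk: "lookup (Polynomial.coeff S n) v = (\<Sum>a\<in>Y0. c a * lookup (Polynomial.coeff (p a) n) v)" .
        have "(\<Sum>a\<in>Y0. c a * lookup (Polynomial.coeff (p a) n) v) = 0"
        proof (cases "n \<le> t")
          case True
          hence "(n, v) \<in> B" unfolding B_def using nv v rees_coeff[OF Sr, of n] by blast
          thus ?thesis using c(2) by fastforce
        next
          case False
          hence "Polynomial.coeff (p a) n = 0" if "a \<in> Y0" for a using degp[OF that] by (intro coeff_eq_0) linarith
          thus ?thesis by (intro sum.neutral) simp
        qed
        thus False using v lk by (simp add: in_keys_iff)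
      qed
    qed
    ultimately show False by blast
  qed
  thus "h \<le> enat CARD('n)" unfolding hm d_def by simp
qed

section \<open>Lower bound for the dimension: flags of faces of a bounded facet\<close>

lemma polytope_flag:
  fixes K :: "'a::euclidean_space set"
  assumes "polytope K" "aff_dim K = int m - 1"
  shows "\<exists>G. G 0 = {} \<and> G m = K \<and> (\<forall>i\<le>m. G i face_of K) \<and> (\<forall>i<m. G i \<subset> G (Suc i))"
  using assms
proof (induction m arbitrary: K)
  case 0
  hence "K = {}" by (simp add: aff_dim_empty)
  thus ?case by (intro exI[of _ "\<lambda>_. {}"]) simp
next
  case (Suc m)
  \<comment> \<open>The index is the dimension plus one, so that the chain starts with the empty
    face in dimension -1; below a point there is no facet in the library's sense, and the empty face
    is taken directly.\<close>
  have "\<exists>F. F face_of K \<and> F \<noteq> K \<and> aff_dim F = int m - 1"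
  proof (cases "m = 0")
    case True
    have "K \<noteq> {}" using Suc.prems(2) True by auto
    thus ?thesis using True by (intro exI[of _ "{}"]) simp
  next
    case False
    then obtain F where "F facet_of K" using polytope_facet_exists[OF Suc.prems(1)] Suc.prems(2) by auto
    hence "F face_of K" "aff_dim F = aff_dim K - 1" unfolding facet_of_def by simp_all
    thus ?thesis using Suc.prems(2) by (intro exI[of _ F]) auto
  qed
  then obtain F where F: "F face_of K" "F \<noteq> K" "aff_dim F = int m - 1" by blast
  have "polytope F" using Suc.prems(1) F(1) face_of_polytope_polytope by blast
  from Suc.IH[OF this F(3)] obtain G where G: "G 0 = {}" "G m = F" "\<forall>i\<le>m. G i face_of F" "\<forall>i<m. G i \<subset> G (Suc i)" by blast
  have "F \<subset> K" using F face_of_imp_subset by blast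
  show ?case
  proof (intro exI[of _ "\<lambda>i. if i \<le> m then G i else K"] conjI allI impI)
    fix i
    show "(if i \<le> m then G i else K) face_of K" if "i \<le> Suc m"
      using G(3) face_of_trans[OF _ F(1)] face_of_refl[OF polytope_imp_convex[OF Suc.prems(1)]] by simp
    show "(if i \<le> m then G i else K) \<subset> (if Suc i \<le> m then G (Suc i) else K)" if "i < Suc m"
    proof (cases "i = m")
      case True
      thus ?thesis using G(2) \<open>F \<subset> K\<close> by simp
    next
      case False
      thus ?thesis using that G(4) by simp
    qed
  qed (use G(1) in simp_all)
qed

definition face_exps :: "('n::finite \<Rightarrow>\<^sub>0 nat) set \<Rightarrow> (real ^ 'n) set \<Rightarrow> nat \<Rightarrow> ('n \<Rightarrow>\<^sub>0 nat) set" where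
  "face_exps V G n = {v. if n = 0 then v = 0 else v \<in> pexps V n \<and> (1 / real n) *\<^sub>R real_exp v \<in> G}"

text \<open>The normal of a bounded facet is strictly positive, so adding a nonzero exponent leaves
  the facet; hence nothing in \<open>mexps\<close> lies over it. The face condition is that of
  \<open>G\<close> itself, because the rescaled sum is a proper convex combination of the rescaled
  summands.\<close>

lemma fib_face_face_exps:
  fixes V :: "('n::finite \<Rightarrow>\<^sub>0 nat) set" and b :: "real ^ 'n"
  assumes V: "finite V" "V \<noteq> {}" and F: "facet_ineq (NP V 1) F b c" and bd: "bounded F" and G: "G face_of F"
  shows "fib_face V (face_exps V G)"
proof -
  have bpos: "0 < b $ i" for i by (rule facet_ineq_bounded_pos[OF V F bd])
  have FP: "F face_of NP V 1" and Feq: "F = {x. x \<bullet> b = c} \<inter> NP V 1" and Pc: "\<And>x. x \<in> NP V 1 \<Longrightarrow> c \<le> x \<bullet> b"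
    using F unfolding facet_ineq_def facet_of_def by auto
  have GP: "G face_of NP V 1" by (rule face_of_trans[OF G FP])
  have GF: "x \<bullet> b = c" if "x \<in> G" for x using that face_of_imp_subset[OF G] Feq by blast
  have inP: "(1 / real n) *\<^sub>R real_exp v \<in> NP V 1" if "v \<in> pexps V n" "n > 0" for v n
    using pexps_imp_NP[OF V(1) that(1)] NP_divide_iff[OF that(2)] by blast
  have nm: "v \<notin> mexps V n" if v: "v \<in> face_exps V G n" for v n
  proof
    assume "v \<in> mexps V n"
    then obtain u w where uw: "v = u + w" "u \<noteq> 0" "w \<in> pexps V n" unfolding mexps_def by blast
    show False
    proof (cases "n = 0")
      case True
      hence "pdeg (u + w) = 0" using v uw(1) unfolding face_exps_def by simp
      thus False using uw(2) by (simp add: pdeg_add)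
    next
      case False
      have n: "n > 0" using False by simp
      have "(1 / real n) *\<^sub>R real_exp v \<in> G" using v False unfolding face_exps_def by simp
      from GF[OF this] have "((1 / real n) *\<^sub>R real_exp v) \<bullet> b = c" .
      moreover have "c \<le> ((1 / real n) *\<^sub>R real_exp w) \<bullet> b" by (rule Pc[OF inP[OF uw(3) n]])
      ultimately have "(1 / real n) * (real_exp u \<bullet> b) \<le> 0" unfolding uw(1) real_exp_add by (simp add: inner_add_left distrib_left)
      hence "real_exp u \<bullet> b \<le> 0" using False by (simp add: mult_le_0_iff divide_le_0_iff)
      moreover have "\<exists>i. lookup u i \<noteq> 0"
      proof (rule ccontr)
        assume "\<nexists>i. lookup u i \<noteq> 0"
        hence "u = 0" by (intro poly_mapping_eqI) simp
        thus False using uw(2) by simp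
      qed
      then obtain i where "lookup u i \<noteq> 0" ..
      hence "0 < real_exp u \<bullet> b"
        unfolding inner_vec_def using bpos by (intro sum_pos2[of _ i]) (simp_all add: less_imp_le)
      ultimately show False by simp
    qed
  qed
  have sub: "face_exps V G n \<subseteq> pexps V n" for n unfolding face_exps_def by (cases "n = 0") auto
  have add: "v + w \<in> face_exps V G (n + m) \<longleftrightarrow> v \<in> face_exps V G n \<and> w \<in> face_exps V G m"
    if v: "v \<in> pexps V n" and w: "w \<in> pexps V m" for v w n m
  proof -
    have zero: "v + w \<in> face_exps V G m \<longleftrightarrow> v = 0 \<and> w \<in> face_exps V G m" if "w \<in> pexps V m" for v w m
    proof
      assume "v + w \<in> face_exps V G m"
      hence "v + w \<notin> mexps V m" by (rule nm)
      hence "v = 0" using that unfolding mexps_def by blast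
      thus "v = 0 \<and> w \<in> face_exps V G m" using \<open>v + w \<in> face_exps V G m\<close> by simp
    qed simp
    show ?thesis
    proof (cases "n = 0 \<or> m = 0")
      case True
      thus ?thesis
      proof
        assume "n = 0"
        thus ?thesis using zero[OF w, of v] by (simp add: face_exps_def[of _ _ 0])
      next
        assume "m = 0"
        thus ?thesis using zero[OF v, of w] by (auto simp: face_exps_def[of _ _ 0] add.commute)
      qed
    next
      case False
      define x where "x = (1 / real n) *\<^sub>R real_exp v"
      define y where "y = (1 / real m) *\<^sub>R real_exp w"
      \<comment> \<open>The weights are proportional to the degrees: the rescaled sum divides the
        segment from \<open>x\<close> to \<open>y\<close> in the ratio m to n.\<close>
      define s where "s = real m / (real n + real m)"
      have s: "0 < s" "s < 1" using False by (simp_all add: s_def)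
      have s1: "1 - s = real n / (real n + real m)" using False by (simp add: s_def field_simps)
      have xy: "x \<in> NP V 1" "y \<in> NP V 1" unfolding x_def y_def using inP v w False by simp_all
      have comb: "(1 / real (n + m)) *\<^sub>R real_exp (v + w) = (1 - s) *\<^sub>R x + s *\<^sub>R y"
        unfolding s1 unfolding x_def y_def s_def real_exp_add using False by (simp add: scaleR_add_right)
      have "v + w \<in> pexps V (n + m)" using v w by (rule pexps_add_mem)
      hence "v + w \<in> face_exps V G (n + m) \<longleftrightarrow> (1 - s) *\<^sub>R x + s *\<^sub>R y \<in> G"
        unfolding face_exps_def comb[symmetric] using False by simp
      also have "\<dots> \<longleftrightarrow> x \<in> G \<and> y \<in> G"
      proof
        assume g: "(1 - s) *\<^sub>R x + s *\<^sub>R y \<in> G"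
        show "x \<in> G \<and> y \<in> G"
        proof (cases "x = y")
          case True
          hence "(1 - s) *\<^sub>R x + s *\<^sub>R y = x" by (simp add: scaleR_left_diff_distrib)
          thus ?thesis using g True by simp
        next
          case False
          hence "(1 - s) *\<^sub>R x + s *\<^sub>R y \<in> open_segment x y" unfolding in_segment using s by blast
          from face_ofD[OF GP this xy g] show ?thesis .
        qed
      next
        assume "x \<in> G \<and> y \<in> G"
        thus "(1 - s) *\<^sub>R x + s *\<^sub>R y \<in> G"
          using face_of_imp_convex[OF G] s by (intro convexD) simp_all
      qed
      also have "\<dots> \<longleftrightarrow> v \<in> face_exps V G n \<and> w \<in> face_exps V G m"
        unfolding face_exps_def x_def y_def using False v w by simp
      finally show ?thesis .
    qed
  qed
  show ?thesis unfolding fib_face_def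
  proof (intro conjI allI ballI)
    show "0 \<in> face_exps V G 0" unfolding face_exps_def by simp
    show "face_exps V G n \<subseteq> pexps V n - mexps V n" for n using sub nm by blast
  qed (rule add)
qed

text \<open>With a strictly positive normal, no orthant direction fits into the facet, so the facet
  lies in the convex hull of the generators. A face of that hull is spanned by the generators in it,
  and they cannot all lie in a convex set that fails to contain the face.\<close>

lemma bounded_face_vertex:
  fixes V :: "('n::finite \<Rightarrow>\<^sub>0 nat) set" and b :: "real ^ 'n"
  assumes V: "finite V" "V \<noteq> {}" and F: "facet_ineq (NP V 1) F b c" and bd: "bounded F"
    and G': "G' face_of F" and G: "convex G" "\<not> G' \<subseteq> G"
  shows "\<exists>v\<in>V. real_exp v \<in> G' \<and> real_exp v \<notin> G"
proof -
  have bpos: "0 < b $ i" for i by (rule facet_ineq_bounded_pos[OF V F bd])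
  have FP: "F face_of NP V 1" and Feq: "F = {x. x \<bullet> b = c} \<inter> NP V 1" and Pc: "\<And>x. x \<in> NP V 1 \<Longrightarrow> c \<le> x \<bullet> b"
    using F unfolding facet_ineq_def facet_of_def by auto
  have hullP: "convex hull (real_exp ` V) \<subseteq> NP V 1"
    using NP_gen[OF V(1)] by (intro hull_minimal convex_NP) blast
  have "F \<subseteq> convex hull (real_exp ` V)"
  proof
    fix x assume x: "x \<in> F"
    hence "x \<in> NP V 1" "x \<bullet> b = c" using Feq by blast+
    then obtain z y where zy: "x = z + y" "z \<in> convex hull (real_exp ` V)" "y \<in> orthant"
      unfolding newton_eq_NP[OF V(1), symmetric] by blast
    have "c \<le> z \<bullet> b" using Pc hullP zy(2) by blast
    hence le: "y \<bullet> b \<le> 0" using \<open>x \<bullet> b = c\<close> unfolding zy(1) by (simp add: inner_add_left)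
    have y0: "0 \<le> y $ i" for i using zy(3) unfolding orthant_def by blast
    have "y $ i = 0" for i
    proof (rule ccontr)
      assume "y $ i \<noteq> 0"
      hence "0 < y $ i" using y0[of i] by simp
      hence "0 < y \<bullet> b" unfolding inner_vec_def using bpos y0 by (intro sum_pos2[of _ i]) (simp_all add: less_imp_le)
      thus False using le by simp
    qed
    hence "y = 0" by (simp add: vec_eq_iff)
    thus "x \<in> convex hull (real_exp ` V)" using zy by simp
  qed
  moreover have "G' \<subseteq> F" by (rule face_of_imp_subset[OF G'])
  ultimately have "G' face_of (convex hull (real_exp ` V))"
    using face_of_subset[OF face_of_trans[OF G' FP] _ hullP] by blast
  then obtain S where S: "S \<subseteq> real_exp ` V" "G' = convex hull S"
    using face_of_convex_hull_subset[of "real_exp ` V" G'] V(1) by (metis finite_imageI finite_imp_compact)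
  have "\<not> S \<subseteq> G" using G S(2) hull_minimal[of S G convex] by blast
  then obtain y where "y \<in> S" "y \<notin> G" by blast
  moreover have "y \<in> G'" using \<open>y \<in> S\<close> S(2) hull_subset[of S convex] by blast
  ultimately show ?thesis using S(1) by blast
qed

theorem krull_dim_fib:
  fixes V :: "('n::finite \<Rightarrow>\<^sub>0 nat) set" and b :: "real ^ 'n"
  assumes V: "finite V" "V \<noteq> {}" and F: "facet_ineq (NP V 1) F b c" and bd: "bounded F"
  shows "krull_dim (fib V :: (nat \<Rightarrow> ('n, 'k::field) loc_mpoly set) ring) = enat CARD('n)"
proof (rule antisym[OF krull_dim_fib_le[OF V(1)]])
  define d where "d = CARD('n)"
  have "F facet_of NP V 1" using F unfolding facet_ineq_def by blast
  hence FP: "F face_of NP V 1" and dim: "aff_dim F = aff_dim (NP V 1) - 1" unfolding facet_of_def by simp_all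
  have "aff_dim (NP V 1) = int d"
    using aff_dim_nonempty_interior[OF interior_NP_nonempty[OF V]] by (simp add: d_def)
  hence dimF: "aff_dim F = int d - 1" using dim by simp
  have "polytope F"
    using face_of_polyhedron_polyhedron[OF polyhedron_NP[OF V(1)] FP] bd by (simp add: polytope_eq_bounded_polyhedron)
  from polytope_flag[OF this dimF] obtain G where G: "\<forall>i\<le>d. G i face_of F" "\<forall>i<d. G i \<subset> G (Suc i)" by blast
  \<comment> \<open>Faces and primes correspond with inclusions reversed, so the flag is traversed
    from the whole facet down to the empty face. The d strict steps use that the empty face
    counts.\<close>
  define P where "P i = (face_prime V (face_exps V (G (d - i))) :: (nat \<Rightarrow> ('n, 'k) loc_mpoly set) set)" for i
  have ff: "fib_face V (face_exps V (G i))" if "i \<le> d" for i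
    by (rule fib_face_face_exps[OF V F bd]) (use G that in simp)
  have prime: "primeideal (P i) (fib V)" if "i \<le> d" for i
    unfolding P_def by (rule primeideal_face_prime[OF ff]) simp
  have strict: "P i \<subset> P (Suc i)" if i: "i < d" for i
  proof -
    define k where "k = d - Suc i"
    have k: "k < d" "d - i = Suc k" using i by (simp_all add: k_def)
    have Gk: "G k \<subset> G (Suc k)" using G(2) k(1) by simp
    have "convex (G k)" using G(1) k(1) face_of_imp_convex less_imp_le by blast
    hence "\<exists>v\<in>V. real_exp v \<in> G (Suc k) \<and> real_exp v \<notin> G k"
      using G(1) k(1) Gk by (intro bounded_face_vertex[OF V F bd]) auto
    then obtain v where v: "v \<in> V" "real_exp v \<in> G (Suc k)" "real_exp v \<notin> G k" by blast
    have "v \<in> pexps V 1" using v(1) pexps_1[of V] subset_upc by auto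
    hence vQ: "v \<in> face_exps V (G (Suc k)) 1" "v \<notin> face_exps V (G k) 1" unfolding face_exps_def using v by simp_all
    have "face_exps V (G k) n \<subseteq> face_exps V (G (Suc k)) n" for n unfolding face_exps_def using Gk by auto
    from face_prime_psubset[OF ff ff this vQ]
    have "(face_prime V (face_exps V (G (Suc k))) :: (nat \<Rightarrow> ('n, 'k) loc_mpoly set) set) \<subset> face_prime V (face_exps V (G k))"
      using k(1) by simp
    thus ?thesis unfolding P_def k(2) k_def .
  qed
  show "enat CARD('n) \<le> krull_dim (fib V :: (nat \<Rightarrow> ('n, 'k) loc_mpoly set) ring)"
    unfolding krull_dim_def d_def[symmetric]
    by (intro Sup_upper CollectI exI[of _ d] conjI refl exI[of _ P] allI impI prime strict)
qed


section \<open>The epsilon multiplicity\<close>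

text \<open>The zero ideal is treated apart: it has no generators, its polyhedron is empty without
  facets, and the saturations of its positive powers are empty as well.\<close>

lemma emeasure_out_region_limit:
  fixes V :: "('n::finite \<Rightarrow>\<^sub>0 nat) set" and I :: "('n, 'k::field) loc_mpoly set"
  assumes V: "finite V" and I: "I = mono_ideal (upc V)" and mV: "min_exps I = V"
  shows "(\<lambda>n. ennreal (card (sat (pexps V n) - pexps V n) / real n ^ CARD('n))) \<longlonglongrightarrow> emeasure lebesgue (out_region I)
    \<and> emeasure lebesgue (out_region I) < \<infinity>"
proof (cases "V = {}")
  case True
  have np: "newton_polyhedron I = {}" unfolding newton_polyhedron_def mV True by simp
  have "out_region I = {}" unfolding out_region_def np facet_ineq_def by simp
  moreover have "sat (pexps V n) = {}" if "n > 0" for n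
    using that unfolding sat_pexps unfolding True by (cases n) (simp_all add: pexps_def upc_def)
  hence "real (card (sat (pexps V n) - pexps V n)) / real n ^ CARD('n) = 0" for n by (cases "n = 0") simp_all
  hence "(\<lambda>n. ennreal (real (card (sat (pexps V n) - pexps V n)) / real n ^ CARD('n))) = (\<lambda>_. 0)"
    by (simp only: ennreal_0)
  ultimately show ?thesis by (simp only: emeasure_empty tendsto_const) simp
next
  case False
  have np: "newton_polyhedron I = NP V 1" unfolding newton_polyhedron_def mV by (rule newton_eq_NP[OF V])
  have "emeasure lebesgue (out_region I) = emeasure lebesgue (orthant
       \<inter> \<Inter> {{x. x \<bullet> b \<ge> c} | F b c. facet_ineq (NP V 1) F b c \<and> \<not> bounded F}
       \<inter> \<Union> {{x. x \<bullet> b \<le> c} | F b c. facet_ineq (NP V 1) F b c \<and> bounded F})"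
  proof (cases "max_analytic_spread I")
    case True
    thus ?thesis unfolding out_region_def np by simp
  next
    case nms: False
    have "\<not> (facet_ineq (NP V 1) F b c \<and> bounded F)" for F b c
    proof
      assume "facet_ineq (NP V 1) F b c \<and> bounded F"
      hence "analytic_spread I = enat CARD('n)"
        unfolding analytic_spread_def I using krull_dim_fib[OF V False, of F b c] by simp
      thus False using nms unfolding max_analytic_spread_def by simp
    qed
    hence nb: "{{x. x \<bullet> b \<le> c} | F b c. facet_ineq (NP V 1) F b c \<and> bounded F} = {}" by blast
    show ?thesis unfolding nb using nms unfolding out_region_def by simp
  qed
  also have "\<dots> = emeasure lebesgue (NPsat V - NP V 1)" by (rule emeasure_out_polyhedron[OF V False])
  finally show ?thesis using card_sat_diff_limit[OF V False] by simp
qed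

lemma eps_seq_mono_ideal:
  fixes V :: "('n::finite \<Rightarrow>\<^sub>0 nat) set"
  assumes "finite V"
  shows "eps_seq (mono_ideal (upc V) :: ('n, 'k::field) loc_mpoly set) n =
    fact CARD('n) * ennreal (card (sat (pexps V n) - pexps V n) / real n ^ CARD('n))"
proof -
  obtain K where K: "\<And>v i. v \<in> V \<Longrightarrow> lookup v i \<le> K" using exps_bound_obtain[OF assms] by blast
  have fin: "finite (sat (pexps V n) - pexps V n)" by (rule finite_sat_diff[OF K])
  let ?c = "card (sat (pexps V n) - pexps V n)"
  have fact: "(fact CARD('n) :: ennreal) = ennreal (fact CARD('n))"
    by (metis of_nat_fact ennreal_of_nat_eq_real_of_nat)
  have "eps_seq (mono_ideal (upc V) :: ('n, 'k) loc_mpoly set) n = ennreal (fact CARD('n) / real n ^ CARD('n)) * ennreal (real ?c)"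
    unfolding eps_seq_def ideal_pow_mono_ideal module_length_H0[OF upclosed_pexps fin]
    by (simp add: ennreal_of_nat_eq_real_of_nat)
  also have "\<dots> = ennreal (fact CARD('n) / real n ^ CARD('n) * real ?c)" by (rule ennreal_mult[symmetric]) simp_all
  also have "\<dots> = ennreal (fact CARD('n) * (real ?c / real n ^ CARD('n)))" by (simp add: field_simps)
  also have "\<dots> = fact CARD('n) * ennreal (real ?c / real n ^ CARD('n))" unfolding fact by (rule ennreal_mult) simp_all
  finally show ?thesis .
qed

theorem theorem5p1:
  fixes I :: "('n::finite, 'k::field) loc_mpoly set"
  assumes "monomial_ideal I"
  shows "eps_seq I \<longlonglongrightarrow> eps_mult I
    \<and> eps_mult I = fact CARD('n) * emeasure lebesgue (out_region I)
    \<and> (\<exists>q::rat. 0 \<le> q \<and> eps_mult I = ennreal (of_rat q))"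
proof -
  obtain V0 where "I = ideal_of_exps V0" using assms unfolding monomial_ideal_def by blast
  hence I0: "I = mono_ideal (upc V0)" unfolding ideal_of_exps_eq .
  \<comment> \<open>The given generating set may be infinite; its minimal exponents are finitely
    many by Dickson's lemma and generate the same ideal.\<close>
  define V where "V = minl (upc V0)"
  have V: "finite V" unfolding V_def by (rule finite_minl[of UNIV]) simp_all
  have I: "I = mono_ideal (upc V)" unfolding V_def upc_minl[OF upclosed_upc] by (rule I0)
  have mV: "min_exps I = V" unfolding I0 V_def by (rule min_exps_mono_ideal[OF upclosed_upc])
  define f where "f n = card (sat (pexps V n) - pexps V n)" for n
  define M where "M = emeasure lebesgue (out_region I)"
  have lim: "(\<lambda>n. ennreal (real (f n) / real n ^ CARD('n))) \<longlonglongrightarrow> M" and fin: "M < \<infinity>"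
    using emeasure_out_region_limit[OF V I mV] unfolding f_def M_def by blast+
  have fact: "(fact CARD('n) :: ennreal) = ennreal (fact CARD('n))"
    by (metis of_nat_fact ennreal_of_nat_eq_real_of_nat)
  have "(\<lambda>n. fact CARD('n) * ennreal (real (f n) / real n ^ CARD('n))) \<longlonglongrightarrow> fact CARD('n) * M"
    by (rule ennreal_tendsto_cmult[OF _ lim]) (simp add: fact)
  hence conv: "eps_seq I \<longlonglongrightarrow> fact CARD('n) * M"
    unfolding I eps_seq_mono_ideal[OF V, abs_def] f_def .
  have mult: "eps_mult I = fact CARD('n) * M"
    unfolding eps_mult_def by (rule lim_imp_Limsup[OF sequentially_bot conv])
  define L where "L = enn2real M"
  have Meq: "M = ennreal L" and L0: "0 \<le> L" using fin by (simp_all add: L_def)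
  have "(\<lambda>n. real (f n) / real n ^ CARD('n)) \<longlonglongrightarrow> L"
    using lim L0 unfolding Meq by (subst (asm) tendsto_ennreal_iff) simp_all
  \<comment> \<open>A subsequence suffices here: convergence is already known, so the polynomial
    along multiples of \<open>N\<close> determines the value of the limit.\<close>
  moreover obtain N where "N > 0" "evpoly (\<lambda>k. f (N * k))" using evpoly_card_sat_diff[OF V] unfolding f_def by blast
  ultimately have "L \<in> \<rat>" using evpoly_limit_rational by blast
  hence "fact CARD('n) * L \<in> \<rat>" by (intro Rats_mult) (metis Rats_of_nat of_nat_fact)
  then obtain q where q: "fact CARD('n) * L = of_rat q" by (rule Rats_cases)
  have "0 \<le> (of_rat q :: real)" unfolding q[symmetric] using L0 by simp
  hence "0 \<le> q" by simp
  moreover have "eps_mult I = ennreal (of_rat q)"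
    unfolding mult Meq fact q[symmetric] using L0 by (simp add: ennreal_mult)
  ultimately show ?thesis using conv mult unfolding M_def by metis
qed

end
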